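(* Let $m$ be an algebraic number. Suppose that $f\in\overline{\mathbb{Q}}[x]$ has degree $n$ and $f(x)\equiv x^n-1 \mod m$. If $\alpha$ is a root of $f$ and $T\in\overline{\mathbb{Q}}[x]$ is a nonconstant polynomial such that $T(\alpha^n)\neq 0$, then $$h(\alpha)\geq\frac{\omega_m(T)-\nu_\infty(T)}{n\deg T}.$$
   Context: For a number field $K$ and a place $v$ of $K$ dividing the place $p$ of $\mathbb{Q}$ (with $p$ a prime or $\infty$), let $K_v$ and $\mathbb{Q}_p$ be the completions ($\mathbb{Q}_\infty=\mathbb{R}$), let $\|\cdot\|_v$ be the unique absolute value on $K_v$ extending the $p$-adic (for $p=\infty$, the usual) absolute value on $\mathbb{Q}_p$, and set $|\cdot|_v=\|\cdot\|_v^{[K_v:\mathbb{Q}_p]/[K:\mathbb{Q}]}$. Let $\Omega_v$ be the completion of an algebraic closure of $K_v$, with $|\cdot|_v$ extended to $\Omega_v$. Write $\log^+ t=\max\{0,\log t\}$, $\log 0=-\infty$, and $0^0=1$. The logarithmic Weil height of $\alpha\in K$ is $h(\alpha)=\sum_v\log^+|\alpha|_v$, the sum over all places $v$ of $K$; it is independent of the choice of $K\ni\alpha$. For $T\in\Omega_v[x]$ let $\nu_v(T)=\log\sup\{|T(z)|_v: z\in\Omega_v,\ |z|_v=1\}$. For $T\in K[x]$ let $\nu_\infty(T)=\sum_{v\mid\infty}\nu_v(T)$, the sum over Archimedean places $v$ of $K$. For $f,g\in K[x]$ and $m\in K$, $f\equiv g\mod m$ means $\nu_v(f-g)\leq\log|m|_v$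 for all non-Archimedean places $v$ of $K$. For $m\in K$ and $T\in K[x]$, $$\omega_m(T)=-\sum_{v\nmid\infty}\log\max\left\{\left|\frac{m^kT^{(k)}(1)}{k!}\right|_v: 0\leq k\leq\deg T\right\},$$ the sum over non-Archimedean places $v$ of $K$, where $T^{(k)}$ is the $k$-th derivative. None of these notions depends on the number field $K$ containing the relevant numbers and coefficients. *)

theory Defs
  imports "HOL-Algebra.Algebraic_Closure_Type" "HOL-Analysis.Analysis"
begin

subsection \<open>Absolute values and completions of rings\<close>

definition absolute_value :: "('a, 'b) ring_scheme \<Rightarrow> ('a \<Rightarrow> real) \<Rightarrow> bool" where
  "absolute_value R v \<longleftrightarrow>
     (\<forall>x\<in>carrier R. 0 \<le> v x \<and> (v x = 0 \<longleftrightarrow> x = \<zero>\<^bsub>R\<^esub>)) \<and>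
     (\<forall>x\<in>carrier R. \<forall>y\<in>carrier R. v (x \<otimes>\<^bsub>R\<^esub> y) = v x * v y) \<and>
     (\<forall>x\<in>carrier R. \<forall>y\<in>carrier R. v (x \<oplus>\<^bsub>R\<^esub> y) \<le> v x + v y)"

definition cauchy_seqs :: "('a, 'b) ring_scheme \<Rightarrow> ('a \<Rightarrow> real) \<Rightarrow> (nat \<Rightarrow> 'a) set" where
  "cauchy_seqs R v =
     {s. range s \<subseteq> carrier R \<and> (\<forall>e>0. \<exists>N. \<forall>i\<ge>N. \<forall>j\<ge>N. v (s i \<ominus>\<^bsub>R\<^esub> s j) < e)}"

definition null_seqs :: "('a, 'b) ring_scheme \<Rightarrow> ('a \<Rightarrow> real) \<Rightarrow> (nat \<Rightarrow> 'a) set" where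
  "null_seqs R v = {s. range s \<subseteq> carrier R \<and> (\<lambda>i. v (s i)) \<longlonglongrightarrow> 0}"

definition cauchy_ring :: "('a, 'b) ring_scheme \<Rightarrow> ('a \<Rightarrow> real) \<Rightarrow> (nat \<Rightarrow> 'a) ring" where
  "cauchy_ring R v =
     \<lparr> carrier = cauchy_seqs R v,
       monoid.mult = (\<lambda>s t i. s i \<otimes>\<^bsub>R\<^esub> t i),
       one = (\<lambda>i. \<one>\<^bsub>R\<^esub>),
       ring.zero = (\<lambda>i. \<zero>\<^bsub>R\<^esub>),
       add = (\<lambda>s t i. s i \<oplus>\<^bsub>R\<^esub> t i) \<rparr>"

definition completion :: "('a, 'b) ring_scheme \<Rightarrow> ('a \<Rightarrow> real) \<Rightarrow> (nat \<Rightarrow> 'a) set ring" where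
  "completion R v = cauchy_ring R v Quot null_seqs R v"

definition completion_class ::
    "('a, 'b) ring_scheme \<Rightarrow> ('a \<Rightarrow> real) \<Rightarrow> (nat \<Rightarrow> 'a) \<Rightarrow> (nat \<Rightarrow> 'a) set" where
  "completion_class R v s = null_seqs R v +>\<^bsub>cauchy_ring R v\<^esub> s"

definition completion_embed ::
    "('a, 'b) ring_scheme \<Rightarrow> ('a \<Rightarrow> real) \<Rightarrow> 'a \<Rightarrow> (nat \<Rightarrow> 'a) set" where
  "completion_embed R v x = completion_class R v (\<lambda>i. x)"

text \<open>The limit does not depend on the Cauchy sequence representing the class.\<close>
definition completion_abs :: "('a \<Rightarrow> real) \<Rightarrow> (nat \<Rightarrow> 'a) set \<Rightarrow> real" where
  "completion_abs v A = (THE r. \<forall>s\<in>A. (\<lambda>i. v (s i)) \<longlonglongrightarrow> r)"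


subsection \<open>Number fields and their places\<close>

text \<open>Number fields are taken inside \<open>\<complex>\<close>, which contains the algebraic closure of \<open>\<rat>\<close>.\<close>

definition field_ring :: "complex set \<Rightarrow> complex ring" where
  "field_ring K = ring_of_type_algebra \<lparr> carrier := K \<rparr>"

definition number_field :: "complex set \<Rightarrow> bool" where
  "number_field K \<longleftrightarrow>
     subfield K (ring_of_type_algebra :: complex ring) \<and>
     ring.finite_dimension (ring_of_type_algebra :: complex ring) \<rat> K"

definition nf_degree :: "complex set \<Rightarrow> nat" where
  "nf_degree K = ring.dim (ring_of_type_algebra :: complex ring) \<rat> K"

definition padic_abs :: "nat \<Rightarrow> rat \<Rightarrow> real" where
  "padic_abs p q =
     (if q = 0 then 0
      else real p powi (int (multiplicity (int p) (snd (quotient_of q))) -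
                        int (multiplicity (int p) (fst (quotient_of q)))))"

text \<open>
  A place \<open>v\<close> dividing \<open>p\<close> is represented by the restriction to \<open>K\<close> of the absolute value
  \<open>\<parallel>\<cdot>\<parallel>\<^sub>v\<close>, i.e. by the unique absolute value in its class that extends the standard absolute
  value of \<open>\<rat>\<close> at \<open>p\<close>. Extensionality outside \<open>K\<close> makes distinct functions distinct places.
\<close>

definition finite_places :: "complex set \<Rightarrow> (complex \<Rightarrow> real) set" where
  "finite_places K =
     {v \<in> extensional K. absolute_value (field_ring K) v \<and>
        (\<exists>p. prime p \<and> (\<forall>q::rat. v (of_rat q) = padic_abs p q))}"

definition infinite_places :: "complex set \<Rightarrow> (complex \<Rightarrow> real) set" where
  "infinite_places K =
     {v \<in> extensional K. absolute_value (field_ring K) v \<and>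
        (\<forall>q::rat. v (of_rat q) = \<bar>of_rat q\<bar>)}"

definition places :: "complex set \<Rightarrow> (complex \<Rightarrow> real) set" where
  "places K = finite_places K \<union> infinite_places K"

definition local_field :: "complex set \<Rightarrow> (complex \<Rightarrow> real) \<Rightarrow> (nat \<Rightarrow> complex) set ring" where
  "local_field K v = completion (field_ring K) v"

text \<open>\<open>\<rat>\<^sub>p\<close> inside \<open>K\<^sub>v\<close>: the classes of Cauchy sequences of rational numbers.\<close>
definition local_base :: "complex set \<Rightarrow> (complex \<Rightarrow> real) \<Rightarrow> (nat \<Rightarrow> complex) set set" where
  "local_base K v =
     completion_class (field_ring K) v ` {s \<in> cauchy_seqs (field_ring K) v. range s \<subseteq> \<rat>}"

definition local_degree :: "complex set \<Rightarrow> (complex \<Rightarrow> real) \<Rightarrow> nat" where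
  "local_degree K v = ring.dim (local_field K v) (local_base K v) (carrier (local_field K v))"

definition place_exponent :: "complex set \<Rightarrow> (complex \<Rightarrow> real) \<Rightarrow> real" where
  "place_exponent K v = real (local_degree K v) / real (nf_degree K)"

text \<open>The normalised \<open>|x|\<^sub>v\<close> for \<open>x \<in> K\<close>.\<close>
definition nabs :: "complex set \<Rightarrow> (complex \<Rightarrow> real) \<Rightarrow> complex \<Rightarrow> real" where
  "nabs K v x = v x powr place_exponent K v"


subsection \<open>The field \<open>\<Omega>\<^sub>v\<close>\<close>

definition local_closure where
  "local_closure K v = field.alg_closure (local_field K v)"

text \<open>As \<open>K\<^sub>v\<close> is complete, its absolute value has exactly one extension to the closure.\<close>
definition local_closure_abs where
  "local_closure_abs K v =
     (SOME w. absolute_value (local_closure K v) w \<and>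
        (\<forall>x\<in>carrier (local_field K v).
            w (ring.indexed_const (local_field K v) x) = completion_abs v x))"

definition Omega where
  "Omega K v = completion (local_closure K v) (local_closure_abs K v)"

definition Omega_nabs where
  "Omega_nabs K v z = completion_abs (local_closure_abs K v) z powr place_exponent K v"

definition Omega_embed where
  "Omega_embed K v x =
     completion_embed (local_closure K v) (local_closure_abs K v)
       (ring.indexed_const (local_field K v) (completion_embed (field_ring K) v x))"


subsection \<open>Height, \<open>\<nu>\<close>, congruence and \<open>\<omega>\<close>\<close>

text \<open>Logarithm of a nonnegative real, with \<open>log 0 = -\<infinity>\<close>.\<close>
definition elog :: "real \<Rightarrow> ereal" where
  "elog t = (if t = 0 then -\<infinity> else ereal (ln t))"

definition weil_height :: "complex set \<Rightarrow> complex \<Rightarrow> ereal" where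
  "weil_height K \<alpha> = (\<Sum>\<^sub>\<infinity>v\<in>places K. max 0 (elog (nabs K v \<alpha>)))"

text \<open>
  \<open>\<nu>\<^sub>v\<close> on \<open>\<Omega>\<^sub>v[x]\<close>; polynomials over \<^const>\<open>Omega\<close> are coefficient lists with the leading
  coefficient first, as in HOL-Algebra.
\<close>
definition Omega_nu where
  "Omega_nu K v P =
     elog (SUP z \<in> {z \<in> carrier (Omega K v). Omega_nabs K v z = 1}.
             Omega_nabs K v (ring.eval (Omega K v) P z))"

definition nu :: "complex set \<Rightarrow> (complex \<Rightarrow> real) \<Rightarrow> complex poly \<Rightarrow> ereal" where
  "nu K v T = Omega_nu K v (map (Omega_embed K v) (rev (coeffs T)))"

definition nu_infinity :: "complex set \<Rightarrow> complex poly \<Rightarrow> ereal" where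
  "nu_infinity K T = (\<Sum>v\<in>infinite_places K. nu K v T)"

definition poly_cong :: "complex set \<Rightarrow> complex poly \<Rightarrow> complex poly \<Rightarrow> complex \<Rightarrow> bool" where
  "poly_cong K f g m \<longleftrightarrow> (\<forall>v\<in>finite_places K. nu K v (f - g) \<le> elog (nabs K v m))"

definition omega :: "complex set \<Rightarrow> complex \<Rightarrow> complex poly \<Rightarrow> ereal" where
  "omega K m T =
     - (\<Sum>\<^sub>\<infinity>v\<in>finite_places K.
          elog (MAX k\<in>{0..Polynomial.degree T}.
                  nabs K v (m ^ k * poly ((pderiv ^^ k) T) 1 / fact k)))"

end

theory Submission
  imports Defs
begin

text \<open>
  Apply the product formula to \<open>T(\<alpha>\<^sup>n) \<noteq> 0\<close>. At a finite place the maximum modulus principle for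
  \<open>f - (x\<^sup>n - 1)\<close>, evaluated at \<open>\<alpha>\<close>, bounds \<open>\<alpha>\<^sup>n - 1\<close> by \<open>\<bar>m\<bar>\<^sub>v max(1, \<bar>\<alpha>\<bar>\<^sub>v)\<^sup>n\<close>, and the Taylor
  expansion of \<open>T\<close> at 1 bounds \<open>T(\<alpha>\<^sup>n)\<close> by the local term of \<open>\<omega>\<^sub>m(T)\<close> times
  \<open>max(1, \<bar>\<alpha>\<bar>\<^sub>v)\<close> to the power \<open>n deg T\<close>. At an infinite place the maximum modulus principle for \<open>T\<close>
  gives the same with \<open>\<nu>\<^sub>v(T)\<close>. Summing the logarithms over all places yields the bound.

  The product formula for \<open>K\<close> reduces to that of \<open>\<rat>\<close> through the embeddings of \<open>K\<close> into an
  algebraically closed valued field above \<open>p\<close>: the local degree of a place is the number of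
  embeddings inducing it, so the product of \<open>\<bar>x\<bar>\<^sub>v\<close> over the places above \<open>p\<close> is a power of
  \<open>\<bar>N(x)\<bar>\<^sub>p\<close>. The maximum modulus principle is proved uniformly for all places:
  since \<open>\<bar>2\<bar>\<^sub>v \<ge> 1/2\<close>, splitting a polynomial into its even and odd part costs a bounded factor,
  so its values at the roots of unity of 2-power order bound its coefficients up to a factor
  polynomial in the degree.
\<close>

section \<open>Completions of valued fields\<close>

text \<open>\<open>local_closure_abs\<close> is a choice, so nothing can be said about
  \<open>Omega\<close> before an extension of the absolute value to the algebraic closure is known
  to exist. A minimal seminorm among those restricting to the given absolute value turns out to be
  multiplicative; this argument treats Archimedean and non-Archimedean places alike. The local
  degree is a dimension over a completion, whereas the product formula wants a count of embeddings.
  A sandwich joins the two. Interpolation at the conjugates that induce \<open>v\<close> makes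
  equally many powers of a primitive element locally independent at \<open>v\<close>. Weak
  approximation glues local families into one family independent over the rationals, so the local
  degrees sum to at most the degree of the primitive element. Since there are exactly that many
  conjugates, all inequalities are equalities. Local independence is phrased as a lower bound for
  rational combinations of elements of \<open>K\<close> (\<open>vindep\<close>), so that the
  argument stays inside \<open>K\<close>. The valued field receiving the embeddings is a finite
  extension of the rationals that contains the conjugates when the place is p-adic, and the complex
  numbers at infinity.\<close>

locale valued_field = field R for R (structure) +
  fixes v :: "'a \<Rightarrow> real"
  assumes absolute_value: "absolute_value R v"
begin

lemma v_nonneg [simp]: "x \<in> carrier R \<Longrightarrow> 0 \<le> v x"
  and v_eq_0_iff [simp]: "x \<in> carrier R \<Longrightarrow> v x = 0 \<longleftrightarrow> x = \<zero>"
  and v_mult [simp]: "x \<in> carrier R \<Longrightarrow> y \<in> carrier R \<Longrightarrow> v (x \<otimes> y) = v x * v y"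
  and v_add: "x \<in> carrier R \<Longrightarrow> y \<in> carrier R \<Longrightarrow> v (x \<oplus> y) \<le> v x + v y"
  using absolute_value unfolding absolute_value_def by auto

lemma v_zero [simp]: "v \<zero> = 0"
  by simp

lemma v_one [simp]: "v \<one> = 1"
proof -
  have "v \<one> = v \<one> * v \<one>"
    using v_mult[of \<one> \<one>] by simp
  then show ?thesis
    using v_eq_0_iff[of \<one>] one_not_zero by auto
qed

lemma v_minus [simp]: assumes "x \<in> carrier R" shows "v (\<ominus> x) = v x"
proof -
  have "v (\<ominus> x) * v (\<ominus> x) = v x * v x"
    using assms by (metis a_inv_closed l_minus minus_minus r_minus v_mult)
  then show ?thesis
    using assms v_nonneg[of x] v_nonneg[of "\<ominus> x"] by (metis a_inv_closed abs_of_nonneg real_sqrt_abs2)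
qed

lemma v_diff: "x \<in> carrier R \<Longrightarrow> y \<in> carrier R \<Longrightarrow> v (x \<ominus> y) \<le> v x + v y"
  using v_add[of x "\<ominus> y"] by (simp add: a_minus_def)

lemma v_diff_commute: assumes "x \<in> carrier R" "y \<in> carrier R" shows "v (x \<ominus> y) = v (y \<ominus> x)"
proof -
  have "y \<ominus> x = \<ominus> (x \<ominus> y)"
    using assms by (simp add: a_minus_def minus_add a_comm)
  then show ?thesis using assms by simp
qed

lemma v_abs_diff:
  assumes "x \<in> carrier R" "y \<in> carrier R"
  shows "\<bar>v x - v y\<bar> \<le> v (x \<ominus> y)"
proof -
  have "x = (x \<ominus> y) \<oplus> y" "y = (y \<ominus> x) \<oplus> x"
    using assms by (simp_all add: a_minus_def a_assoc l_neg)
  then have "v x \<le> v (x \<ominus> y) + v y" "v y \<le> v (y \<ominus> x) + v x"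
    using assms v_add by (metis minus_closed)+
  then show ?thesis using v_diff_commute[OF assms] by linarith
qed

lemma v_inv: assumes "x \<in> carrier R" "x \<noteq> \<zero>" shows "v (inv x) = inverse (v x)"
proof -
  have "x \<in> Units R" using assms field_Units by auto
  then have "v x * v (inv x) = 1"
    using v_mult[of x "inv x"] by (simp add: assms)
  then show ?thesis using inverse_unique by metis
qed

lemma v_nat_pow [simp]: "x \<in> carrier R \<Longrightarrow> v (x [^] (n::nat)) = v x ^ n"
  by (induction n) auto

section \<open>Cauchy sequences modulo null sequences\<close>

abbreviation Cau where "Cau \<equiv> cauchy_seqs R v"
abbreviation Nul where "Nul \<equiv> null_seqs R v"
abbreviation CR where "CR \<equiv> cauchy_ring R v"
abbreviation cls where "cls \<equiv> completion_class R v"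

lemma Cau_closed [simp]: "s \<in> Cau \<Longrightarrow> s i \<in> carrier R"
  unfolding cauchy_seqs_def by auto

lemma Nul_closed: "s \<in> Nul \<Longrightarrow> s i \<in> carrier R"
  unfolding null_seqs_def by auto

lemma CauI:
  assumes "\<And>i. s i \<in> carrier R"
    and "\<And>e. 0 < e \<Longrightarrow> \<exists>N. \<forall>i\<ge>N. \<forall>j\<ge>N. v (s i \<ominus> s j) < e"
  shows "s \<in> Cau"
  using assms unfolding cauchy_seqs_def by auto

lemma CauD: "s \<in> Cau \<Longrightarrow> 0 < e \<Longrightarrow> \<exists>N. \<forall>i\<ge>N. \<forall>j\<ge>N. v (s i \<ominus> s j) < e"
  unfolding cauchy_seqs_def by auto

lemma Cau_const [simp]: "x \<in> carrier R \<Longrightarrow> (\<lambda>i. x) \<in> Cau"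
  by (rule CauI) (auto simp: a_minus_def r_neg)

lemma Cau_convergent: assumes "s \<in> Cau" shows "convergent (\<lambda>i. v (s i))"
proof -
  have "Cauchy (\<lambda>i. v (s i))"
  proof (rule metric_CauchyI)
    fix e :: real assume "0 < e"
    from CauD[OF assms this] obtain N where "\<forall>i\<ge>N. \<forall>j\<ge>N. v (s i \<ominus> s j) < e" by blast
    then show "\<exists>M. \<forall>m\<ge>M. \<forall>n\<ge>M. dist (v (s m)) (v (s n)) < e"
      using v_abs_diff Cau_closed[OF assms] unfolding dist_real_def by (metis le_less_trans)
  qed
  then show ?thesis by (simp add: Cauchy_convergent_iff)
qed

lemma Cau_bounded: assumes "s \<in> Cau" obtains B where "0 < B" "\<And>i. v (s i) \<le> B"
proof -
  have "Bseq (\<lambda>i. v (s i))" using Cau_convergent[OF assms] convergent_imp_Bseq by blast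
  then obtain B where "0 < B" "\<forall>n. norm (v (s n)) \<le> B" by (auto simp: Bseq_def)
  then show ?thesis using that[of B] by (metis abs_le_D1 real_norm_def)
qed

lemma Cau_add: assumes "s \<in> Cau" "t \<in> Cau" shows "(\<lambda>i. s i \<oplus> t i) \<in> Cau"
proof (rule CauI)
  show "s i \<oplus> t i \<in> carrier R" for i using assms by simp
  fix e :: real assume "0 < e"
  then have "0 < e / 2" by simp
  from CauD[OF assms(1) this] CauD[OF assms(2) this] obtain N M where
    N: "\<forall>i\<ge>N. \<forall>j\<ge>N. v (s i \<ominus> s j) < e/2" and M: "\<forall>i\<ge>M. \<forall>j\<ge>M. v (t i \<ominus> t j) < e/2" by blast
  have "v ((s i \<oplus> t i) \<ominus> (s j \<oplus> t j)) < e" if "i \<ge> max N M" "j \<ge> max N M" for i j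
  proof -
    have "(s i \<oplus> t i) \<ominus> (s j \<oplus> t j) = (s i \<ominus> s j) \<oplus> (t i \<ominus> t j)"
      using assms by (simp add: a_minus_def minus_add a_ac)
    then have "v ((s i \<oplus> t i) \<ominus> (s j \<oplus> t j)) \<le> v (s i \<ominus> s j) + v (t i \<ominus> t j)"
      using assms v_add by simp
    then show ?thesis using N M that by (smt (verit) field_sum_of_halves max.bounded_iff)
  qed
  then show "\<exists>N. \<forall>i\<ge>N. \<forall>j\<ge>N. v ((s i \<oplus> t i) \<ominus> (s j \<oplus> t j)) < e" by blast
qed

lemma Cau_minus: assumes "s \<in> Cau" shows "(\<lambda>i. \<ominus> s i) \<in> Cau"
proof (rule CauI)
  show "\<ominus> s i \<in> carrier R" for i using assms by simp
  fix e :: real assume "0 < e"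
  have "v (\<ominus> s i \<ominus> \<ominus> s j) = v (s i \<ominus> s j)" for i j
  proof -
    have "\<ominus> s i \<ominus> \<ominus> s j = s j \<ominus> s i" using assms by (simp add: a_minus_def a_comm)
    then show ?thesis using assms v_diff_commute by simp
  qed
  then show "\<exists>N. \<forall>i\<ge>N. \<forall>j\<ge>N. v (\<ominus> s i \<ominus> \<ominus> s j) < e" using CauD[OF assms \<open>0 < e\<close>] by simp
qed

lemma mult_diff:
  assumes "a \<in> carrier R" "b \<in> carrier R" "c \<in> carrier R" "d \<in> carrier R"
  shows "(a \<otimes> b) \<ominus> (c \<otimes> d) = (a \<otimes> (b \<ominus> d)) \<oplus> ((a \<ominus> c) \<otimes> d)"
  using assms by algebra

text \<open>With \<open>b\<close> inverse to \<open>c\<close> and \<open>a\<close> inverse to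
  \<open>d\<close> this is 1/d - 1/c = (c - d)/(cd); it yields the Cauchy property of inverted
  sequences.\<close>

lemma inv_diff:
  assumes "a \<in> carrier R" "b \<in> carrier R" "c \<in> carrier R" "d \<in> carrier R"
  shows "(a \<otimes> b) \<otimes> (c \<ominus> d) = a \<otimes> (c \<otimes> b) \<ominus> b \<otimes> (d \<otimes> a)"
  using assms by algebra

lemma Cau_mult: assumes "s \<in> Cau" "t \<in> Cau" shows "(\<lambda>i. s i \<otimes> t i) \<in> Cau"
proof (rule CauI)
  show "s i \<otimes> t i \<in> carrier R" for i using assms by simp
  fix e :: real assume "0 < e"
  obtain B where B: "0 < B" "\<And>i. v (s i) \<le> B" using Cau_bounded[OF assms(1)] by blast
  obtain D where D: "0 < D" "\<And>i. v (t i) \<le> D" using Cau_bounded[OF assms(2)] by blast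
  have "0 < e / (2*D)" "0 < e / (2*B)" using \<open>0 < e\<close> B D by auto
  from CauD[OF assms(1) this(1)] CauD[OF assms(2) this(2)] obtain N M where
    N: "\<forall>i\<ge>N. \<forall>j\<ge>N. v (s i \<ominus> s j) < e/(2*D)" and M: "\<forall>i\<ge>M. \<forall>j\<ge>M. v (t i \<ominus> t j) < e/(2*B)" by blast
  have "v ((s i \<otimes> t i) \<ominus> (s j \<otimes> t j)) < e" if "i \<ge> max N M" "j \<ge> max N M" for i j
  proof -
    have "v ((s i \<otimes> t i) \<ominus> (s j \<otimes> t j)) \<le> v (s i) * v (t i \<ominus> t j) + v (s i \<ominus> s j) * v (t j)"
      using assms v_add[of "s i \<otimes> (t i \<ominus> t j)" "(s i \<ominus> s j) \<otimes> t j"] by (simp add: mult_diff)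
    also have "\<dots> \<le> B * v (t i \<ominus> t j) + v (s i \<ominus> s j) * D"
      using B D assms by (intro add_mono mult_right_mono mult_left_mono) auto
    also have "\<dots> < B * (e/(2*B)) + e/(2*D) * D"
      using B D N M that by (intro add_strict_mono mult_strict_left_mono mult_strict_right_mono) auto
    also have "\<dots> = e" using B D by (simp add: field_simps)
    finally show ?thesis .
  qed
  then show "\<exists>N. \<forall>i\<ge>N. \<forall>j\<ge>N. v ((s i \<otimes> t i) \<ominus> (s j \<otimes> t j)) < e" by blast
qed

lemma CR_simps [simp]:
  "carrier CR = Cau" "s \<otimes>\<^bsub>CR\<^esub> t = (\<lambda>i. s i \<otimes> t i)" "s \<oplus>\<^bsub>CR\<^esub> t = (\<lambda>i. s i \<oplus> t i)"
  "\<one>\<^bsub>CR\<^esub> = (\<lambda>i. \<one>)" "\<zero>\<^bsub>CR\<^esub> = (\<lambda>i. \<zero>)"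
  unfolding cauchy_ring_def by simp_all

lemma cring_CR: "cring CR"
proof (rule cringI)
  show "abelian_group CR"
  proof (rule abelian_groupI)
    fix x assume "x \<in> carrier CR"
    then show "\<exists>y\<in>carrier CR. y \<oplus>\<^bsub>CR\<^esub> x = \<zero>\<^bsub>CR\<^esub>"
      by (intro bexI[of _ "\<lambda>i. \<ominus> x i"]) (auto simp: Cau_minus l_neg)
  qed (auto simp: Cau_add a_ac)
  show "comm_monoid CR"
    by (rule comm_monoidI) (auto simp: Cau_mult m_ac)
qed (auto simp: l_distr)

lemma CR_minus: assumes "s \<in> Cau" shows "\<ominus>\<^bsub>CR\<^esub> s = (\<lambda>i. \<ominus> s i)"
proof -
  interpret CR: cring CR by (rule cring_CR)
  show ?thesis
    by (rule sym, rule CR.sum_zero_eq_neg) (use assms in \<open>auto simp: Cau_minus l_neg\<close>)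
qed

lemma CR_diff: assumes "s \<in> Cau" "t \<in> Cau" shows "s \<ominus>\<^bsub>CR\<^esub> t = (\<lambda>i. s i \<ominus> t i)"
  using assms by (simp add: a_minus_def CR_minus)

lemma Nul_Cau: assumes "s \<in> Nul" shows "s \<in> Cau"
proof (rule CauI)
  show c: "s i \<in> carrier R" for i using Nul_closed[OF assms] .
  fix e :: real assume "0 < e"
  have "(\<lambda>i. v (s i)) \<longlonglongrightarrow> 0" using assms unfolding null_seqs_def by simp
  from LIMSEQ_D[OF this, of "e/2"] \<open>0 < e\<close> obtain N where N: "\<forall>n\<ge>N. norm (v (s n) - 0) < e/2" by auto
  have "v (s i \<ominus> s j) < e" if "i \<ge> N" "j \<ge> N" for i j
  proof -
    have "v (s i) < e/2" "v (s j) < e/2" using N that by force+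
    then show ?thesis using v_diff[OF c c, of i j] by linarith
  qed
  then show "\<exists>N. \<forall>i\<ge>N. \<forall>j\<ge>N. v (s i \<ominus> s j) < e" by blast
qed

lemma NulI: "s \<in> Cau \<Longrightarrow> (\<lambda>i. v (s i)) \<longlonglongrightarrow> 0 \<Longrightarrow> s \<in> Nul"
  unfolding null_seqs_def cauchy_seqs_def by simp

lemma NulD: "s \<in> Nul \<Longrightarrow> (\<lambda>i. v (s i)) \<longlonglongrightarrow> 0"
  unfolding null_seqs_def by simp

lemma Nul_mult: assumes "s \<in> Cau" "t \<in> Nul" shows "(\<lambda>i. s i \<otimes> t i) \<in> Nul"
proof (rule NulI)
  show "(\<lambda>i. s i \<otimes> t i) \<in> Cau" using assms Nul_Cau Cau_mult by blast
  have "(\<lambda>i. v (s i) * v (t i)) \<longlonglongrightarrow> lim (\<lambda>i. v (s i)) * 0"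
    by (intro tendsto_mult NulD assms) (use Cau_convergent[OF assms(1)] convergent_LIMSEQ_iff in blast)
  then show "(\<lambda>i. v (s i \<otimes> t i)) \<longlonglongrightarrow> 0" using assms Nul_closed by simp
qed

lemma ideal_Nul: "ideal Nul CR"
proof (rule idealI)
  interpret CR: cring CR by (rule cring_CR)
  show "ring CR" by (rule CR.ring_axioms)
  show "subgroup Nul (add_monoid CR)"
  proof (rule CR.add.subgroupI)
    show "Nul \<subseteq> carrier CR" using Nul_Cau by auto
    have "(\<lambda>i. \<zero>) \<in> Nul" by (rule NulI) auto
    then show "Nul \<noteq> {}" by blast
    fix s assume s: "s \<in> Nul"
    then show "\<ominus>\<^bsub>CR\<^esub> s \<in> Nul"
      using NulD[OF s] Nul_Cau[OF s] by (auto intro!: NulI simp: CR_minus Cau_minus)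
    fix t assume t: "t \<in> Nul"
    have "(\<lambda>i. v (s i \<oplus> t i)) \<longlonglongrightarrow> 0"
    proof (rule tendsto_sandwich[of "\<lambda>i. 0" _ _ "\<lambda>i. v (s i) + v (t i)"])
      show "(\<lambda>i. v (s i) + v (t i)) \<longlonglongrightarrow> 0"
        using tendsto_add[OF NulD[OF s] NulD[OF t]] by simp
      show "(\<lambda>i. 0::real) \<longlonglongrightarrow> 0" by simp
    qed (use s t Nul_closed v_add in auto)
    then show "s \<oplus>\<^bsub>CR\<^esub> t \<in> Nul"
      using s t Nul_Cau by (auto intro!: NulI Cau_add)
  qed
  fix a x assume "a \<in> Nul" "x \<in> carrier CR"
  then show "x \<otimes>\<^bsub>CR\<^esub> a \<in> Nul" using Nul_mult by simp
  then show "a \<otimes>\<^bsub>CR\<^esub> x \<in> Nul"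
    using CR.m_comm[of a x] \<open>a \<in> Nul\<close> \<open>x \<in> carrier CR\<close> Nul_Cau by auto
qed

section \<open>The completion as a valued field\<close>

abbreviation Co where "Co \<equiv> completion R v"

lemma cring_Co: "cring Co"
  unfolding completion_def using ideal.quotient_is_cring[OF ideal_Nul cring_CR] .

lemma cls_hom: "cls \<in> ring_hom CR Co"
proof -
  have "cls = (+>\<^bsub>CR\<^esub>) Nul" by (simp add: completion_class_def fun_eq_iff)
  then show ?thesis using ideal.rcos_ring_hom[OF ideal_Nul] unfolding completion_def by simp
qed

lemma carrier_Co: "carrier Co = cls ` Cau"
  unfolding completion_def FactRing_def A_RCOSETS_def' completion_class_def by auto

lemma cls_closed [simp]: "s \<in> Cau \<Longrightarrow> cls s \<in> carrier Co"
  by (simp add: carrier_Co)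

lemma cls_eq_iff: assumes "s \<in> Cau" "t \<in> Cau"
  shows "cls s = cls t \<longleftrightarrow> (\<lambda>i. v (s i \<ominus> t i)) \<longlonglongrightarrow> 0"
proof -
  interpret CR: cring CR by (rule cring_CR)
  have "cls s = cls t \<longleftrightarrow> s \<ominus>\<^bsub>CR\<^esub> t \<in> Nul"
    using CR.quotient_eq_iff_same_a_r_cos[OF ideal_Nul] assms unfolding completion_class_def by simp
  also have "\<dots> \<longleftrightarrow> (\<lambda>i. v (s i \<ominus> t i)) \<longlonglongrightarrow> 0"
    using assms by (simp add: CR_diff null_seqs_def image_subset_iff)
  finally show ?thesis .
qed

lemma cls_self: assumes "s \<in> Cau" shows "s \<in> cls s"
proof -
  interpret I: ideal Nul CR by (rule ideal_Nul)
  interpret CR: cring CR by (rule cring_CR)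
  show ?thesis using I.a_rcos_self[of s] assms unfolding completion_class_def by simp
qed

lemma mem_clsD: assumes "s \<in> Cau" "t \<in> cls s" shows "t \<in> Cau" "cls t = cls s"
proof -
  interpret I: ideal Nul CR by (rule ideal_Nul)
  interpret CR: cring CR by (rule cring_CR)
  obtain h where "h \<in> Nul" and t: "t = h \<oplus>\<^bsub>CR\<^esub> s"
    using assms unfolding completion_class_def a_r_coset_def' by auto
  then show "t \<in> Cau" using Cau_add[OF Nul_Cau assms(1)] by simp
  show "cls t = cls s"
    using I.a_repr_independence'[of t s] assms unfolding completion_class_def by auto
qed

lemma cls_add: "s \<in> Cau \<Longrightarrow> t \<in> Cau \<Longrightarrow> cls s \<oplus>\<^bsub>Co\<^esub> cls t = cls (\<lambda>i. s i \<oplus> t i)"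
  using ring_hom_add[OF cls_hom] by simp

lemma cls_mult: "s \<in> Cau \<Longrightarrow> t \<in> Cau \<Longrightarrow> cls s \<otimes>\<^bsub>Co\<^esub> cls t = cls (\<lambda>i. s i \<otimes> t i)"
  using ring_hom_mult[OF cls_hom] by simp

lemma cls_one: "\<one>\<^bsub>Co\<^esub> = cls (\<lambda>i. \<one>)"
  using ring_hom_one[OF cls_hom] by simp

lemma cls_zero: "\<zero>\<^bsub>Co\<^esub> = cls (\<lambda>i. \<zero>)"
  using ring_hom_zero[OF cls_hom cring.axioms(1)[OF cring_CR] cring.axioms(1)[OF cring_Co]] by simp

lemma cls_eq_zero_iff: "s \<in> Cau \<Longrightarrow> cls s = \<zero>\<^bsub>Co\<^esub> \<longleftrightarrow> (\<lambda>i. v (s i)) \<longlonglongrightarrow> 0"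
  by (simp add: cls_zero cls_eq_iff a_minus_def)

text \<open>\<open>completion_abs\<close> is a \<open>THE\<close> over all representatives of the
  class. Two representatives differ by a null sequence, so the reverse triangle inequality gives
  them the same limit; \<open>s\<close> itself lies in the class, which makes that limit
  unique.\<close>

lemma completion_abs_cls: assumes "s \<in> Cau" shows "(\<lambda>i. v (s i)) \<longlonglongrightarrow> completion_abs v (cls s)"
proof -
  have lim: "(\<lambda>i. v (s i)) \<longlonglongrightarrow> lim (\<lambda>i. v (s i))"
    using Cau_convergent[OF assms] convergent_LIMSEQ_iff by blast
  have "completion_abs v (cls s) = lim (\<lambda>i. v (s i))"
    unfolding completion_abs_def
  proof (rule the_equality)
    show "\<forall>t\<in>cls s. (\<lambda>i. v (t i)) \<longlonglongrightarrow> lim (\<lambda>i. v (s i))"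
    proof
      fix t assume "t \<in> cls s"
      note t = mem_clsD[OF assms this]
      then have "(\<lambda>i. v (t i \<ominus> s i)) \<longlonglongrightarrow> 0" using cls_eq_iff[OF t(1) assms] by simp
      then have "(\<lambda>i. v (t i) - v (s i)) \<longlonglongrightarrow> 0"
        by (rule Lim_null_comparison[rotated]) (use v_abs_diff t assms in auto)
      from tendsto_add[OF this lim] show "(\<lambda>i. v (t i)) \<longlonglongrightarrow> lim (\<lambda>i. v (s i))" by simp
    qed
    fix r assume "\<forall>t\<in>cls s. (\<lambda>i. v (t i)) \<longlonglongrightarrow> r"
    then show "r = lim (\<lambda>i. v (s i))" using cls_self[OF assms] LIMSEQ_unique lim by blast
  qed
  then show ?thesis using lim by simp
qed

lemma completion_abs_eq: "s \<in> Cau \<Longrightarrow> (\<lambda>i. v (s i)) \<longlonglongrightarrow> r \<Longrightarrow> completion_abs v (cls s) = r"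
  using completion_abs_cls LIMSEQ_unique by blast

lemma absolute_value_Co: "absolute_value Co (completion_abs v)"
  unfolding absolute_value_def
proof (intro conjI ballI)
  fix x assume "x \<in> carrier Co"
  then obtain s where s: "s \<in> Cau" "x = cls s" by (auto simp: carrier_Co)
  have lx: "(\<lambda>i. v (s i)) \<longlonglongrightarrow> completion_abs v x"
    using completion_abs_cls[OF s(1)] by (simp add: s(2))
  show "0 \<le> completion_abs v x"
    using LIMSEQ_le_const[OF lx, of 0] s by auto
  show "(completion_abs v x = 0) = (x = \<zero>\<^bsub>Co\<^esub>)"
    using cls_eq_zero_iff[OF s(1)] lx unfolding s(2) by (metis LIMSEQ_unique)
  fix y assume "y \<in> carrier Co"
  then obtain t where t: "t \<in> Cau" "y = cls t" by (auto simp: carrier_Co)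
  have ly: "(\<lambda>i. v (t i)) \<longlonglongrightarrow> completion_abs v y"
    using completion_abs_cls[OF t(1)] by (simp add: t(2))
  show "completion_abs v (x \<otimes>\<^bsub>Co\<^esub> y) = completion_abs v x * completion_abs v y"
    unfolding s(2) t(2) cls_mult[OF s(1) t(1)]
  proof (rule completion_abs_eq[OF Cau_mult[OF s(1) t(1)]])
    show "(\<lambda>i. v (s i \<otimes> t i)) \<longlonglongrightarrow> completion_abs v (cls s) * completion_abs v (cls t)"
      using tendsto_mult[OF lx ly] s t by simp
  qed
  have "completion_abs v (cls (\<lambda>i. s i \<oplus> t i)) \<le> completion_abs v x + completion_abs v y"
    by (rule LIMSEQ_le[OF completion_abs_cls[OF Cau_add[OF s(1) t(1)]] tendsto_add[OF lx ly]])
       (use s(1) t(1) v_add in auto)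
  then show "completion_abs v (x \<oplus>\<^bsub>Co\<^esub> y) \<le> completion_abs v x + completion_abs v y"
    by (simp add: s(2) t(2) cls_add[OF s(1) t(1)])
qed

text \<open>A Cauchy sequence that is not null is eventually bounded away from zero, so inverting
  its entries preserves the Cauchy property. The entries of \<open>t\<close> are part of the
  conclusion because a later argument must see that rational entries have rational inverses.\<close>

lemma Cau_inv:
  assumes "s \<in> Cau" "\<not> (\<lambda>i. v (s i)) \<longlonglongrightarrow> 0"
  obtains t where "t \<in> Cau" "cls s \<otimes>\<^bsub>Co\<^esub> cls t = \<one>\<^bsub>Co\<^esub>"
    "\<And>i. t i = (if s i = \<zero> then \<zero> else inv (s i))"
proof -
  define t where "t i = (if s i = \<zero> then \<zero> else inv (s i))" for i
  have tc: "t i \<in> carrier R" for i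
    using assms(1) by (auto simp: t_def field_Units intro!: Units_inv_closed)
  define r where "r = completion_abs v (cls s)"
  have lim: "(\<lambda>i. v (s i)) \<longlonglongrightarrow> r" unfolding r_def by (rule completion_abs_cls[OF assms(1)])
  have "r \<ge> 0" using LIMSEQ_le_const[OF lim, of 0] assms by auto
  then have "r > 0" using assms(2) lim by (cases "r = 0") auto
  then have "\<forall>\<^sub>F i in sequentially. v (s i) > r/2" using lim by (intro order_tendstoD) auto
  then obtain N where N: "\<And>i. i \<ge> N \<Longrightarrow> v (s i) > r/2" by (auto simp: eventually_sequentially)
  have st: "s i \<otimes> t i = \<one>" "v (t i) < 2/r" if "i \<ge> N" for i
  proof -
    have nz: "s i \<noteq> \<zero>" using N[OF that] \<open>r > 0\<close> by auto
    then show "s i \<otimes> t i = \<one>" using assms(1) by (simp add: t_def field_Units)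
    have "v (t i) = inverse (v (s i))" using nz assms(1) by (simp add: t_def v_inv)
    also have "\<dots> < inverse (r/2)" using N[OF that] \<open>r > 0\<close> by (intro less_imp_inverse_less) auto
    finally show "v (t i) < 2/r" by simp
  qed
  have tC: "t \<in> Cau"
  proof (rule CauI)
    fix e :: real assume "0 < e"
    \<comment> \<open>The difference of two inverses is the difference of the entries times two
      factors below \<open>2/r\<close>; the factor \<open>(r/2)^2\<close> cancels them.\<close>
    then have "0 < e * (r/2)^2" using \<open>r > 0\<close> by simp
    from CauD[OF assms(1) this] obtain M where M: "\<forall>i\<ge>M. \<forall>j\<ge>M. v (s i \<ominus> s j) < e * (r/2)^2" by blast
    have "v (t i \<ominus> t j) < e" if "i \<ge> max N M" "j \<ge> max N M" for i j
    proof -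
      have "(t i \<otimes> t j) \<otimes> (s j \<ominus> s i) = t i \<otimes> (s j \<otimes> t j) \<ominus> t j \<otimes> (s i \<otimes> t i)"
        using inv_diff[of "t i" "t j" "s j" "s i"] assms(1) tc by simp
      also have "\<dots> = t i \<ominus> t j" using st that tc by simp
      finally have "v (t i \<ominus> t j) = v (t i) * v (t j) * v (s j \<ominus> s i)"
        using tc assms(1) by (metis v_mult m_closed minus_closed Cau_closed)
      also have "\<dots> \<le> 2/r * (2/r) * v (s j \<ominus> s i)"
        using st that tc \<open>r > 0\<close> assms(1) by (intro mult_mono) (auto simp: less_imp_le)
      also have "\<dots> < 2/r * (2/r) * (e * (r/2)^2)"
        using M that \<open>r > 0\<close> by (intro mult_strict_left_mono) auto
      also have "\<dots> = e" using \<open>r > 0\<close> by (simp add: field_simps power2_eq_square)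
      finally show ?thesis .
    qed
    then show "\<exists>N. \<forall>i\<ge>N. \<forall>j\<ge>N. v (t i \<ominus> t j) < e" by blast
  qed (rule tc)
  have "cls s \<otimes>\<^bsub>Co\<^esub> cls t = \<one>\<^bsub>Co\<^esub>"
  proof -
    have "\<forall>\<^sub>F i in sequentially. v (s i \<otimes> t i \<ominus> \<one>) = 0"
      using st by (auto simp: eventually_sequentially a_minus_def r_neg intro!: exI[of _ N])
    then have "(\<lambda>i. v (s i \<otimes> t i \<ominus> \<one>)) \<longlonglongrightarrow> 0" by (rule tendsto_eventually)
    then show ?thesis using assms(1) tC by (simp add: cls_mult cls_one cls_eq_iff Cau_mult)
  qed
  then show thesis using that[of t] tC t_def by blast
qed

lemma field_Co: "field Co"
proof (rule cring.cring_fieldI2[OF cring_Co])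
  show "\<zero>\<^bsub>Co\<^esub> \<noteq> \<one>\<^bsub>Co\<^esub>"
    using cls_eq_zero_iff[of "\<lambda>i. \<one>"] by (simp add: cls_one LIMSEQ_const_iff)
  fix a assume "a \<in> carrier Co" "a \<noteq> \<zero>\<^bsub>Co\<^esub>"
  then obtain s where s: "s \<in> Cau" "a = cls s" by (auto simp: carrier_Co)
  then have "\<not> (\<lambda>i. v (s i)) \<longlonglongrightarrow> 0" using \<open>a \<noteq> \<zero>\<^bsub>Co\<^esub>\<close> cls_eq_zero_iff by blast
  from Cau_inv[OF s(1) this] obtain t where "t \<in> Cau" "cls s \<otimes>\<^bsub>Co\<^esub> cls t = \<one>\<^bsub>Co\<^esub>" by metis
  then show "\<exists>b\<in>carrier Co. a \<otimes>\<^bsub>Co\<^esub> b = \<one>\<^bsub>Co\<^esub>" using s(2) by (intro bexI[of _ "cls t"]) auto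
qed

lemma valued_field_Co: "valued_field Co (completion_abs v)"
  by (intro valued_field.intro field_Co valued_field_axioms.intro absolute_value_Co)

lemma completion_embed_hom: "completion_embed R v \<in> ring_hom R Co"
  unfolding completion_embed_def
  by (rule ring_hom_memI) (auto simp: cls_mult cls_add cls_one)

lemma completion_abs_embed [simp]:
  "x \<in> carrier R \<Longrightarrow> completion_abs v (completion_embed R v x) = v x"
  unfolding completion_embed_def by (rule completion_abs_eq) auto

end

section \<open>Extension of absolute values to algebraic extensions\<close>

lemma le_cInf_add:
  fixes S T :: "real set"
  assumes "S \<noteq> {}" "T \<noteq> {}" and le: "\<And>x y. x \<in> S \<Longrightarrow> y \<in> T \<Longrightarrow> A \<le> x + y"
  shows "A \<le> Inf S + Inf T"
proof -
  have "A - x \<le> Inf T" if "x \<in> S" for x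
    using assms(2) le[OF that] by (intro cInf_greatest) (auto simp: algebra_simps)
  then have "A - Inf T \<le> Inf S"
    using assms(1) by (intro cInf_greatest) (auto simp: algebra_simps)
  then show ?thesis by simp
qed

text \<open>Dividing by one factor reduces the claim to a lower bound of the other set. A factor 0
  cannot be divided by, but then \<open>le\<close> already gives \<open>A \<le> 0\<close>; the same
  distinction is made for \<open>Inf T\<close>.\<close>

lemma le_cInf_mult:
  fixes S T :: "real set"
  assumes ne: "S \<noteq> {}" "T \<noteq> {}" and pos: "\<And>x. x \<in> S \<Longrightarrow> 0 \<le> x" "\<And>y. y \<in> T \<Longrightarrow> 0 \<le> y"
    and le: "\<And>x y. x \<in> S \<Longrightarrow> y \<in> T \<Longrightarrow> A \<le> x * y"
  shows "A \<le> Inf S * Inf T"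
proof -
  have T: "0 \<le> Inf T" using ne pos by (intro cInf_greatest) auto
  have 1: "A \<le> x * Inf T" if "x \<in> S" for x
  proof (cases "x = 0")
    case True
    then show ?thesis using le[OF that] ne by auto
  next
    case False
    then have "x > 0" using pos that by force
    then have "A / x \<le> Inf T"
      using ne le[OF that] by (intro cInf_greatest) (auto simp: field_simps)
    then show ?thesis using \<open>x > 0\<close> by (simp add: field_simps)
  qed
  show ?thesis
  proof (cases "Inf T = 0")
    case True
    then show ?thesis using 1 ne by auto
  next
    case False
    then have "Inf T > 0" using T by simp
    then have "A / Inf T \<le> Inf S"
      using ne 1 by (intro cInf_greatest) (auto simp: field_simps)
    then show ?thesis using \<open>Inf T > 0\<close> by (simp add: field_simps)
  qed
qed

lemma power_le_imp_base_le:
  fixes t r C :: real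
  assumes "0 < r" "\<And>k. t ^ k \<le> C * r ^ k"
  shows "t \<le> r"
proof (rule ccontr)
  assume "\<not> t \<le> r"
  then have "1 < t / r" using assms(1) by simp
  then obtain n where "C < (t / r) ^ n" using real_arch_pow by blast
  then show False using assms(2)[of n] assms(1) by (simp add: power_divide field_simps)
qed

locale field_extension_abs = field L for L (structure) +
  fixes F E :: "'a set" and u :: "'a \<Rightarrow> real"
  assumes subfield_F: "subfield F L" and subfield_E: "subfield E L" and F_subset: "F \<subseteq> E"
    and abs_u: "absolute_value (L\<lparr>carrier := F\<rparr>) u"
begin

section \<open>The tower of fields and seminorms on the larger field\<close>

lemma E_simps [simp]:
  "x \<in> E \<Longrightarrow> x \<in> carrier L" "\<zero> \<in> E" "\<one> \<in> E" "x \<in> E \<Longrightarrow> y \<in> E \<Longrightarrow> x \<oplus> y \<in> E"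
  "x \<in> E \<Longrightarrow> y \<in> E \<Longrightarrow> x \<otimes> y \<in> E" "x \<in> E \<Longrightarrow> \<ominus> x \<in> E"
  "x \<in> E \<Longrightarrow> x [^] (n::nat) \<in> E"
proof -
  note E = subringE[OF subfieldE(1)[OF subfield_E]]
  show "x \<in> E \<Longrightarrow> x \<in> carrier L" "\<zero> \<in> E" "\<one> \<in> E" "x \<in> E \<Longrightarrow> y \<in> E \<Longrightarrow> x \<oplus> y \<in> E"
   and m: "x \<in> E \<Longrightarrow> y \<in> E \<Longrightarrow> x \<otimes> y \<in> E" and "x \<in> E \<Longrightarrow> \<ominus> x \<in> E" for x y using E by auto
  show "x \<in> E \<Longrightarrow> x [^] (n::nat) \<in> E" by (induction n) (auto simp: E m)
qed

lemma E_inv: "x \<in> E \<Longrightarrow> x \<noteq> \<zero> \<Longrightarrow> inv x \<in> E" "x \<in> E \<Longrightarrow> x \<noteq> \<zero> \<Longrightarrow> x \<otimes> inv x = \<one>"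
  using subfield_m_inv[OF subfield_E, of x] by auto

lemma F_simps [simp]:
  "x \<in> F \<Longrightarrow> x \<in> E" "\<zero> \<in> F" "\<one> \<in> F" "x \<in> F \<Longrightarrow> y \<in> F \<Longrightarrow> x \<oplus> y \<in> F"
  "x \<in> F \<Longrightarrow> y \<in> F \<Longrightarrow> x \<otimes> y \<in> F" "x \<in> F \<Longrightarrow> \<ominus> x \<in> F"
  using F_subset subringE[OF subfieldE(1)[OF subfield_F]] by auto

lemma F_inv: "x \<in> F \<Longrightarrow> x \<noteq> \<zero> \<Longrightarrow> inv x \<in> F" "x \<in> F \<Longrightarrow> x \<noteq> \<zero> \<Longrightarrow> x \<otimes> inv x = \<one>"
  using subfield_m_inv[OF subfield_F, of x] by auto

lemma u_simps [simp]:
  "x \<in> F \<Longrightarrow> 0 \<le> u x" "x \<in> F \<Longrightarrow> u x = 0 \<longleftrightarrow> x = \<zero>"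
  "x \<in> F \<Longrightarrow> y \<in> F \<Longrightarrow> u (x \<otimes> y) = u x * u y"
  and u_add: "x \<in> F \<Longrightarrow> y \<in> F \<Longrightarrow> u (x \<oplus> y) \<le> u x + u y"
  using abs_u unfolding absolute_value_def by auto

lemma u_one [simp]: "u \<one> = 1"
proof -
  have "u \<one> * u \<one> = u \<one>" using u_simps(3)[of \<one> \<one>] by simp
  then show ?thesis using u_simps(2)[of \<one>] by auto
qed

lemma u_zero [simp]: "u \<zero> = 0"
  by simp

lemma u_inv: assumes "x \<in> F" "x \<noteq> \<zero>" shows "u (inv x) * u x = 1"
  using u_simps(3)[of "inv x" x] F_inv[OF assms] assms by (simp add: m_comm)

text \<open>Submultiplicative on \<open>E\<close>, but equal to \<open>u\<close> on
  \<open>F\<close>. The value 0 outside \<open>E\<close> lets seminorms be compared as functions on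
  the whole type and keeps chains bounded below there.\<close>

definition seminorm :: "('a \<Rightarrow> real) \<Rightarrow> bool" where
  "seminorm p \<longleftrightarrow> (\<forall>x. x \<notin> E \<longrightarrow> p x = 0) \<and> (\<forall>x\<in>E. 0 \<le> p x) \<and>
     (\<forall>x\<in>E. \<forall>y\<in>E. p (x \<oplus> y) \<le> p x + p y) \<and> (\<forall>x\<in>E. \<forall>y\<in>E. p (x \<otimes> y) \<le> p x * p y) \<and>
     (\<forall>c\<in>F. p c = u c)"

lemma seminormD:
  assumes "seminorm p"
  shows "x \<notin> E \<Longrightarrow> p x = 0" "x \<in> E \<Longrightarrow> 0 \<le> p x"
    "x \<in> E \<Longrightarrow> y \<in> E \<Longrightarrow> p (x \<oplus> y) \<le> p x + p y"
    "x \<in> E \<Longrightarrow> y \<in> E \<Longrightarrow> p (x \<otimes> y) \<le> p x * p y" "c \<in> F \<Longrightarrow> p c = u c"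
  using assms unfolding seminorm_def by auto

text \<open>Submultiplicativity applied to \<open>c\<close> and to its inverse, on both of which the
  seminorm equals \<open>u\<close>, gives the two inequalities.\<close>

lemma seminorm_homogeneous:
  assumes "seminorm p" "c \<in> F" "x \<in> E"
  shows "p (c \<otimes> x) = u c * p x"
proof (cases "c = \<zero>")
  case True
  then show ?thesis using assms seminormD(5)[OF assms(1), of \<zero>] by simp
next
  case False
  note ci = F_inv[OF assms(2) False] u_inv[OF assms(2) False]
  have uc: "u c > 0" using False assms(2) by (metis u_simps(1,2) less_eq_real_def)
  have le: "p (c \<otimes> x) \<le> u c * p x"
    using seminormD(4)[OF assms(1), of c x] seminormD(5)[OF assms(1), of c] assms by simp
  have "x = inv c \<otimes> (c \<otimes> x)" using ci assms by (metis E_simps(1) F_simps(1) l_one m_assoc m_comm)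
  then have "p x \<le> u (inv c) * p (c \<otimes> x)"
    using seminormD(4)[OF assms(1), of "inv c" "c \<otimes> x"] seminormD(5)[OF assms(1), of "inv c"] assms ci by simp
  then have "u c * p x \<le> u c * (u (inv c) * p (c \<otimes> x))" using uc by (simp add: mult_left_mono)
  also have "\<dots> = p (c \<otimes> x)" using ci(3) by (metis mult.assoc mult.commute mult_1)
  finally show ?thesis using le by simp
qed

text \<open>In a field, 1 = p(1) \<le> p(x) p(1/x), so p(x) cannot vanish.\<close>

lemma seminorm_pos:
  assumes "seminorm p" "x \<in> E" "x \<noteq> \<zero>"
  shows "0 < p x"
proof -
  have "1 \<le> p x * p (inv x)"
    using seminormD(4)[OF assms(1,2), of "inv x"] seminormD(5)[OF assms(1), of \<one>] E_inv[OF assms(2,3)] by simp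
  then show ?thesis
    using seminormD(2)[OF assms(1,2)] by (cases "p x = 0") auto
qed

text \<open>For sums and products the infima at \<open>x\<close> and \<open>y\<close> are approached
  by possibly different members of the chain; the smaller of the two members serves both points at
  once.\<close>

lemma seminorm_Inf_chain:
  assumes "S \<noteq> {}" and S: "\<And>p. p \<in> S \<Longrightarrow> seminorm p"
    and chain: "\<And>p q. p \<in> S \<Longrightarrow> q \<in> S \<Longrightarrow> (\<forall>x. p x \<le> q x) \<or> (\<forall>x. q x \<le> p x)"
  shows "seminorm (\<lambda>x. INF p\<in>S. p x)"
proof -
  have bdd: "bdd_below ((\<lambda>p. p x) ` S)" for x
  proof (rule bdd_belowI2)
    fix p assume "p \<in> S"
    then show "0 \<le> p x" by (metis S seminormD(1,2) order_refl)
  qed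
  have lower: "(INF p\<in>S. p x) \<le> p x" if "p \<in> S" for p x
    using bdd that by (intro cINF_lower) auto
  show ?thesis unfolding seminorm_def
  proof (intro conjI allI ballI impI)
    fix x assume "x \<notin> E"
    then have "(\<lambda>p. p x) ` S = {0}" using assms(1) seminormD(1)[OF S] by force
    then show "(INF p\<in>S. p x) = 0" by simp
  next
    fix x assume x: "x \<in> E"
    show "0 \<le> (INF p\<in>S. p x)" using assms(1) seminormD(2)[OF S] x by (intro cINF_greatest) auto
    fix y assume y: "y \<in> E"
    show "(INF p\<in>S. p (x \<oplus> y)) \<le> (INF p\<in>S. p x) + (INF p\<in>S. p y)"
    proof (rule le_cInf_add)
      fix a b assume "a \<in> (\<lambda>p. p x) ` S" "b \<in> (\<lambda>p. p y) ` S"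
      then obtain p q where pq: "p \<in> S" "q \<in> S" "a = p x" "b = q y" by auto
      then obtain r where r: "r \<in> S" "r x \<le> p x" "r y \<le> q y"
        using chain[of p q] by (metis order_refl)
      show "(INF p\<in>S. p (x \<oplus> y)) \<le> a + b"
        using lower[OF r(1), of "x \<oplus> y"] seminormD(3)[OF S[OF r(1)] x y] r pq by linarith
    qed (use assms(1) in auto)
    show "(INF p\<in>S. p (x \<otimes> y)) \<le> (INF p\<in>S. p x) * (INF p\<in>S. p y)"
    proof (rule le_cInf_mult)
      fix a b assume "a \<in> (\<lambda>p. p x) ` S" "b \<in> (\<lambda>p. p y) ` S"
      then obtain p q where pq: "p \<in> S" "q \<in> S" "a = p x" "b = q y" by auto
      then obtain r where r: "r \<in> S" "r x \<le> p x" "r y \<le> q y"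
        using chain[of p q] by (metis order_refl)
      have "r x * r y \<le> p x * q y"
        using r seminormD(2)[OF S] x y pq by (intro mult_mono) auto
      then have "(INF p\<in>S. p (x \<otimes> y)) \<le> p x * q y"
        using lower[OF r(1), of "x \<otimes> y"] seminormD(4)[OF S[OF r(1)] x y] by linarith
      then show "(INF p\<in>S. p (x \<otimes> y)) \<le> a * b" by (simp add: pq)
    qed (use assms(1) seminormD(2)[OF S] x y in auto)
  next
    fix c assume "c \<in> F"
    then have "(\<lambda>p. p c) ` S = {u c}" using assms(1) seminormD(5)[OF S] by force
    then show "(INF p\<in>S. p c) = u c" by simp
  qed
qed

lemma exists_minimal_seminorm:
  assumes "seminorm p0"
  obtains p where "seminorm p" "\<And>q. seminorm q \<Longrightarrow> (\<And>x. q x \<le> p x) \<Longrightarrow> q = p"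
proof -
  define A where "A = {p. seminorm p}"
  \<comment> \<open>The order is reversed, so the maximal element supplied by Zorn's lemma is a
    minimal seminorm and chains are bounded by their pointwise infimum.\<close>
  define P where "P = (\<lambda>p q :: 'a \<Rightarrow> real. \<forall>x. q x \<le> p x)"
  have "\<exists>m\<in>A. \<forall>a\<in>A. P m a \<longrightarrow> a = m"
  proof (rule predicate_Zorn)
    show "partial_order_on A (relation_of P A)"
      by (rule partial_order_on_relation_ofI)
         (auto simp: P_def fun_eq_iff intro: order_trans antisym)
    fix S assume S: "S \<in> Chains (relation_of P A)"
    show "\<exists>q\<in>A. \<forall>a\<in>S. P a q"
    proof (cases "S = {}")
      case True
      then show ?thesis using assms A_def by auto
    next
      case False
      have S1: "seminorm p" if "p \<in> S" for p
        using S that unfolding Chains_def relation_of_def A_def by blast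
      have S2: "(\<forall>x. p x \<le> q x) \<or> (\<forall>x. q x \<le> p x)" if "p \<in> S" "q \<in> S" for p q
        using S that unfolding Chains_def relation_of_def P_def by blast
      have "(INF p\<in>S. p x) \<le> p x" if "p \<in> S" for p x
      proof (rule cINF_lower[OF _ that])
        show "bdd_below ((\<lambda>p. p x) ` S)"
          by (rule bdd_belowI2[of _ 0]) (use seminormD(1,2)[OF S1] in \<open>metis order_refl\<close>)
      qed
      moreover have "seminorm (\<lambda>x. INF p\<in>S. p x)"
        by (rule seminorm_Inf_chain[OF False]) (use S1 S2 in blast)+
      ultimately show ?thesis unfolding A_def P_def
        by (intro bexI[of _ "\<lambda>x. INF p\<in>S. p x"]) auto
    qed
  qed
  then show ?thesis using that unfolding A_def P_def by blast
qed

text \<open>The spectral radius lim p(x^k)^(1/k), written as the infimum of the exponential rates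
  that dominate the powers of \<open>x\<close>. In this form no limit has to be shown to
  exist.\<close>

definition spectral :: "('a \<Rightarrow> real) \<Rightarrow> 'a \<Rightarrow> real" where
  "spectral p x = (if x \<in> E then Inf {r. 0 < r \<and> (\<exists>C. \<forall>k. p (x [^] (k::nat)) \<le> C * r ^ k)} else 0)"

lemma seminorm_power_le:
  assumes "seminorm p" "x \<in> E"
  shows "p (x [^] (k::nat)) \<le> p x ^ k"
proof (induction k)
  case 0
  then show ?case using seminormD(5)[OF assms(1), of \<one>] by simp
next
  case (Suc k)
  have "p (x [^] Suc k) \<le> p (x [^] k) * p x"
    using seminormD(4)[OF assms(1), of "x [^] k" x] assms(2) by simp
  also have "\<dots> \<le> p x ^ k * p x"
    using Suc seminormD(2)[OF assms(1,2)] by (intro mult_right_mono)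
  finally show ?case by (simp add: mult.commute)
qed

lemma spectral_le:
  assumes "0 < r" "\<And>k. p (x [^] (k::nat)) \<le> C * r ^ k" "x \<in> E"
  shows "spectral p x \<le> r"
  unfolding spectral_def using assms by (auto intro!: cInf_lower bdd_belowI[of _ 0])

lemma spectral_seminorm_le:
  assumes "seminorm p" "x \<in> E" shows "spectral p x \<le> p x"
proof (rule field_le_epsilon)
  fix e :: real assume "0 < e"
  note px = seminormD(2)[OF assms]
  show "spectral p x \<le> p x + e"
  proof (rule spectral_le)
    show "p (x [^] (k::nat)) \<le> 1 * (p x + e) ^ k" for k
      using seminorm_power_le[OF assms, of k] power_mono[of "p x" "p x + e" k] px \<open>0 < e\<close> by simp
  \<comment> \<open>Rates must be positive while \<open>p x\<close> may be 0, hence the slack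
    \<open>e\<close>.\<close>
  qed (use px \<open>0 < e\<close> assms in auto)
qed

definition spectral_set :: "('a \<Rightarrow> real) \<Rightarrow> 'a \<Rightarrow> real set" where
  "spectral_set p x = {r. 0 < r \<and> (\<exists>C. \<forall>k. p (x [^] (k::nat)) \<le> C * r ^ k)}"

lemma spectral_eq: "x \<in> E \<Longrightarrow> spectral p x = Inf (spectral_set p x)"
  by (simp add: spectral_def spectral_set_def)

lemma spectral_set_nonempty:
  assumes "seminorm p" "x \<in> E" shows "p x + 1 \<in> spectral_set p x"
proof -
  note px = seminormD(2)[OF assms]
  have "p (x [^] (k::nat)) \<le> 1 * (p x + 1) ^ k" for k
    using seminorm_power_le[OF assms, of k] power_mono[of "p x" "p x + 1" k] px by simp
  then show ?thesis using px unfolding spectral_set_def by (auto intro!: exI[of _ 1])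
qed

text \<open>If the powers of \<open>x\<close> and \<open>y\<close> grow at rates \<open>r\<close>
  and \<open>s\<close>, those of the sum and of the product grow at rates \<open>r + s\<close> and
  \<open>r * s\<close>. On \<open>F\<close> the growth rate is exact because \<open>u\<close> is
  multiplicative.\<close>

lemma seminorm_spectral:
  assumes p: "seminorm p"
  shows "seminorm (spectral p)"
  unfolding seminorm_def
proof (intro conjI allI ballI impI)
  show "x \<notin> E \<Longrightarrow> spectral p x = 0" for x by (simp add: spectral_def)
  have ne: "spectral_set p x \<noteq> {}" if "x \<in> E" for x using spectral_set_nonempty[OF p that] by blast
  have pos: "0 \<le> r" if "r \<in> spectral_set p x" for r x using that by (simp add: spectral_set_def)
  show "0 \<le> spectral p x" if "x \<in> E" for x
    unfolding spectral_eq[OF that] using ne[OF that] pos by (intro cInf_greatest) auto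
  fix x assume x: "x \<in> E"
  { fix y assume y: "y \<in> E"
    show "spectral p (x \<oplus> y) \<le> spectral p x + spectral p y"
      unfolding spectral_eq[OF x] spectral_eq[OF y]
    proof (rule le_cInf_add[OF ne[OF x] ne[OF y]])
      fix r s assume "r \<in> spectral_set p x" "s \<in> spectral_set p y"
      then obtain C D where rs: "0 < r" "0 < s" and C: "\<And>k. p (x [^] (k::nat)) \<le> C * r ^ k"
        and D: "\<And>k. p (y [^] (k::nat)) \<le> D * s ^ k" unfolding spectral_set_def by auto
      \<comment> \<open>The binomial estimate without binomial coefficients: carrying the powers of
        \<open>x\<close> and \<open>y\<close> as parameters, each induction step splits off one
        factor \<open>x \<oplus> y\<close>.\<close>
      have "p ((x \<oplus> y) [^] (n::nat) \<otimes> (x [^] (i::nat) \<otimes> y [^] (j::nat))) \<le> C * D * (r + s) ^ n * r ^ i * s ^ j" for n i j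
      proof (induction n arbitrary: i j)
        case 0
        have "p (x [^] i \<otimes> y [^] j) \<le> p (x [^] i) * p (y [^] j)"
          using seminormD(4)[OF p] x y by simp
        also have "\<dots> \<le> (C * r ^ i) * (D * s ^ j)"
          using C D seminormD(2)[OF p] x y by (intro mult_mono) (auto intro: order_trans[OF _ C])
        finally show ?case using x y by (simp add: mult_ac)
      next
        case (Suc n)
        have "(x \<oplus> y) [^] Suc n \<otimes> (x [^] i \<otimes> y [^] j) =
           (x \<oplus> y) [^] n \<otimes> (x [^] Suc i \<otimes> y [^] j) \<oplus> (x \<oplus> y) [^] n \<otimes> (x [^] i \<otimes> y [^] Suc j)"
        proof -
          have eq: "(a \<otimes> (x \<oplus> y)) \<otimes> (b \<otimes> c) = a \<otimes> ((b \<otimes> x) \<otimes> c) \<oplus> a \<otimes> (b \<otimes> (c \<otimes> y))"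
            if "a \<in> carrier L" "b \<in> carrier L" "c \<in> carrier L" "x \<in> carrier L" "y \<in> carrier L" for a b c x y
            using that by algebra
          show ?thesis using eq[of "(x \<oplus> y) [^] n" "x [^] i" "y [^] j" x y] x y by simp
        qed
        then have "p ((x \<oplus> y) [^] Suc n \<otimes> (x [^] i \<otimes> y [^] j)) \<le>
           p ((x \<oplus> y) [^] n \<otimes> (x [^] Suc i \<otimes> y [^] j)) + p ((x \<oplus> y) [^] n \<otimes> (x [^] i \<otimes> y [^] Suc j))"
          using seminormD(3)[OF p] x y by (metis E_simps(4,5,7))
        also have "\<dots> \<le> C * D * (r + s) ^ n * r ^ Suc i * s ^ j + C * D * (r + s) ^ n * r ^ i * s ^ Suc j"
          by (intro add_mono Suc)
        also have "\<dots> = C * D * (r + s) ^ Suc n * r ^ i * s ^ j" by (simp add: algebra_simps)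
        finally show ?case .
      qed
      from this[of _ 0 0] have "p ((x \<oplus> y) [^] (n::nat)) \<le> C * D * (r + s) ^ n" for n
        using x y by simp
      then have "spectral p (x \<oplus> y) \<le> r + s"
        using rs x y by (intro spectral_le[where C="C * D"]) auto
      then show "spectral p (x \<oplus> y) \<le> r + s" .
    qed
    show "spectral p (x \<otimes> y) \<le> spectral p x * spectral p y"
      unfolding spectral_eq[OF x] spectral_eq[OF y]
    proof (rule le_cInf_mult[OF ne[OF x] ne[OF y] pos pos])
      fix r s assume "r \<in> spectral_set p x" "s \<in> spectral_set p y"
      then obtain C D where rs: "0 < r" "0 < s" and C: "\<And>k. p (x [^] (k::nat)) \<le> C * r ^ k"
        and D: "\<And>k. p (y [^] (k::nat)) \<le> D * s ^ k" unfolding spectral_set_def by auto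
      show "spectral p (x \<otimes> y) \<le> r * s"
      proof (rule spectral_le[where C="C * D"])
        fix k :: nat
        have "(x \<otimes> y) [^] k = x [^] k \<otimes> y [^] k" using x y by (simp add: nat_pow_distrib)
        then have "p ((x \<otimes> y) [^] k) \<le> p (x [^] k) * p (y [^] k)"
          using seminormD(4)[OF p] x y by simp
        also have "\<dots> \<le> (C * r ^ k) * (D * s ^ k)"
          using C D seminormD(2)[OF p] x y by (intro mult_mono) (auto intro: order_trans[OF _ C])
        finally show "p ((x \<otimes> y) [^] k) \<le> C * D * (r * s) ^ k" by (simp add: power_mult_distrib mult_ac)
      qed (use rs x y in auto)
    qed auto
  }
next
  fix c assume c: "c \<in> F"
  have cpow: "c [^] (k::nat) \<in> F \<and> u (c [^] k) = u c ^ k" for k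
    by (induction k) (use c in \<open>auto simp: mult.commute\<close>)
  have "u c \<le> r" if r: "r \<in> spectral_set p c" for r
  proof -
    obtain C where "0 < r" "\<And>k. p (c [^] (k::nat)) \<le> C * r ^ k" using r unfolding spectral_set_def by auto
    then show ?thesis using cpow seminormD(5)[OF p] by (intro power_le_imp_base_le[of r "u c" C]) auto
  qed
  then have "u c \<le> spectral p c"
    using c spectral_set_nonempty[OF p F_simps(1)[OF c]] by (subst spectral_eq) (auto intro!: cInf_greatest)
  moreover have "spectral p c \<le> u c" using spectral_seminorm_le[OF p F_simps(1)[OF c]] seminormD(5)[OF p c] by simp
  ultimately show "spectral p c = u c" by simp
qed

text \<open>
  A minimal seminorm equals its spectral radius and is therefore power-multiplicative; it then
  dominates the seminorm sending \<open>y\<close> to the limit of \<open>p (y x\<^sup>n) / p (x)\<^sup>n\<close>, hence equals it.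
\<close>

lemma minimal_seminorm_multiplicative:
  assumes p: "seminorm p" and min: "\<And>q. seminorm q \<Longrightarrow> (\<And>x. q x \<le> p x) \<Longrightarrow> q = p"
    and x: "x \<in> E" and y: "y \<in> E"
  shows "p (x \<otimes> y) = p x * p y"
proof (cases "x = \<zero>")
  case True
  then show ?thesis using y seminormD(5)[OF p, of \<zero>] by simp
next
  case False
  have sp: "spectral p = p"
    by (rule min[OF seminorm_spectral[OF p]])
       (metis spectral_seminorm_le[OF p] seminormD(1)[OF p] spectral_def order_refl)
  have px: "p x > 0" using seminorm_pos[OF p x False] .
  have pow: "p (x [^] (n::nat)) = p x ^ n" for n
  proof (cases "n = 0")
    case True
    then show ?thesis using seminormD(5)[OF p, of \<one>] by simp
  next
    case n: False
    have "p x ^ n \<le> Inf (spectral_set p (x [^] n))"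
    proof (rule cInf_greatest)
      show "spectral_set p (x [^] n) \<noteq> {}" using spectral_set_nonempty[OF p, of "x [^] n"] x by auto
      fix r assume "r \<in> spectral_set p (x [^] n)"
      then obtain C where r: "0 < r" and C: "\<And>k. p ((x [^] n) [^] (k::nat)) \<le> C * r ^ k"
        unfolding spectral_set_def by auto
      \<comment> \<open>A rate \<open>r\<close> for the powers of \<open>x [^] n\<close> becomes the
        rate \<open>s\<close> for those of \<open>x\<close>: split the exponent as a multiple of
        \<open>n\<close> plus a remainder. The finitely many remainders are absorbed into the
        constant \<open>D\<close>.\<close>
      define s where "s = root n r"
      have s: "0 < s" "s ^ n = r" using r n by (auto simp: s_def)
      define D where "D = (\<Sum>j<n. p (x [^] j) / s ^ j)"
      have D: "p (x [^] j) \<le> D * s ^ j" if "j < n" for j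
      proof -
        have "p (x [^] j) / s ^ j \<le> D" unfolding D_def
          by (rule member_le_sum) (use that s seminormD(2)[OF p] x in auto)
        then show ?thesis using s by (simp add: field_simps)
      qed
      have "spectral p x \<le> s"
      proof (rule spectral_le[where C="C * D", OF s(1) _ x])
        fix k :: nat
        have k: "k = n * (k div n) + k mod n" by simp
        have "x [^] k = (x [^] n) [^] (k div n) \<otimes> x [^] (k mod n)"
          using x by (subst k) (simp only: nat_pow_pow nat_pow_mult E_simps)
        then have "p (x [^] k) \<le> p ((x [^] n) [^] (k div n)) * p (x [^] (k mod n))"
          using seminormD(4)[OF p] x by simp
        also have "\<dots> \<le> (C * r ^ (k div n)) * (D * s ^ (k mod n))"
          using C[of "k div n"] D[of "k mod n"] n x seminormD(2)[OF p]
          by (intro mult_mono) (auto intro: order_trans[OF _ C])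
        also have "\<dots> = C * D * s ^ k"
          by (subst (3) k) (simp only: power_add power_mult s mult_ac)
        finally show "p (x [^] k) \<le> C * D * s ^ k" .
      qed
      then have "p x ^ n \<le> s ^ n" using sp px by (intro power_mono) auto
      then show "p x ^ n \<le> r" using s by simp
    qed
    then have "p x ^ n \<le> p (x [^] n)" using spectral_eq[of "x [^] n" p] x sp by simp
    then show ?thesis using seminorm_power_le[OF p x, of n] by simp
  qed
  \<comment> \<open>Power-multiplicativity makes this sequence decreasing in \<open>n\<close>, so
    the limit in question can be taken as an infimum.\<close>
  define d where "d n z = p (z \<otimes> x [^] n) / p x ^ n" for n :: nat and z
  define q where "q z = (if z \<in> E then INF n. d n z else 0)" for z
  have dpos: "0 \<le> d n z" if "z \<in> E" for n z
    unfolding d_def using px seminormD(2)[OF p] that x by simp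
  have lower: "(INF n. d n z) \<le> d m z" if "z \<in> E" for m z
    by (rule cINF_lower) (use dpos[OF that] in \<open>auto intro!: bdd_belowI2[of _ 0]\<close>)
  have ddec: "d (n + k) z \<le> d n z" if "z \<in> E" for n k z
  proof -
    have "z \<otimes> x [^] (n + k) = (z \<otimes> x [^] n) \<otimes> x [^] k"
      using that x by (simp add: nat_pow_mult[symmetric] m_assoc)
    then have "p (z \<otimes> x [^] (n + k)) \<le> p (z \<otimes> x [^] n) * p x ^ k"
      using seminormD(4)[OF p, of "z \<otimes> x [^] n" "x [^] k"] that x pow[of k] by simp
    then show ?thesis using px by (simp add: d_def field_simps power_add)
  qed
  have q: "seminorm q" unfolding seminorm_def
  proof (intro conjI allI ballI impI)
    show "z \<notin> E \<Longrightarrow> q z = 0" for z by (simp add: q_def)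
    show "0 \<le> q z" if "z \<in> E" for z
      using that dpos by (auto simp: q_def intro!: cINF_greatest)
    fix z w assume z: "z \<in> E" and w: "w \<in> E"
    have "(INF n. d n (z \<oplus> w)) \<le> (INF n. d n z) + (INF n. d n w)"
    proof (rule le_cInf_add)
      fix a b assume "a \<in> range (\<lambda>n. d n z)" "b \<in> range (\<lambda>n. d n w)"
      then obtain n m where nm: "a = d n z" "b = d m w" by auto
      have "(INF n. d n (z \<oplus> w)) \<le> d (n + m) (z \<oplus> w)" using lower z w by simp
      also have "\<dots> \<le> d (n + m) z + d (n + m) w"
        unfolding d_def using seminormD(3)[OF p, of "z \<otimes> x [^] (n+m)" "w \<otimes> x [^] (n+m)"] z w x px
        by (simp add: l_distr divide_right_mono flip: add_divide_distrib)
      also have "\<dots> \<le> a + b" using ddec[OF z, of n m] ddec[OF w, of m n] nm by (simp add: add.commute)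
      finally show "(INF n. d n (z \<oplus> w)) \<le> a + b" .
    qed auto
    then show "q (z \<oplus> w) \<le> q z + q w" using z w by (simp add: q_def)
    have "(INF n. d n (z \<otimes> w)) \<le> (INF n. d n z) * (INF n. d n w)"
    proof (rule le_cInf_mult)
      fix a b assume "a \<in> range (\<lambda>n. d n z)" "b \<in> range (\<lambda>n. d n w)"
      then obtain n m where nm: "a = d n z" "b = d m w" by auto
      have "(INF n. d n (z \<otimes> w)) \<le> d (n + m) (z \<otimes> w)" using lower z w by simp
      also have "\<dots> \<le> d n z * d m w"
      proof -
        have eq: "(z \<otimes> w) \<otimes> (a \<otimes> b) = (z \<otimes> a) \<otimes> (w \<otimes> b)"
          if "a \<in> carrier L" "b \<in> carrier L" "z \<in> carrier L" "w \<in> carrier L" for a b z w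
          using that by algebra
        have "(z \<otimes> w) \<otimes> x [^] (n + m) = (z \<otimes> x [^] n) \<otimes> (w \<otimes> x [^] m)"
          using eq[of "x [^] n" "x [^] m" z w] x z w by (simp add: nat_pow_mult)
        then have "p ((z \<otimes> w) \<otimes> x [^] (n + m)) \<le> p (z \<otimes> x [^] n) * p (w \<otimes> x [^] m)"
          using seminormD(4)[OF p] x z w by simp
        then show ?thesis using px unfolding d_def by (simp add: power_add divide_right_mono)
      qed
      finally show "(INF n. d n (z \<otimes> w)) \<le> a * b" using nm by simp
    qed (use dpos z w in auto)
    then show "q (z \<otimes> w) \<le> q z * q w" using z w by (simp add: q_def)
  next
    fix c assume c: "c \<in> F"
    have "d n c = u c" for n
      unfolding d_def using seminorm_homogeneous[OF p c, of "x [^] n"] x pow px by simp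
    then show "q c = u c" using c by (simp add: q_def)
  qed
  have "q z \<le> p z" for z
  proof (cases "z \<in> E")
    case True
    then show ?thesis using lower[OF True, of 0] by (simp add: q_def d_def)
  qed (simp add: q_def seminormD(1)[OF p])
  \<comment> \<open>Minimality forces \<open>q = p\<close>; since \<open>q y\<close> is at most the
    term with \<open>n = 1\<close>, this is the missing inequality.\<close>
  from min[OF q this] have "p y \<le> d 1 y" using lower[OF y, of 1] y by (metis q_def)
  then have "p x * p y \<le> p (x \<otimes> y)" using px x y by (simp add: d_def field_simps m_comm)
  then show ?thesis using seminormD(4)[OF p x y] by simp
qed

lemma exists_extension_of_seminorm:
  assumes "seminorm p0"
  obtains w where "absolute_value (L\<lparr>carrier := E\<rparr>) w" "\<And>c. c \<in> F \<Longrightarrow> w c = u c" "\<And>x. x \<notin> E \<Longrightarrow> w x = 0"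
proof -
  obtain p where p: "seminorm p" "\<And>q. seminorm q \<Longrightarrow> (\<And>x. q x \<le> p x) \<Longrightarrow> q = p"
    using exists_minimal_seminorm[OF assms] by blast
  show ?thesis
  proof (rule that[of p])
    have "p x = 0 \<longleftrightarrow> x = \<zero>" if "x \<in> E" for x
      using seminorm_pos[OF p(1) that] seminormD(5)[OF p(1), of \<zero>] by (cases "x = \<zero>") auto
    then show "absolute_value (L\<lparr>carrier := E\<rparr>) p"
      unfolding absolute_value_def
      by (intro conjI ballI)
         (simp_all add: seminormD(2,3)[OF p(1)] minimal_seminorm_multiplicative[OF p])
  qed (use seminormD[OF p(1)] in auto)
qed

section \<open>Operator norms and extension to finite extensions\<close>

definition op_bounds :: "('a \<Rightarrow> real) \<Rightarrow> 'a \<Rightarrow> real set" where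
  "op_bounds N y = {C. 0 \<le> C \<and> (\<forall>z\<in>E. N (y \<otimes> z) \<le> C * N z)}"

text \<open>The norm of the operator "multiplication by y" is automatically submultiplicative.
  Homogeneity of \<open>N\<close>, tested at the element 1, makes it equal to \<open>u\<close> on
  \<open>F\<close>.\<close>

lemma seminorm_operator_norm:
  assumes nonneg: "\<And>x. x \<in> E \<Longrightarrow> 0 \<le> N x"
    and add: "\<And>x y. x \<in> E \<Longrightarrow> y \<in> E \<Longrightarrow> N (x \<oplus> y) \<le> N x + N y"
    and hom: "\<And>c x. c \<in> F \<Longrightarrow> x \<in> E \<Longrightarrow> N (c \<otimes> x) = u c * N x"
    and bounded: "\<And>y. y \<in> E \<Longrightarrow> \<exists>C\<ge>0. \<forall>z\<in>E. N (y \<otimes> z) \<le> C * N z"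
    and one: "0 < N \<one>"
  shows "seminorm (\<lambda>y. if y \<in> E then Inf (op_bounds N y) else 0)"
proof -
  have ne: "op_bounds N y \<noteq> {}" if "y \<in> E" for y
    using bounded[OF that] unfolding op_bounds_def by blast
  have pos: "0 \<le> C" if "C \<in> op_bounds N y" for C y using that by (simp add: op_bounds_def)
  have lower: "Inf (op_bounds N y) \<le> C" if "C \<in> op_bounds N y" for C y
    using that pos by (intro cInf_lower) (auto intro!: bdd_belowI[of _ 0])
  show ?thesis unfolding seminorm_def
  proof (intro conjI allI ballI impI)
    fix x assume x: "x \<in> E"
    show "0 \<le> (if x \<in> E then Inf (op_bounds N x) else 0)"
      using cInf_greatest[OF ne[OF x] pos] x by simp
    fix y assume y: "y \<in> E"
    have "Inf (op_bounds N (x \<oplus> y)) \<le> Inf (op_bounds N x) + Inf (op_bounds N y)"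
    proof (rule le_cInf_add[OF ne[OF x] ne[OF y]])
      fix C D assume CD: "C \<in> op_bounds N x" "D \<in> op_bounds N y"
      have "N ((x \<oplus> y) \<otimes> z) \<le> (C + D) * N z" if "z \<in> E" for z
      proof -
        have "N ((x \<oplus> y) \<otimes> z) \<le> N (x \<otimes> z) + N (y \<otimes> z)"
          using add[of "x \<otimes> z" "y \<otimes> z"] x y that by (simp add: l_distr)
        also have "\<dots> \<le> C * N z + D * N z"
          using CD that unfolding op_bounds_def by (intro add_mono) auto
        finally show ?thesis by (simp add: algebra_simps)
      qed
      then show "Inf (op_bounds N (x \<oplus> y)) \<le> C + D"
        using CD by (intro lower) (auto simp: op_bounds_def)
    qed
    then show "(if x \<oplus> y \<in> E then Inf (op_bounds N (x \<oplus> y)) else 0) \<le>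
      (if x \<in> E then Inf (op_bounds N x) else 0) + (if y \<in> E then Inf (op_bounds N y) else 0)"
      using x y by simp
    have "Inf (op_bounds N (x \<otimes> y)) \<le> Inf (op_bounds N x) * Inf (op_bounds N y)"
    proof (rule le_cInf_mult[OF ne[OF x] ne[OF y] pos pos])
      fix C D assume CD: "C \<in> op_bounds N x" "D \<in> op_bounds N y"
      have "N ((x \<otimes> y) \<otimes> z) \<le> (C * D) * N z" if z: "z \<in> E" for z
      proof -
        have "N ((x \<otimes> y) \<otimes> z) \<le> C * N (y \<otimes> z)"
          using CD x y z by (simp add: m_assoc op_bounds_def)
        also have "\<dots> \<le> C * (D * N z)"
          using CD z unfolding op_bounds_def by (intro mult_left_mono) auto
        finally show ?thesis by (simp add: mult.assoc)
      qed
      then show "Inf (op_bounds N (x \<otimes> y)) \<le> C * D"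
        using CD by (intro lower) (auto simp: op_bounds_def)
    qed auto
    then show "(if x \<otimes> y \<in> E then Inf (op_bounds N (x \<otimes> y)) else 0) \<le>
      (if x \<in> E then Inf (op_bounds N x) else 0) * (if y \<in> E then Inf (op_bounds N y) else 0)"
      using x y by simp
  next
    fix c assume c: "c \<in> F"
    have "Inf (op_bounds N c) = u c"
    proof (rule antisym)
      show "Inf (op_bounds N c) \<le> u c" using c hom by (intro lower) (auto simp: op_bounds_def)
      have "u c \<le> C" if "C \<in> op_bounds N c" for C
      proof -
        have "N (c \<otimes> \<one>) \<le> C * N \<one>" using that unfolding op_bounds_def by auto
        then show ?thesis using hom[OF c, of \<one>] one by simp
      qed
      then show "u c \<le> Inf (op_bounds N c)" using ne c by (intro cInf_greatest) auto
    qed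
    then show "(if c \<in> E then Inf (op_bounds N c) else 0) = u c" using c by simp
  qed auto
qed

lemma combine_bound:
  assumes nonneg: "\<And>x. x \<in> E \<Longrightarrow> 0 \<le> N x"
    and add: "\<And>x y. x \<in> E \<Longrightarrow> y \<in> E \<Longrightarrow> N (x \<oplus> y) \<le> N x + N y"
    and hom: "\<And>c x. c \<in> F \<Longrightarrow> x \<in> E \<Longrightarrow> N (c \<otimes> x) = u c * N x"
    and "set Ks \<subseteq> F" "set Vs \<subseteq> E" "length Ks = length Vs" "\<And>V. V \<in> set Vs \<Longrightarrow> N V \<le> M"
  shows "combine Ks Vs \<in> E \<and> N (combine Ks Vs) \<le> M * sum_list (map u Ks)"
  using assms(4-)
proof (induction Ks Vs rule: list_induct2')
  case (4 k Ks V Vs)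
  then have IH: "combine Ks Vs \<in> E" "N (combine Ks Vs) \<le> M * sum_list (map u Ks)" by auto
  have "N (combine (k # Ks) (V # Vs)) \<le> u k * N V + N (combine Ks Vs)"
    using add[of "k \<otimes> V" "combine Ks Vs"] 4 IH hom by simp
  also have "\<dots> \<le> u k * M + M * sum_list (map u Ks)"
    using IH 4 by (intro add_mono mult_left_mono) auto
  finally show ?case using IH 4 by (simp add: algebra_simps)
qed (use hom[of \<zero> \<zero>] in auto)

text \<open>In a basis the sum of the absolute values of the coordinates is a norm for which every
  multiplication is bounded. Its operator norm is a seminorm extending \<open>u\<close>, and a
  minimal seminorm is then an absolute value.\<close>

lemma exists_extension_finite:
  assumes "finite_dimension F E"
  obtains w where "absolute_value (L\<lparr>carrier := E\<rparr>) w" "\<And>c. c \<in> F \<Longrightarrow> w c = u c" "\<And>x. x \<notin> E \<Longrightarrow> w x = 0"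
proof -
  obtain n where "dimension n F E" using assms by (auto simp: finite_dimension_def)
  from exists_base[OF subfield_F this] obtain Us where Us: "set Us \<subseteq> carrier L" "independent F Us" "Span F Us = E" by blast
  have UsE: "set Us \<subseteq> E" using Span_base_incl[OF subfield_F Us(1)] Us(3) by simp
  define coords where "coords x = (THE Ks. set Ks \<subseteq> F \<and> length Ks = length Us \<and> x = combine Ks Us)" for x
  have ex1: "\<exists>!Ks. set Ks \<subseteq> F \<and> length Ks = length Us \<and> x = combine Ks Us" if "x \<in> E" for x
    using unique_decomposition[OF subfield_F Us(2)] that Us(3) by simp
  have co: "set (coords x) \<subseteq> F" "length (coords x) = length Us" "combine (coords x) Us = x" if "x \<in> E" for x
    using theI'[OF ex1[OF that]] unfolding coords_def by auto
  have co_eq: "coords x = Ks" if "x \<in> E" "set Ks \<subseteq> F" "length Ks = length Us" "x = combine Ks Us" for x Ks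
    unfolding coords_def by (rule the1_equality[OF ex1[OF that(1)]]) (intro conjI that)
  define N where "N x = sum_list (map u (coords x))" for x
  have nonneg: "0 \<le> N x" if "x \<in> E" for x
    unfolding N_def using co(1)[OF that] by (intro sum_list_nonneg) auto
  have FL: "set Ks \<subseteq> carrier L" if "set Ks \<subseteq> F" for Ks using that by auto
  have add: "N (x \<oplus> y) \<le> N x + N y" if x: "x \<in> E" and y: "y \<in> E" for x y
  proof -
    have "coords (x \<oplus> y) = map2 (\<oplus>) (coords x) (coords y)"
    proof (rule co_eq)
      show "set (map2 (\<oplus>) (coords x) (coords y)) \<subseteq> F"
        using co(1)[OF x] co(1)[OF y] by (auto intro!: F_simps(4) dest: set_zip_leftD set_zip_rightD)
      show "x \<oplus> y = combine (map2 (\<oplus>) (coords x) (coords y)) Us"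
        using combine_add[of "coords x" Us "coords y"] co[OF x] co[OF y] FL Us(1) by simp
    qed (use x y co in auto)
    moreover have "sum_list (map u (map2 (\<oplus>) as bs)) \<le> sum_list (map u as) + sum_list (map u bs)"
      if "length as = length bs" "set as \<subseteq> F" "set bs \<subseteq> F" for as bs
      using that
    proof (induction as bs rule: list_induct2)
      case (Cons a as b bs)
      then show ?case using u_add[of a b] by simp
    qed auto
    ultimately show ?thesis unfolding N_def using co[OF x] co[OF y] by simp
  qed
  have hom: "N (c \<otimes> x) = u c * N x" if c: "c \<in> F" and x: "x \<in> E" for c x
  proof -
    have "coords (c \<otimes> x) = map ((\<otimes>) c) (coords x)"
    proof (rule co_eq)
      show "c \<otimes> x = combine (map ((\<otimes>) c) (coords x)) Us"
        using combine_r_distr[of "coords x" Us c] co[OF x] FL Us(1) c by simp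
    qed (use c x co[OF x] in auto)
    moreover have "sum_list (map u (map ((\<otimes>) c) as)) = u c * sum_list (map u as)" if "set as \<subseteq> F" for as
      using that c by (induction as) (auto simp: algebra_simps)
    ultimately show ?thesis unfolding N_def using co[OF x] by simp
  qed
  have bounded: "\<exists>C\<ge>0. \<forall>z\<in>E. N (y \<otimes> z) \<le> C * N z" if y: "y \<in> E" for y
  proof -
    \<comment> \<open>\<open>M\<close> dominates the norms of the products of \<open>y\<close> with
      the basis elements, hence bounds the operator.\<close>
    define M where "M = sum_list (map N (map (\<lambda>V. V \<otimes> y) Us))"
    have "0 \<le> M" unfolding M_def using UsE y nonneg by (intro sum_list_nonneg) auto
    moreover have "N (y \<otimes> z) \<le> M * N z" if z: "z \<in> E" for z
    proof -
      have "y \<otimes> z = combine (coords z) (map (\<lambda>V. V \<otimes> y) Us)"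
        using combine_l_distr[of "coords z" Us y] co[OF z] FL Us(1) y z by (simp add: m_comm)
      moreover have "N (combine (coords z) (map (\<lambda>V. V \<otimes> y) Us)) \<le> M * sum_list (map u (coords z))"
      proof (rule conjunct2[OF combine_bound[OF nonneg add hom]])
        fix V assume "V \<in> set (map (\<lambda>V. V \<otimes> y) Us)"
        then show "N V \<le> M" unfolding M_def
          using UsE y nonneg by (intro member_le_sum_list) auto
      qed (use co[OF z] UsE y in auto)
      ultimately show ?thesis by (simp add: N_def)
    qed
    ultimately show ?thesis by blast
  qed
  have one: "0 < N \<one>"
  proof (rule ccontr)
    assume "\<not> 0 < N \<one>"
    then have "N \<one> = 0" using nonneg[of \<one>] by simp
    moreover have "0 \<le> r" if "r \<in> set (map u (coords \<one>))" for r
      using that co(1)[of \<one>] by auto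
    ultimately have "u k = 0" if "k \<in> set (coords \<one>)" for k
      using that sum_list_nonneg_eq_0_iff[of "map u (coords \<one>)"] unfolding N_def by auto
    then have "k = \<zero>" if "k \<in> set (coords \<one>)" for k
      using that co(1)[of \<one>] u_simps(2)[of k] by auto
    then have "coords \<one> = replicate (length Us) \<zero>"
      using co(2)[of \<one>] by (intro replicate_eqI) auto
    then show False using combine_replicate[OF Us(1)] co(3)[of \<one>] one_not_zero by simp
  qed
  from exists_extension_of_seminorm[OF seminorm_operator_norm[of N, OF nonneg add hom bounded one]] that
  show ?thesis by blast
qed

end

text \<open>Zorn's lemma on pairs of an intermediate field and an extension to it. If a maximal
  field missed some \<open>x\<close>, adjoining this algebraic element would give a finite
  extension, to which the absolute value extends. Setting \<open>w\<close> to 0 outside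
  \<open>F\<close> makes the order on pairs antisymmetric.\<close>

lemma (in field) exists_extension_algebraic:
  assumes K: "subfield K R" and u: "absolute_value (R\<lparr>carrier := K\<rparr>) u"
    and alg: "\<And>x. x \<in> carrier R \<Longrightarrow> (algebraic over K) x"
  obtains w where "absolute_value R w" "\<And>c. c \<in> K \<Longrightarrow> w c = u c"
proof -
  define A where "A = {(F, w). subfield F R \<and> K \<subseteq> F \<and> absolute_value (R\<lparr>carrier := F\<rparr>) w \<and>
    (\<forall>c\<in>K. w c = u c) \<and> (\<forall>x. x \<notin> F \<longrightarrow> w x = 0)}"
  define P where "P = (\<lambda>(F :: 'a set, w :: 'a \<Rightarrow> real) (F' :: 'a set, w' :: 'a \<Rightarrow> real). F \<subseteq> F' \<and> (\<forall>x\<in>F. w' x = w x))"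
  have "\<exists>m\<in>A. \<forall>a\<in>A. P m a \<longrightarrow> a = m"
  proof (rule predicate_Zorn)
    show "partial_order_on A (relation_of P A)"
    proof (rule partial_order_on_relation_ofI)
      fix a b assume "a \<in> A" "b \<in> A" "P a b" "P b a"
      then show "a = b" unfolding A_def P_def by (auto simp: fun_eq_iff) metis
    qed (auto simp: P_def)
    fix C assume C: "C \<in> Chains (relation_of P A)"
    have CA: "C \<subseteq> A" using C unfolding Chains_def relation_of_def by blast
    have chain: "P a b \<or> P b a" if "a \<in> C" "b \<in> C" for a b
      using C that unfolding Chains_def relation_of_def by blast
    show "\<exists>m\<in>A. \<forall>a\<in>C. P a m"
    proof (cases "C = {}")
      case True
      define w where "w x = (if x \<in> K then u x else 0)" for x
      have "absolute_value (R\<lparr>carrier := K\<rparr>) w"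
        using u subringE[OF subfieldE(1)[OF K]] unfolding absolute_value_def w_def by simp
      then have "(K, w) \<in> A" using K by (auto simp: A_def w_def)
      then show ?thesis using True by blast
    next
      case False
      define U where "U = (\<Union>a\<in>C. fst a)"
      \<comment> \<open>Any member of the chain containing \<open>x\<close> may be chosen, as the
        members agree on common points.\<close>
      define w where "w x = (if x \<in> U then snd (SOME a. a \<in> C \<and> x \<in> fst a) x else 0)" for x
      have w_eq: "w x = snd a x" if "a \<in> C" "x \<in> fst a" for a x
      proof -
        define b where "b = (SOME a. a \<in> C \<and> x \<in> fst a)"
        have "b \<in> C \<and> x \<in> fst b" unfolding b_def by (rule someI[of _ a]) (use that in auto)
        then have "snd b x = snd a x" using chain[of a b] that unfolding P_def by (auto split: prod.splits)
        then show ?thesis using that by (auto simp: w_def b_def U_def)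
      qed
      have common: "\<exists>a\<in>C. x \<in> fst a \<and> y \<in> fst a" if xy: "x \<in> U" "y \<in> U" for x y
      proof -
        obtain a where "a \<in> C" "x \<in> fst a" using xy(1) unfolding U_def by blast
        moreover obtain b where "b \<in> C" "y \<in> fst b" using xy(2) unfolding U_def by blast
        moreover have "fst a \<subseteq> fst b \<or> fst b \<subseteq> fst a"
          using chain[OF \<open>a \<in> C\<close> \<open>b \<in> C\<close>] unfolding P_def by (auto split: prod.splits)
        ultimately show ?thesis by blast
      qed
      have AD: "subfield (fst a) R" "K \<subseteq> fst a" "absolute_value (R\<lparr>carrier := fst a\<rparr>) (snd a)"
        "\<And>c. c \<in> K \<Longrightarrow> snd a c = u c" if "a \<in> C" for a
      proof -
        have "a \<in> A" using CA that by blast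
        then show "subfield (fst a) R" "K \<subseteq> fst a" "absolute_value (R\<lparr>carrier := fst a\<rparr>) (snd a)"
          "\<And>c. c \<in> K \<Longrightarrow> snd a c = u c" by (cases a; simp add: A_def)+
      qed
      have sub: "subring (fst a) R" if "a \<in> C" for a using AD(1)[OF that] subfieldE(1) by blast
      obtain a0 where a0: "a0 \<in> C" using False by blast
      have "subring U R"
      proof (rule subringI)
        show "U \<subseteq> carrier R" using subringE(1)[OF sub] by (auto simp: U_def)
        show "\<one> \<in> U" using subringE(3)[OF sub[OF a0]] a0 by (auto simp: U_def)
        show "\<ominus> h \<in> U" if "h \<in> U" for h using that subringE(5)[OF sub] by (auto simp: U_def)
        fix x y assume "x \<in> U" "y \<in> U"
        then obtain a where a: "a \<in> C" "x \<in> fst a" "y \<in> fst a" using common by blast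
        then have "x \<otimes> y \<in> fst a" "x \<oplus> y \<in> fst a" using subringE(6,7)[OF sub[OF a(1)]] by auto
        then show "x \<otimes> y \<in> U" "x \<oplus> y \<in> U" using a(1) unfolding U_def by blast+
      qed
      then have sU: "subfield U R"
      proof (rule subfieldI')
        fix k assume "k \<in> U - {\<zero>}"
        then obtain a where a: "a \<in> C" "k \<in> fst a - {\<zero>}" unfolding U_def by blast
        then have "inv k \<in> fst a" using subfield_m_inv(1)[OF AD(1)[OF a(1)] a(2)] by simp
        then show "inv k \<in> U" using a(1) unfolding U_def by blast
      qed
      have "absolute_value (R\<lparr>carrier := U\<rparr>) w"
        unfolding absolute_value_def
      proof (intro conjI ballI)
        fix x assume "x \<in> carrier (R\<lparr>carrier := U\<rparr>)"
        then have x: "x \<in> U" by simp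
        then obtain a where a: "a \<in> C" "x \<in> fst a" unfolding U_def by blast
        show "0 \<le> w x" "(w x = 0) = (x = \<zero>\<^bsub>R\<lparr>carrier := U\<rparr>\<^esub>)"
          using w_eq[OF a] AD(3)[OF a(1)] a(2) unfolding absolute_value_def by auto
        fix y assume "y \<in> carrier (R\<lparr>carrier := U\<rparr>)"
        then have y: "y \<in> U" by simp
        then obtain b where b: "b \<in> C" "x \<in> fst b" "y \<in> fst b" using common x by blast
        have "x \<otimes> y \<in> fst b" "x \<oplus> y \<in> fst b" using subringE(6,7)[OF sub[OF b(1)]] b by auto
        then show "w (x \<otimes>\<^bsub>R\<lparr>carrier := U\<rparr>\<^esub> y) = w x * w y" "w (x \<oplus>\<^bsub>R\<lparr>carrier := U\<rparr>\<^esub> y) \<le> w x + w y"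
          using w_eq[OF b(1)] AD(3)[OF b(1)] b(2,3) unfolding absolute_value_def by auto
      qed
      moreover have "\<forall>c\<in>K. w c = u c"
        using w_eq[OF a0] AD(2,4)[OF a0] by auto
      ultimately have "(U, w) \<in> A"
        using sU AD(2)[OF a0] a0 by (auto simp: A_def w_def U_def)
      moreover have "P a (U, w)" if "a \<in> C" for a
        using w_eq[OF that] that by (auto simp: P_def U_def split: prod.splits)
      ultimately show ?thesis by blast
    qed
  qed
  then obtain F w where Fw: "(F, w) \<in> A" and max: "\<And>a. a \<in> A \<Longrightarrow> P (F, w) a \<Longrightarrow> a = (F, w)" by auto
  have F: "subfield F R" "K \<subseteq> F" "absolute_value (R\<lparr>carrier := F\<rparr>) w" "\<And>c. c \<in> K \<Longrightarrow> w c = u c"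
    using Fw by (auto simp: A_def)
  have "F = carrier R"
  proof (rule ccontr)
    assume "F \<noteq> carrier R"
    then obtain x where x: "x \<in> carrier R" "x \<notin> F" using subfieldE(3)[OF F(1)] by blast
    define E where "E = simple_extension F x"
    have algx: "(algebraic over F) x" using algebraic_mono[OF F(2) alg[OF x(1)]] .
    have E: "subfield E R" "F \<subseteq> E" "x \<in> E" "finite_dimension F E"
      unfolding E_def using simple_extension_is_subfield[OF F(1) x(1)] algx
        simple_extension_incl[OF subfieldE(3)[OF F(1)] x(1)] simple_extension_mem[OF subfieldE(1)[OF F(1)] x(1)]
        finite_dimension_simple_extension[OF F(1) x(1)] by auto
    interpret field_extension_abs R F E w
      by (intro field_extension_abs.intro field_axioms field_extension_abs_axioms.intro F E)
    obtain w' where w': "absolute_value (R\<lparr>carrier := E\<rparr>) w'" "\<And>c. c \<in> F \<Longrightarrow> w' c = w c" "\<And>x. x \<notin> E \<Longrightarrow> w' x = 0"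
      using exists_extension_finite[OF E(4)] by blast
    then have "(E, w') \<in> A" using E F by (auto simp: A_def)
    moreover have "P (F, w) (E, w')" using E w' by (auto simp: P_def)
    ultimately show False using max x E by blast
  qed
  then show ?thesis using that[of w] F by (simp add: absolute_value_def)
qed

section \<open>Absolute values on subfields of the complex numbers\<close>

text \<open>Restates the axioms with the arithmetic of the complex type, so that valuations of
  subfields can be handled by ordinary simplification instead of through ring records.\<close>

locale subfield_abs =
  fixes K :: "complex set" and v :: "complex \<Rightarrow> real"
  assumes one_mem [simp]: "1 \<in> K"
    and diff_mem [simp]: "x \<in> K \<Longrightarrow> y \<in> K \<Longrightarrow> x - y \<in> K"
    and mult_mem [simp]: "x \<in> K \<Longrightarrow> y \<in> K \<Longrightarrow> x * y \<in> K"
    and inverse_mem [simp]: "x \<in> K \<Longrightarrow> inverse x \<in> K"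
    and abs_nonneg [simp]: "x \<in> K \<Longrightarrow> 0 \<le> v x"
    and abs_eq_0_iff [simp]: "x \<in> K \<Longrightarrow> v x = 0 \<longleftrightarrow> x = 0"
    and abs_mult [simp]: "x \<in> K \<Longrightarrow> y \<in> K \<Longrightarrow> v (x * y) = v x * v y"
    and abs_add: "x \<in> K \<Longrightarrow> y \<in> K \<Longrightarrow> v (x + y) \<le> v x + v y"
begin

lemma zero_mem [simp]: "0 \<in> K"
  using diff_mem[of 1 1] by simp

lemma uminus_mem [simp]: "x \<in> K \<Longrightarrow> - x \<in> K"
  using diff_mem[of 0 x] by simp

lemma add_mem [simp]: "x \<in> K \<Longrightarrow> y \<in> K \<Longrightarrow> x + y \<in> K"
  using diff_mem[of x "- y"] by simp

lemma divide_mem [simp]: "x \<in> K \<Longrightarrow> y \<in> K \<Longrightarrow> x / y \<in> K"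
  by (simp add: divide_inverse)

lemma power_mem [simp]: "x \<in> K \<Longrightarrow> x ^ n \<in> K"
  by (induction n) auto

lemma powi_mem [simp]: "x \<in> K \<Longrightarrow> x powi n \<in> K"
  by (simp add: power_int_def)

lemma sum_mem [simp]: "(\<And>i. i \<in> A \<Longrightarrow> f i \<in> K) \<Longrightarrow> sum f A \<in> K"
  by (induction A rule: infinite_finite_induct) auto

lemma prod_mem [simp]: "(\<And>i. i \<in> A \<Longrightarrow> f i \<in> K) \<Longrightarrow> prod f A \<in> K"
  by (induction A rule: infinite_finite_induct) auto

lemma of_nat_mem [simp]: "of_nat n \<in> K"
  by (induction n) auto

lemma of_int_mem [simp]: "of_int n \<in> K"
  by (cases n rule: int_cases2) auto

lemma of_rat_mem [simp]: "of_rat q \<in> K"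
proof (cases q)
  case (Fract a b)
  then show ?thesis by (simp add: of_rat_rat)
qed

lemma poly_mem [simp]: "(\<And>i. Polynomial.coeff P i \<in> K) \<Longrightarrow> x \<in> K \<Longrightarrow> poly P x \<in> K"
  by (simp add: poly_altdef)

lemma abs_zero [simp]: "v 0 = 0"
  by simp

lemma abs_pos: "x \<in> K \<Longrightarrow> x \<noteq> 0 \<Longrightarrow> 0 < v x"
  by (metis abs_eq_0_iff abs_nonneg less_eq_real_def)

lemma abs_one [simp]: "v 1 = 1"
  using abs_mult[of 1 1] abs_eq_0_iff[of 1] by auto

lemma abs_uminus [simp]: assumes "x \<in> K" shows "v (- x) = v x"
proof -
  have "v (- 1) * v (- 1) = 1"
    using abs_mult[of "- 1" "- 1"] by simp
  then have "v (- 1) = 1"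
    using power2_eq_imp_eq[of "v (- 1)" 1] by (simp add: power2_eq_square)
  then show ?thesis using abs_mult[of "- 1" x] assms by simp
qed

lemma abs_inverse [simp]: assumes "x \<in> K" shows "v (inverse x) = inverse (v x)"
proof (cases "x = 0")
  case False
  then have "v x * v (inverse x) = 1" using abs_mult[of x "inverse x"] assms by simp
  then show ?thesis by (metis inverse_unique)
qed auto

lemma abs_divide [simp]: "x \<in> K \<Longrightarrow> y \<in> K \<Longrightarrow> v (x / y) = v x / v y"
  by (simp add: divide_inverse)

lemma abs_power [simp]: "x \<in> K \<Longrightarrow> v (x ^ n) = v x ^ n"
  by (induction n) auto

lemma abs_powi [simp]: "x \<in> K \<Longrightarrow> v (x powi n) = v x powi n"
  by (simp add: power_int_def)

lemma abs_sum: "(\<And>i. i \<in> A \<Longrightarrow> f i \<in> K) \<Longrightarrow> v (sum f A) \<le> (\<Sum>i\<in>A. v (f i))"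
proof (induction A rule: infinite_finite_induct)
  case (insert x F)
  then show ?case using abs_add[of "f x" "sum f F"] by force
qed auto

lemma abs_prod: "(\<And>i. i \<in> A \<Longrightarrow> f i \<in> K) \<Longrightarrow> v (prod f A) = (\<Prod>i\<in>A. v (f i))"
  by (induction A rule: infinite_finite_induct) auto

lemma abs_diff: "x \<in> K \<Longrightarrow> y \<in> K \<Longrightarrow> v (x - y) \<le> v x + v y"
  using abs_add[of x "- y"] by simp

lemma abs_diff_ge: "x \<in> K \<Longrightarrow> y \<in> K \<Longrightarrow> v x - v y \<le> v (x + y)"
  using abs_diff[of "x + y" y] by simp

lemma abs_diff_triangle: "x \<in> K \<Longrightarrow> y \<in> K \<Longrightarrow> z \<in> K \<Longrightarrow> v (x - z) \<le> v (x - y) + v (y - z)"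
  using abs_add[of "x - y" "y - z"] by simp

end

text \<open>Two places over the same \<open>a\<close> agree on the rationals. A rational of absolute
  value above 1 then scales all of them by the same factor, which normalises them against each
  other.\<close>

locale place_over = subfield_abs K v for K v +
  fixes a :: "rat \<Rightarrow> real"
  assumes abs_of_rat [simp]: "v (of_rat q) = a q"
    and nontrivial: "\<exists>r. 1 < a r"
begin

lemma a_nonneg [simp]: "0 \<le> a q"
  using abs_nonneg[of "of_rat q"] by simp

lemma a_eq_0_iff [simp]: "a q = 0 \<longleftrightarrow> q = 0"
  using abs_eq_0_iff[of "of_rat q"] by simp

end

section \<open>Weak approximation\<close>

lemma separate_two_places:
  assumes "place_over K v a" "place_over K u a" "x \<in> K" "v x < u x"
  obtains y where "y \<in> K" "v y < 1" "1 < u y"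
proof -
  interpret v: place_over K v a by fact
  interpret u: place_over K u a by fact
  show ?thesis
  proof (cases "x = 0")
    case True
    then show ?thesis using assms by simp
  next
    case False
    obtain r where r: "1 < a r" using v.nontrivial by blast
    have pos: "0 < v x" "0 < u x" using v.abs_pos u.abs_pos assms(3) False by auto
    define c where "c = ln (a r)"
    have c: "0 < c" using r by (simp add: c_def)
    have "0 < ln (u x) - ln (v x)" using pos assms(4) by simp
    \<comment> \<open>Logarithmically, \<open>y\<close> = x^k / r^j needs a multiple of
      \<open>c\<close> strictly between \<open>k * ln (v x)\<close> and \<open>k * ln (u x)\<close>.
      For large \<open>k\<close> this interval is longer than \<open>2 * c\<close>, so it contains
      \<open>j * c\<close>.\<close>
    then obtain k :: nat where k: "2 * c < of_nat k * (ln (u x) - ln (v x))"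
      using reals_Archimedean3 by blast
    define j where "j = \<lfloor>k * ln (v x) / c\<rfloor> + 1"
    have j1: "k * ln (v x) < j * c" 
    proof -
      have "k * ln (v x) / c < j" unfolding j_def by linarith
      then show ?thesis using c by (simp add: field_simps)
    qed
    have j2: "j * c \<le> k * ln (v x) + c"
    proof -
      have "j \<le> k * ln (v x) / c + 1" unfolding j_def by linarith
      then have "j * c \<le> (k * ln (v x) / c + 1) * c" using c by (intro mult_right_mono) auto
      then show ?thesis using c by (simp add: field_simps)
    qed
    have j3: "j * c < k * ln (u x)" using j2 k c by (simp add: algebra_simps)
    define y where "y = x ^ k / of_rat r powi j"
    have "a r = exp c" using r by (simp add: c_def)
    then have ar: "a r powi j = exp (j * c)" by (simp add: exp_power_int)
    have "v y = exp (k * ln (v x)) / exp (j * c)"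
      using assms(3) pos by (simp add: y_def ar exp_of_nat_mult)
    then have "v y < 1" using j1 by simp
    moreover have "u y = exp (k * ln (u x)) / exp (j * c)"
      using assms(3) pos by (simp add: y_def ar exp_of_nat_mult)
    then have "1 < u y" using j3 by simp
    moreover have "y \<in> K" using assms(3) by (simp add: y_def)
    ultimately show ?thesis using that by blast
  qed
qed

lemma separate_two_places':
  assumes "place_over K v a" "place_over K u a" "x \<in> K" "v x \<noteq> u x"
  obtains y where "y \<in> K" "v y < 1" "1 < u y"
proof (cases "v x < u x")
  case True
  then show ?thesis using separate_two_places assms that by blast
next
  case False
  interpret v: place_over K v a by fact
  interpret u: place_over K u a by fact
  have "u x < v x" using False assms(4) by simp
  from separate_two_places[OF assms(2,1,3) this] obtain y where y: "y \<in> K" "u y < 1" "1 < v y" .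
  have "y \<noteq> 0" using y by auto
  then have "0 < u y" using u.abs_pos y by simp
  then show ?thesis
    using that[of "inverse y"] y by (simp add: one_less_inverse inverse_less_1_iff)
qed

context place_over
begin

lemma one_plus_power_ne: assumes "x \<in> K" "v x \<noteq> 1" "0 < k" shows "1 + x ^ k \<noteq> 0"
proof
  assume "1 + x ^ k = 0"
  then have "x ^ k = - 1" by (simp add: eq_neg_iff_add_eq_0 add.commute)
  then have "v x ^ k = 1" using abs_power[OF assms(1), of k] by simp
  then show False using assms power_eq_imp_eq_base[of "v x" k 1] by simp
qed

text \<open>The classical switch x^k/(1 + x^k): it tends to 0 at places where \<open>x\<close> is
  small and to 1 where \<open>x\<close> is large. Here the denominator is bounded below by the
  reverse triangle inequality.\<close>

lemma small_quotient_tendsto: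
  assumes "x \<in> K" "v x < 1" shows "(\<lambda>k. v (x ^ k / (1 + x ^ k))) \<longlonglongrightarrow> 0"
proof -
  have p: "(\<lambda>k. v x ^ k) \<longlonglongrightarrow> 0" using assms by (intro LIMSEQ_realpow_zero) auto
  have "(\<lambda>k. v x ^ k / (1 - v x ^ k)) \<longlonglongrightarrow> 0 / (1 - 0)"
    by (intro tendsto_intros p) auto
  then have "(\<lambda>k. v x ^ k / (1 - v x ^ k)) \<longlonglongrightarrow> 0" by simp
  then show ?thesis
  proof (rule tendsto_sandwich[rotated 3])
    show "(\<lambda>k. 0::real) \<longlonglongrightarrow> 0" by simp
    show "\<forall>\<^sub>F k in sequentially. 0 \<le> v (x ^ k / (1 + x ^ k))" using assms by simp
    have "v (x ^ k / (1 + x ^ k)) \<le> v x ^ k / (1 - v x ^ k)" if "0 < k" for k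
    proof -
      have "v x ^ k < 1" using assms that by (metis abs_nonneg power_less_one_iff)
      moreover have "1 - v x ^ k \<le> v (1 + x ^ k)"
        using abs_diff_ge[of 1 "x ^ k"] assms by simp
      ultimately show ?thesis using assms by (auto intro!: frac_le)
    qed
    then show "\<forall>\<^sub>F k in sequentially. v (x ^ k / (1 + x ^ k)) \<le> v x ^ k / (1 - v x ^ k)"
      by (intro eventually_mono[OF eventually_gt_at_top[of 0]]) auto
  qed
qed

text \<open>Passing to the inverse of \<open>x\<close> turns the distance from 1 into the quotient
  of the small case.\<close>

lemma large_quotient_tendsto:
  assumes "x \<in> K" "1 < v x" shows "(\<lambda>k. v (x ^ k / (1 + x ^ k) - 1)) \<longlonglongrightarrow> 0"
proof -
  have x: "x \<noteq> 0" using assms by auto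
  define y where "y = inverse x"
  have y: "y \<in> K" "v y < 1" using assms by (auto simp: y_def inverse_less_1_iff)
  have "v (x ^ k / (1 + x ^ k) - 1) = v (y ^ k / (1 + y ^ k))" if "0 < k" for k
  proof -
    have ne: "1 + x ^ k \<noteq> 0" using one_plus_power_ne assms that by simp
    have "x ^ k / (1 + x ^ k) - 1 = - (y ^ k / (1 + y ^ k))"
      using ne x by (simp add: y_def field_simps power_inverse)
    then show ?thesis using abs_uminus[of "y ^ k / (1 + y ^ k)"] y by simp
  qed
  then have "\<forall>\<^sub>F k in sequentially. v (y ^ k / (1 + y ^ k)) = v (x ^ k / (1 + x ^ k) - 1)"
    by (intro eventually_mono[OF eventually_gt_at_top[of 0]]) auto
  from Lim_transform_eventually[OF small_quotient_tendsto[OF y] this] show ?thesis .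
qed

lemma large_quotient_tendsto_1:
  assumes "x \<in> K" "1 < v x" shows "(\<lambda>k. v (x ^ k / (1 + x ^ k))) \<longlonglongrightarrow> 1"
proof -
  have "\<bar>v (x ^ k / (1 + x ^ k)) - 1\<bar> \<le> v (x ^ k / (1 + x ^ k) - 1)" for k
    using abs_diff_ge[of "x ^ k / (1 + x ^ k) - 1" "- (x ^ k / (1 + x ^ k))"]
      abs_add[of "x ^ k / (1 + x ^ k) - 1" 1] abs_diff_ge[of 1 "x ^ k / (1 + x ^ k) - 1"] assms by simp
  then have "(\<lambda>k. v (x ^ k / (1 + x ^ k)) - 1) \<longlonglongrightarrow> 0"
    by (intro Lim_null_comparison[OF _ large_quotient_tendsto[OF assms]]) auto
  then show ?thesis by (simp add: LIM_zero_iff)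
qed

end

text \<open>Induction on the number of places: \<open>y\<close> already separates \<open>v\<close>
  from \<open>W\<close>, and \<open>b\<close> separates \<open>v\<close> from the new place
  \<open>u\<close>. A large power of \<open>y\<close>, or the switch built from \<open>y\<close>,
  times \<open>b\<close> does both.\<close>

lemma separate_places:
  assumes "finite W" "v \<notin> W" "\<And>u. u \<in> insert v W \<Longrightarrow> place_over K u a"
    "\<And>u. u \<in> W \<Longrightarrow> \<exists>x\<in>K. v x \<noteq> u x"
  obtains y where "y \<in> K" "1 < v y" "\<And>u. u \<in> W \<Longrightarrow> u y < 1"
proof -
  interpret v: place_over K v a using assms(3) by simp
  have "\<exists>y\<in>K. 1 < v y \<and> (\<forall>u\<in>W. u y < 1)"
    using assms
  proof (induction W rule: finite_induct)
    case empty
    obtain r where "1 < a r" using v.nontrivial by blast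
    then show ?case by (intro bexI[of _ "of_rat r"]) auto
  next
    case (insert u W)
    interpret u: place_over K u a using insert.prems by simp
    obtain y where y: "y \<in> K" "1 < v y" and yW: "\<And>w. w \<in> W \<Longrightarrow> w y < 1"
      using insert.IH insert.prems by (metis insert_iff)
    obtain x where "x \<in> K" "u x \<noteq> v x" using insert.prems(3)[of u] by auto
    then obtain b where b: "b \<in> K" "u b < 1" "1 < v b"
      using separate_two_places'[OF u.place_over_axioms v.place_over_axioms] by metis
    have W: "place_over K w a" if "w \<in> W" for w using insert.prems that by simp
    show ?case
    proof (cases "u y \<le> 1")
      \<comment> \<open>The factor \<open>b\<close> is small at \<open>u\<close>, and powers of
        \<open>y\<close> keep it so; at the places of \<open>W\<close> the powers of
        \<open>y\<close> overcome \<open>b\<close>.\<close>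
      case True
      have "\<forall>\<^sub>F k in sequentially. w (y ^ k * b) < 1" if w: "w \<in> W" for w
      proof -
        interpret w: place_over K w a by (rule W[OF w])
        have "(\<lambda>k. w y ^ k * w b) \<longlonglongrightarrow> 0 * w b"
          using y yW[OF w] by (intro tendsto_mult LIMSEQ_realpow_zero) auto
        then have "\<forall>\<^sub>F k in sequentially. w y ^ k * w b < 1"
          by (intro order_tendstoD(2)[of _ "0 * w b"]) auto
        then show ?thesis using y b by simp
      qed
      then have "\<forall>\<^sub>F k in sequentially. \<forall>w\<in>W. w (y ^ k * b) < 1"
        using insert.hyps(1) by (simp add: eventually_ball_finite)
      then obtain k where k: "\<forall>w\<in>W. w (y ^ k * b) < 1" by (auto simp: eventually_sequentially)
      have "u (y ^ k * b) < 1"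
      proof -
        have "u y ^ k * u b \<le> 1 * u b" using True y b by (intro mult_right_mono power_le_one) auto
        then show ?thesis using y b by simp
      qed
      moreover have "1 < v (y ^ k * b)"
      proof -
        have "1 * v b \<le> v y ^ k * v b" using y b by (intro mult_right_mono one_le_power) auto
        then have "1 < v y ^ k * v b" using b(3) by linarith
        then show ?thesis using y b by simp
      qed
      ultimately show ?thesis using k y b by (intro bexI[of _ "y ^ k * b"]) auto
    next
      \<comment> \<open>Powers of \<open>y\<close> would blow up at \<open>u\<close>. The switch
        tends to 1 at \<open>u\<close> and \<open>v\<close> and to 0 on \<open>W\<close>, so there
        the sizes are eventually decided by \<open>b\<close>.\<close>
      case False
      define e where "e k = y ^ k / (1 + y ^ k)" for k
      have eK: "e k \<in> K" for k using y by (simp add: e_def)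
      have "\<forall>\<^sub>F k in sequentially. w (e k * b) < 1" if w: "w \<in> W" for w
      proof -
        interpret w: place_over K w a by (rule W[OF w])
        have "(\<lambda>k. w (e k) * w b) \<longlonglongrightarrow> 0 * w b"
          unfolding e_def using y yW[OF w] by (intro tendsto_mult w.small_quotient_tendsto) auto
        then have "\<forall>\<^sub>F k in sequentially. w (e k) * w b < 1"
          by (intro order_tendstoD(2)[of _ "0 * w b"]) auto
        then show ?thesis using eK b by simp
      qed
      then have 1: "\<forall>\<^sub>F k in sequentially. \<forall>w\<in>W. w (e k * b) < 1"
        using insert.hyps(1) by (simp add: eventually_ball_finite)
      have "(\<lambda>k. u (e k) * u b) \<longlonglongrightarrow> 1 * u b"
        unfolding e_def using y False by (intro tendsto_mult u.large_quotient_tendsto_1) auto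
      then have "\<forall>\<^sub>F k in sequentially. u (e k) * u b < 1"
        using b by (intro order_tendstoD(2)[of _ "1 * u b"]) auto
      then have 2: "\<forall>\<^sub>F k in sequentially. u (e k * b) < 1" using eK b by simp
      have "(\<lambda>k. v (e k) * v b) \<longlonglongrightarrow> 1 * v b"
        unfolding e_def using y by (intro tendsto_mult v.large_quotient_tendsto_1) auto
      then have "\<forall>\<^sub>F k in sequentially. 1 < v (e k) * v b"
        using b by (intro order_tendstoD(1)[of _ "1 * v b"]) auto
      then have 3: "\<forall>\<^sub>F k in sequentially. 1 < v (e k * b)" using eK b by simp
      obtain k where "\<forall>w\<in>W. w (e k * b) < 1" "u (e k * b) < 1" "1 < v (e k * b)"
        using eventually_happens[OF eventually_conj[OF 1 eventually_conj[OF 2 3]]] by auto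
      then show ?thesis using eK b by (intro bexI[of _ "e k * b"]) auto
    qed
  qed
  then show ?thesis using that by blast
qed

lemma weak_approximation:
  assumes "finite W" "v \<notin> W" "\<And>u. u \<in> insert v W \<Longrightarrow> place_over K u a"
    "\<And>u. u \<in> W \<Longrightarrow> \<exists>x\<in>K. v x \<noteq> u x" "0 < \<epsilon>"
  obtains y where "y \<in> K" "v (y - 1) < \<epsilon>" "\<And>u. u \<in> W \<Longrightarrow> u y < \<epsilon>"
proof -
  interpret v: place_over K v a using assms(3) by simp
  obtain x where x: "x \<in> K" "1 < v x" and xW: "\<And>u. u \<in> W \<Longrightarrow> u x < 1"
    using separate_places[OF assms(1-4)] by blast
  have "\<forall>\<^sub>F k in sequentially. u (x ^ k / (1 + x ^ k)) < \<epsilon>" if u: "u \<in> W" for u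
  proof -
    interpret u: place_over K u a using assms(3) u by simp
    show ?thesis using u.small_quotient_tendsto[OF x(1) xW[OF u]] assms(5) by (rule order_tendstoD)
  qed
  then have 1: "\<forall>\<^sub>F k in sequentially. \<forall>u\<in>W. u (x ^ k / (1 + x ^ k)) < \<epsilon>"
    using assms(1) by (simp add: eventually_ball_finite)
  have 2: "\<forall>\<^sub>F k in sequentially. v (x ^ k / (1 + x ^ k) - 1) < \<epsilon>"
    using v.large_quotient_tendsto[OF x] assms(5) by (rule order_tendstoD)
  obtain k where "\<forall>u\<in>W. u (x ^ k / (1 + x ^ k)) < \<epsilon>" "v (x ^ k / (1 + x ^ k) - 1) < \<epsilon>"
    using eventually_happens[OF eventually_conj[OF 1 2]] by auto
  then show ?thesis using that[of "x ^ k / (1 + x ^ k)"] x(1) by simp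
qed

text \<open>Linear independence over the completed rationals, expressed inside \<open>K\<close>: the
  uniform lower bound \<open>c\<close> survives passage to limits of rational coefficients.\<close>

definition vindep :: "(rat \<Rightarrow> real) \<Rightarrow> (complex \<Rightarrow> real) \<Rightarrow> nat \<Rightarrow> (nat \<Rightarrow> complex) \<Rightarrow> bool" where
  "vindep a v n b \<longleftrightarrow>
     (\<exists>c>0. \<forall>q::nat \<Rightarrow> rat. \<forall>i<n. c * a (q i) \<le> v (\<Sum>i<n. of_rat (q i) * b i))"

text \<open>Each local family is multiplied by an element close to 1 at its own place and close to 0
  at the others. In a rational relation, consider a coefficient of largest absolute value: at its
  place the own family contributes at least a fixed multiple of it, more than all errors
  together.\<close>

lemma vindep_families_independent:
  assumes "finite V" and V: "\<And>v. v \<in> V \<Longrightarrow> place_over K v a"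
    and dist: "\<And>u v. u \<in> V \<Longrightarrow> v \<in> V \<Longrightarrow> u \<noteq> v \<Longrightarrow> \<exists>x\<in>K. v x \<noteq> u x"
    and bK: "\<And>v i. v \<in> V \<Longrightarrow> i < d v \<Longrightarrow> b v i \<in> K"
    and indep: "\<And>v. v \<in> V \<Longrightarrow> vindep a v (d v) (b v)"
  obtains y where "\<And>v i. v \<in> V \<Longrightarrow> i < d v \<Longrightarrow> y (v, i) \<in> K"
    "\<And>q v i. (\<Sum>s\<in>Sigma V (\<lambda>v. {..<d v}). of_rat (q s) * y s) = 0 \<Longrightarrow> v \<in> V \<Longrightarrow> i < d v \<Longrightarrow> q (v, i) = (0::rat)"
proof -
  define I where "I = Sigma V (\<lambda>v. {..<d v})"
  have finI: "finite I" unfolding I_def using assms(1) by auto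
  from indep obtain c0 where c0: "\<And>v. v \<in> V \<Longrightarrow> 0 < c0 v"
    "\<And>v q i. v \<in> V \<Longrightarrow> i < d v \<Longrightarrow> c0 v * a (q i) \<le> v (\<Sum>i<d v. of_rat (q i) * b v i)"
    unfolding vindep_def by metis
  obtain c where c: "0 < c" "\<And>v. v \<in> V \<Longrightarrow> c \<le> c0 v"
  proof (cases "V = {}")
    case True
    then show ?thesis using that[of 1] by auto
  next
    case False
    then show ?thesis using that[of "Min (c0 ` V)"] assms(1) c0(1) by auto
  qed
  define M where "M = 1 + (\<Sum>v\<in>V. \<Sum>s\<in>I. v (b (fst s) (snd s)))"
  have Mb: "v (b (fst s) (snd s)) \<le> M" if vs: "v \<in> V" "s \<in> I" for v s
  proof -
    have nn: "0 \<le> u (b (fst s) (snd s))" if "u \<in> V" "s \<in> I" for u s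
    proof -
      interpret u: place_over K u a using V that(1) .
      show ?thesis using bK that(2) by (auto simp: I_def)
    qed
    have "v (b (fst s) (snd s)) \<le> (\<Sum>s\<in>I. v (b (fst s) (snd s)))"
      using vs finI nn by (intro member_le_sum) auto
    also have "\<dots> \<le> (\<Sum>v\<in>V. \<Sum>s\<in>I. v (b (fst s) (snd s)))"
      using vs assms(1) nn by (intro member_le_sum[of v V "\<lambda>v. \<Sum>s\<in>I. v (b (fst s) (snd s))"] sum_nonneg) auto
    finally show ?thesis by (simp add: M_def)
  qed
  have M: "1 \<le> M"
  proof -
    have "0 \<le> v (b (fst s) (snd s))" if "v \<in> V" "s \<in> I" for v s
    proof -
      interpret v: place_over K v a using V that(1) .
      show ?thesis using bK that(2) by (auto simp: I_def)
    qed
    then show ?thesis unfolding M_def by (simp add: sum_nonneg)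
  qed
  \<comment> \<open>Chosen so that \<open>card I\<close> error terms of size at most
    \<open>A * (\<epsilon> * M)\<close> sum to at most half of \<open>c * A\<close>.\<close>
  define \<epsilon> where "\<epsilon> = c / (2 * M * (1 + card I))"
  have eps: "0 < \<epsilon>" using c M by (simp add: \<epsilon>_def)
  have "\<exists>e. e \<in> K \<and> v (e - 1) < \<epsilon> \<and> (\<forall>u\<in>V - {v}. u e < \<epsilon>)" if v: "v \<in> V" for v
  proof (rule weak_approximation[of "V - {v}" v K a \<epsilon>])
    show "\<exists>x\<in>K. v x \<noteq> u x" if "u \<in> V - {v}" for u using dist[of u v] that v by auto
  qed (use assms(1) V v eps in auto)
  then obtain e where e: "\<And>v. v \<in> V \<Longrightarrow> e v \<in> K" "\<And>v. v \<in> V \<Longrightarrow> v (e v - 1) < \<epsilon>"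
    "\<And>v u. v \<in> V \<Longrightarrow> u \<in> V \<Longrightarrow> u \<noteq> v \<Longrightarrow> u (e v) < \<epsilon>"
    by (metis Diff_iff singletonD)
  define y where "y s = e (fst s) * b (fst s) (snd s)" for s
  show ?thesis
  proof (rule that[of y])
    show yK: "y (v, i) \<in> K" if "v \<in> V" "i < d v" for v i
    proof -
      interpret v: place_over K v a using V that(1) .
      show ?thesis using e(1) bK that by (simp add: y_def)
    qed
    fix q v i
    assume q0: "(\<Sum>s\<in>Sigma V (\<lambda>v. {..<d v}). of_rat (q s) * y s) = 0" and vi: "v \<in> V" "i < d v"
    show "q (v, i) = 0"
    proof (rule ccontr)
      assume nz: "q (v, i) \<noteq> 0"
      have viI: "(v, i) \<in> I" using vi by (simp add: I_def)
      define A where "A = Max ((\<lambda>s. a (q s)) ` I)"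
      have A: "a (q s) \<le> A" if "s \<in> I" for s unfolding A_def using that finI by simp
      have "A \<in> (\<lambda>s. a (q s)) ` I" unfolding A_def using finI viI by (intro Max_in) auto
      \<comment> \<open>The relation is evaluated at the place to which a largest coefficient
        belongs.\<close>
      then obtain v0 j where v0: "v0 \<in> V" "j < d v0" "a (q (v0, j)) = A" by (auto simp: I_def)
      interpret v0: place_over K v0 a using V v0(1) .
      have "0 < a (q (v, i))" using nz v0.a_nonneg v0.a_eq_0_iff by (metis less_eq_real_def)
      then have A0: "0 < A" using A[OF viI] by simp
      \<comment> \<open>The error terms: what is left of \<open>y\<close> after removing the
        undisturbed family of \<open>v0\<close>.\<close>
      define z where "z s = (e (fst s) - (if fst s = v0 then 1 else 0)) * b (fst s) (snd s)" for s
      have z: "z s \<in> K \<and> v0 (z s) \<le> \<epsilon> * M" if s: "s \<in> I" for s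
      proof -
        have s1: "fst s \<in> V" "snd s < d (fst s)" using s by (auto simp: I_def)
        define f where "f = e (fst s) - (if fst s = v0 then 1 else 0)"
        have f: "f \<in> K" "v0 f < \<epsilon>" unfolding f_def using e s1(1) v0(1) by (auto split: if_splits)
        have "v0 f * v0 (b (fst s) (snd s)) \<le> \<epsilon> * M"
          using f Mb[OF v0(1) s] bK[OF s1] eps by (intro mult_mono) auto
        then show ?thesis using f bK[OF s1] by (simp add: z_def flip: f_def)
      qed
      have split: "(\<Sum>s\<in>I. of_rat (q s) * z s) = - (\<Sum>i<d v0. of_rat (q (v0, i)) * b v0 i)"
      proof -
        have "(\<Sum>s\<in>I. of_rat (q s) * z s) = (\<Sum>s\<in>I. of_rat (q s) * y s) -
            (\<Sum>s\<in>I. if fst s = v0 then of_rat (q s) * b (fst s) (snd s) else 0)"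
          unfolding sum_subtractf[symmetric] by (rule sum.cong) (auto simp: z_def y_def algebra_simps)
        also have "(\<Sum>s\<in>I. if fst s = v0 then of_rat (q s) * b (fst s) (snd s) else 0) =
            (\<Sum>s\<in>{s\<in>I. fst s = v0}. of_rat (q s) * b (fst s) (snd s))"
          by (rule sum.inter_filter[OF finI, symmetric])
        also have "\<dots> = (\<Sum>i<d v0. of_rat (q (v0, i)) * b v0 i)"
          by (rule sum.reindex_bij_witness[of _ "\<lambda>i. (v0, i)" snd]) (use v0(1) in \<open>auto simp: I_def\<close>)
        finally show ?thesis using q0 by (simp add: I_def)
      qed
      have "c * A \<le> c0 v0 * A" using c(2)[OF v0(1)] A0 by (intro mult_right_mono) auto
      also have "\<dots> \<le> v0 (\<Sum>i<d v0. of_rat (q (v0, i)) * b v0 i)"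
        using c0(2)[OF v0(1,2), of "\<lambda>i. q (v0, i)"] v0(3) by simp
      also have "\<dots> = v0 (\<Sum>s\<in>I. of_rat (q s) * z s)"
        unfolding split using bK[OF v0(1)] by (intro v0.abs_uminus[symmetric] v0.sum_mem) auto
      also have "\<dots> \<le> (\<Sum>s\<in>I. v0 (of_rat (q s) * z s))"
        using z by (intro v0.abs_sum) auto
      also have "\<dots> \<le> (\<Sum>s\<in>I. A * (\<epsilon> * M))"
      proof (rule sum_mono)
        fix s assume s: "s \<in> I"
        have "a (q s) * v0 (z s) \<le> A * (\<epsilon> * M)"
          using A[OF s] z[OF s] A0 by (intro mult_mono) auto
        then show "v0 (of_rat (q s) * z s) \<le> A * (\<epsilon> * M)" using z[OF s] by simp
      qed
      also have "\<dots> = A * (c / 2) * (card I / (1 + card I))"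
      proof -
        have "\<epsilon> * M = c / 2 / (1 + card I)" using M by (simp add: \<epsilon>_def)
        then show ?thesis by simp
      qed
      also have "\<dots> \<le> A * (c / 2) * 1"
        using A0 c by (intro mult_left_mono) auto
      also have "\<dots> < c * A" using A0 c by simp
      finally show False by simp
    qed
  qed
qed

section \<open>Comparison with the dimension over the rationals\<close>

interpretation rat_vec: vector_space "\<lambda>q x :: complex. of_rat q * x"
  by (rule vector_space.intro) (simp_all add: ring_distribs of_rat_add of_rat_mult mult.assoc)

lemma independent_family_card_le:
  assumes "finite I" "\<And>q. (\<Sum>s\<in>I. of_rat (q s) * y s) = 0 \<Longrightarrow> \<forall>s\<in>I. q s = (0::rat)"
    and "finite S" "y ` I \<subseteq> rat_vec.span S"
  shows "card I \<le> card S"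
proof -
  have inj: "inj_on y I"
  proof (rule inj_onI)
    fix s t assume st: "s \<in> I" "t \<in> I" "y s = y t"
    show "s = t"
    proof (rule ccontr)
      assume ne: "s \<noteq> t"
      define q where "q r = (if r = s then 1 else if r = t then - 1 else 0 :: rat)" for r
      have "(\<Sum>r\<in>I. of_rat (q r) * y r) = (\<Sum>r\<in>{s, t}. of_rat (q r) * y r)"
        using assms(1) st by (intro sum.mono_neutral_right) (auto simp: q_def)
      also have "\<dots> = 0" using ne st by (simp add: q_def)
      finally have "q s = 0" using assms(2) st by blast
      then show False by (simp add: q_def)
    qed
  qed
  have "rat_vec.independent (y ` I)"
  proof (rule rat_vec.independent_if_scalars_zero)
    show "finite (y ` I)" using assms(1) by simp
    fix f x assume f: "(\<Sum>x\<in>y ` I. of_rat (f x) * x) = 0" and "x \<in> y ` I"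
    then obtain s where s: "s \<in> I" "x = y s" by auto
    have "(\<Sum>s\<in>I. of_rat (f (y s)) * y s) = 0" using f by (simp add: sum.reindex[OF inj])
    then show "f x = 0" using assms(2)[of "\<lambda>s. f (y s)"] s by simp
  qed
  from rat_vec.independent_span_bound[OF assms(3) this assms(4)] show ?thesis
    by (simp add: card_image[OF inj])
qed

text \<open>One half of the identity "the local degrees add up to the global degree"; the glued
  family is independent over the rationals and therefore no larger than a spanning set.\<close>

lemma sum_vindep_le:
  assumes "finite V" and V: "\<And>v. v \<in> V \<Longrightarrow> place_over K v a"
    and dist: "\<And>u v. u \<in> V \<Longrightarrow> v \<in> V \<Longrightarrow> u \<noteq> v \<Longrightarrow> \<exists>x\<in>K. v x \<noteq> u x"
    and bK: "\<And>v i. v \<in> V \<Longrightarrow> i < d v \<Longrightarrow> b v i \<in> K"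
    and indep: "\<And>v. v \<in> V \<Longrightarrow> vindep a v (d v) (b v)"
    and S: "finite S" "K \<subseteq> rat_vec.span S"
  shows "(\<Sum>v\<in>V. d v) \<le> card S"
proof -
  obtain y where y: "\<And>v i. v \<in> V \<Longrightarrow> i < d v \<Longrightarrow> y (v, i) \<in> K"
    "\<And>q v i. (\<Sum>s\<in>Sigma V (\<lambda>v. {..<d v}). of_rat (q s) * y s) = 0 \<Longrightarrow> v \<in> V \<Longrightarrow> i < d v \<Longrightarrow> q (v, i) = (0::rat)"
    using vindep_families_independent[OF assms(1) V dist bK indep] by blast
  have "card (Sigma V (\<lambda>v. {..<d v})) \<le> card S"
    by (rule independent_family_card_le[of _ y]) (use assms(1) y S in auto)
  then show ?thesis using assms(1) by (simp add: card_SigmaI)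
qed

section \<open>Rational polynomials and primitive elements\<close>

abbreviation cpoly :: "rat poly \<Rightarrow> complex poly" where
  "cpoly \<equiv> map_poly of_rat"

lemma cpoly_add: "cpoly (p + q) = cpoly p + cpoly q"
  by (rule poly_eqI) (simp add: coeff_map_poly of_rat_add)

lemma cpoly_mult: "cpoly (p * q) = cpoly p * cpoly q"
  by (rule poly_eqI) (simp add: coeff_map_poly coeff_mult of_rat_sum of_rat_mult)

lemma cpoly_smult: "cpoly (smult c q) = smult (of_rat c) (cpoly q)"
  by (rule poly_eqI) (simp add: coeff_map_poly of_rat_mult)

lemma cpoly_pderiv: "cpoly (pderiv p) = pderiv (cpoly p)"
  by (rule poly_eqI) (simp add: coeff_map_poly coeff_pderiv of_rat_mult of_rat_add)

lemma degree_cpoly [simp]: "Polynomial.degree (cpoly p) = Polynomial.degree p"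
  by (rule degree_map_poly) simp

lemma cpoly_eq_0_iff [simp]: "cpoly p = 0 \<longleftrightarrow> p = 0"
  by (subst map_poly_eq_0_iff) auto

lemma coeff_cpoly [simp]: "Polynomial.coeff (cpoly p) i = of_rat (Polynomial.coeff p i)"
  by (simp add: coeff_map_poly)

lemma cpoly_pCons [simp]: "cpoly (pCons c p) = pCons (of_rat c) (cpoly p)"
  by (simp add: map_poly_pCons)

lemma cpoly_pcompose: "cpoly (pcompose p q) = pcompose (cpoly p) (cpoly q)"
  by (induction p) (simp_all add: pcompose_pCons cpoly_add cpoly_mult)

section \<open>Simple extensions and minimal polynomials\<close>

definition Qadj :: "complex \<Rightarrow> complex set" where
  "Qadj x = range (\<lambda>P. poly (cpoly P) x)"

lemma QadjI: "poly (cpoly P) x \<in> Qadj x"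
  by (simp add: Qadj_def)

lemma Qadj_self: "x \<in> Qadj x"
  using QadjI[of "[:0, 1:]" x] by simp

lemma Qadj_of_rat: "of_rat q \<in> Qadj x"
  using QadjI[of "[:q:]" x] by simp

lemma Qadj_add: "y \<in> Qadj x \<Longrightarrow> z \<in> Qadj x \<Longrightarrow> y + z \<in> Qadj x"
  unfolding Qadj_def by (auto simp: image_iff) (metis cpoly_add poly_add)

lemma Qadj_mult: "y \<in> Qadj x \<Longrightarrow> z \<in> Qadj x \<Longrightarrow> y * z \<in> Qadj x"
  unfolding Qadj_def by (auto simp: image_iff) (metis cpoly_mult poly_mult)

lemma Qadj_uminus: "y \<in> Qadj x \<Longrightarrow> - y \<in> Qadj x"
  using Qadj_mult[OF Qadj_of_rat[of "- 1" x], of y] by simp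

lemma Qadj_trans: assumes "y \<in> Qadj x" shows "Qadj y \<subseteq> Qadj x"
proof
  fix z assume "z \<in> Qadj y"
  then obtain P Q where "z = poly (cpoly Q) y" "y = poly (cpoly P) x"
    using assms by (auto simp: Qadj_def)
  then have "z = poly (cpoly (pcompose Q P)) x" by (simp add: cpoly_pcompose poly_pcompose)
  then show "z \<in> Qadj x" by (simp add: QadjI)
qed

text \<open>A relation, determined up to a nonzero scalar: no monic normalisation, hence the leading
  coefficients carried along later.\<close>

definition minpoly :: "complex \<Rightarrow> rat poly \<Rightarrow> bool" where
  "minpoly x g \<longleftrightarrow> g \<noteq> 0 \<and> poly (cpoly g) x = 0 \<and>
     (\<forall>h. h \<noteq> 0 \<longrightarrow> poly (cpoly h) x = 0 \<longrightarrow> Polynomial.degree g \<le> Polynomial.degree h)"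

lemma minpoly_exists:
  assumes "P \<noteq> 0" "poly (cpoly P) x = 0"
  obtains g where "minpoly x g"
proof -
  let ?Q = "\<lambda>g. g \<noteq> 0 \<and> poly (cpoly g) x = 0"
  obtain g where "?Q g" "\<forall>h. ?Q h \<longrightarrow> Polynomial.degree g \<le> Polynomial.degree h"
    using ex_has_least_nat[of ?Q P Polynomial.degree] assms by blast
  then show ?thesis using that[of g] by (auto simp: minpoly_def)
qed

lemma minpoly_dvd:
  assumes "minpoly x g" "poly (cpoly P) x = 0" shows "g dvd P"
proof -
  define r where "r = P mod g"
  have "P = P div g * g + r" by (simp add: r_def)
  then have "cpoly P = cpoly (P div g) * cpoly g + cpoly r" by (metis cpoly_add cpoly_mult)
  then have "poly (cpoly r) x = 0" using assms by (simp add: minpoly_def)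
  moreover have "r = 0 \<or> Polynomial.degree r < Polynomial.degree g"
    unfolding r_def using assms(1) by (intro degree_mod_less) (auto simp: minpoly_def)
  ultimately have "r = 0" using assms(1) unfolding minpoly_def by force
  then show ?thesis by (simp add: r_def mod_eq_0_iff_dvd)
qed

lemma minpoly_degree_pos: assumes "minpoly x g" shows "0 < Polynomial.degree g"
proof (rule ccontr)
  assume "\<not> 0 < Polynomial.degree g"
  then obtain c where "g = [:c:]" using degree_0_id by (metis gr0I)
  then show False using assms by (simp add: minpoly_def)
qed

text \<open>Irreducibility of \<open>g\<close>: a minimal polynomial \<open>h\<close> of another
  root divides \<open>g\<close>, and \<open>x\<close> is a root of \<open>h\<close> or of the
  cofactor. Minimality at \<open>x\<close> forces \<open>h\<close> to have the full degree.\<close>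

lemma minpoly_root: assumes "minpoly x g" "poly (cpoly g) y = 0" shows "minpoly y g"
proof -
  obtain h where h: "minpoly y h" using minpoly_exists[of g y] assms by (auto simp: minpoly_def)
  obtain k where k: "g = h * k" using minpoly_dvd[OF h assms(2)] by (auto simp: dvd_def)
  have nz: "h \<noteq> 0" "k \<noteq> 0" using assms(1) k by (auto simp: minpoly_def)
  have deg: "Polynomial.degree g = Polynomial.degree h + Polynomial.degree k"
    unfolding k by (rule degree_mult_eq[OF nz])
  have "poly (cpoly h) x = 0 \<or> poly (cpoly k) x = 0"
    using assms(1) by (simp add: minpoly_def k cpoly_mult)
  then have "Polynomial.degree g \<le> Polynomial.degree h \<or> Polynomial.degree g \<le> Polynomial.degree k"
    using assms(1) nz by (auto simp: minpoly_def)
  then have "Polynomial.degree g = Polynomial.degree h"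
    using deg minpoly_degree_pos[OF h] by auto
  then show ?thesis using h assms by (simp add: minpoly_def)
qed

text \<open>Separability in characteristic zero: the derivative is nonzero and of smaller
  degree.\<close>

lemma minpoly_pderiv: assumes "minpoly x g" shows "poly (cpoly (pderiv g)) x \<noteq> 0"
proof
  assume "poly (cpoly (pderiv g)) x = 0"
  moreover have "pderiv g \<noteq> 0" using minpoly_degree_pos[OF assms] by (simp add: pderiv_eq_0_iff)
  ultimately have "Polynomial.degree g \<le> Polynomial.degree (pderiv g)" using assms by (simp add: minpoly_def)
  then show False using minpoly_degree_pos[OF assms] by (simp add: degree_pderiv)
qed

lemma minpoly_rsquarefree: assumes "minpoly x g" shows "rsquarefree (cpoly g)"
  unfolding rsquarefree_roots
proof (intro allI notI)
  fix z assume "poly (cpoly g) z = 0 \<and> poly (pderiv (cpoly g)) z = 0"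
  then show False using minpoly_pderiv[OF minpoly_root[OF assms, of z]] by (simp add: cpoly_pderiv)
qed

lemma minpoly_card_roots: assumes "minpoly x g"
  shows "card {z. poly (cpoly g) z = 0} = Polynomial.degree g"
proof -
  have "smult (lead_coeff (cpoly g)) (\<Prod>z|poly (cpoly g) z = 0. [:-z, 1:]) = cpoly g"
    by (rule complex_poly_decompose_rsquarefree[OF minpoly_rsquarefree[OF assms]])
  moreover have "lead_coeff (cpoly g) \<noteq> 0" using assms by (simp add: minpoly_def)
  ultimately have "Polynomial.degree (\<Prod>z|poly (cpoly g) z = 0. [:-z, 1:]) = Polynomial.degree g"
    by (metis degree_cpoly degree_smult_eq)
  then show ?thesis by (simp add: degree_prod_eq_sum_degree)
qed

text \<open>Split off the constant term of the minimal polynomial: \<open>r\<close> + x h(x) = 0. By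
  minimality \<open>r\<close> is nonzero, so -h(x)/\<open>r\<close> is the inverse.\<close>

lemma Qadj_inverse:
  assumes "P \<noteq> 0" "poly (cpoly P) x = 0" shows "inverse x \<in> Qadj x"
proof (cases "x = 0")
  case True
  then show ?thesis using Qadj_of_rat[of 0 x] by simp
next
  case False
  obtain g where g: "minpoly x g" using minpoly_exists[OF assms] .
  obtain r h where gh: "g = pCons r h" by (cases g) auto
  have h0: "h \<noteq> 0" using minpoly_degree_pos[OF g] by (auto simp: gh)
  have r: "r \<noteq> 0"
  proof
    assume "r = 0"
    then have "poly (cpoly h) x = 0" using g False by (simp add: minpoly_def gh)
    then have "Polynomial.degree g \<le> Polynomial.degree h" using g h0 by (simp add: minpoly_def)
    then show False using h0 by (simp add: gh)
  qed
  have eq: "of_rat r + x * poly (cpoly h) x = 0" using g by (simp add: minpoly_def gh)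
  have "inverse x = poly (cpoly (smult (- inverse r) h)) x"
  proof -
    have e2: "poly (cpoly (smult (- inverse r) h)) x = of_rat (- inverse r) * poly (cpoly h) x"
      by (simp only: cpoly_smult poly_smult)
    have "x * poly (cpoly (smult (- inverse r) h)) x = - (x * poly (cpoly h) x) / of_rat r"
      unfolding e2 by (simp add: of_rat_minus of_rat_inverse divide_inverse)
    also have "- (x * poly (cpoly h) x) = of_rat r" using eq by (simp add: add_eq_0_iff2)
    also have "of_rat r / of_rat r = (1::complex)" using r by simp
    finally show ?thesis by (simp add: inverse_unique)
  qed
  then show ?thesis by (simp add: QadjI)
qed

section \<open>The primitive element theorem\<close>

lemma division_coeffs:
  fixes F :: "complex set"
  assumes F0: "0 \<in> F" and Fadd: "\<And>x y. x \<in> F \<Longrightarrow> y \<in> F \<Longrightarrow> x + y \<in> F"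
    and Fm: "\<And>x y. x \<in> F \<Longrightarrow> y \<in> F \<Longrightarrow> x * y \<in> F" and Fu: "\<And>x. x \<in> F \<Longrightarrow> - x \<in> F"
    and Fi: "\<And>x. x \<in> F \<Longrightarrow> inverse x \<in> F"
    and d: "d \<noteq> 0" "\<And>i. Polynomial.coeff d i \<in> F" and p: "\<And>i. Polynomial.coeff p i \<in> F"
  shows "\<exists>q r. p = d * q + r \<and> (r = 0 \<or> Polynomial.degree r < Polynomial.degree d) \<and> (\<forall>i. Polynomial.coeff r i \<in> F)"
  using p
proof (induction "Polynomial.degree p" arbitrary: p rule: less_induct)
  case less
  show ?case
  proof (cases "p = 0 \<or> Polynomial.degree p < Polynomial.degree d")
    case True
    then show ?thesis using less.prems by (intro exI[of _ 0] exI[of _ p]) auto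
  next
    case False
    \<comment> \<open>\<open>F\<close> is a set of complex numbers, so the long division runs in the
      complex polynomial ring while the coefficients are tracked to stay in
      \<open>F\<close>.\<close>
    define c where "c = lead_coeff p * inverse (lead_coeff d)"
    define k where "k = Polynomial.degree p - Polynomial.degree d"
    define p' where "p' = p - Polynomial.monom c k * d"
    have c: "c \<in> F" using less.prems d(2) Fm Fi by (simp add: c_def)
    have p'F: "Polynomial.coeff p' i \<in> F" for i
    proof -
      have "Polynomial.coeff p' i = Polynomial.coeff p i + - (if k \<le> i then c * Polynomial.coeff d (i - k) else 0)"
        by (auto simp: p'_def coeff_monom_mult)
      moreover have "(if k \<le> i then c * Polynomial.coeff d (i - k) else 0) \<in> F" using c d F0 Fm by auto
      ultimately show ?thesis using less.prems Fadd Fu by metis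
    qed
    show ?thesis
    proof (cases "p' = 0")
      case True
      then have "p = d * Polynomial.monom c k + 0" by (simp add: p'_def mult.commute)
      then show ?thesis using F0 by (intro exI[of _ "Polynomial.monom c k"] exI[of _ 0]) auto
    next
      case p'0: False
      have "Polynomial.coeff p' i = 0" if "Polynomial.degree p \<le> i" for i
      proof (cases "i = Polynomial.degree p")
        case True
        have "i - k = Polynomial.degree d" "k \<le> i" using False True by (auto simp: k_def)
        then show ?thesis using True d(1) by (simp add: p'_def coeff_monom_mult c_def)
      next
        case ne: False
        then have "Polynomial.degree p < i" using that by simp
        moreover have "Polynomial.degree d < i - k" using ne that False by (auto simp: k_def)
        ultimately show ?thesis by (simp add: p'_def coeff_monom_mult coeff_eq_0)
      qed
      then have "Polynomial.degree p' < Polynomial.degree p"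
        using p'0 by (metis leading_coeff_0_iff linorder_not_le)
      from less.hyps[OF this p'F] obtain q r where
        qr: "p' = d * q + r" "r = 0 \<or> Polynomial.degree r < Polynomial.degree d" "\<forall>i. Polynomial.coeff r i \<in> F"
        by blast
      have "p = d * (Polynomial.monom c k + q) + r" using qr(1) by (simp add: p'_def algebra_simps)
      then show ?thesis using qr by blast
    qed
  qed
qed

text \<open>The classical choice c = a + t b. Over \<open>F\<close>, the field generated by
  \<open>c\<close>, the polynomials \<open>cpoly g\<close> and f(c - t X) both vanish at
  \<open>b\<close>; for suitable \<open>t\<close> they share no other root, and \<open>g\<close> is
  separable, so their common divisor is linear and \<open>b\<close> lies in
  \<open>F\<close>.\<close>

lemma primitive_element_two:
  assumes alg: "\<And>x. x \<in> K \<Longrightarrow> \<exists>P. P \<noteq> 0 \<and> poly (cpoly P) x = 0"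
    and add: "\<And>x y. x \<in> K \<Longrightarrow> y \<in> K \<Longrightarrow> x + y \<in> K"
    and mult: "\<And>x y. x \<in> K \<Longrightarrow> y \<in> K \<Longrightarrow> x * y \<in> K"
    and rat: "\<And>q. of_rat q \<in> K"
    and a: "a \<in> K" and b: "b \<in> K"
  obtains c where "c \<in> K" "a \<in> Qadj c" "b \<in> Qadj c"
proof -
  obtain f where f: "f \<noteq> 0" "poly (cpoly f) a = 0" using alg[OF a] by blast
  obtain g where g: "minpoly b g" using alg[OF b] minpoly_exists by metis
  define A where "A = {z. poly (cpoly f) z = 0}"
  define B where "B = {z. poly (cpoly g) z = 0}"
  have fin: "finite A" "finite B"
    using f g by (auto simp: A_def B_def minpoly_def intro!: poly_roots_finite)
  \<comment> \<open>A \<open>t\<close> outside this finite set satisfies c - t b' = a' for no root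
    a' of \<open>f\<close> and no root b' of \<open>g\<close> other than \<open>b\<close>; pairs
    with b' = b contribute only the value 0.\<close>
  define bad where "bad = (\<lambda>(a', b'). (a' - a) / (b - b')) ` (A \<times> B)"
  have "infinite (range (\<lambda>n::nat. of_nat n :: complex))"
    by (rule range_inj_infinite) (simp add: inj_on_def)
  then have "\<not> range (\<lambda>n::nat. of_nat n :: complex) \<subseteq> bad"
    using fin infinite_super[of _ bad] by (auto simp: bad_def)
  then obtain n :: nat where n: "(of_nat n :: complex) \<notin> bad" by blast
  define t where "t = (of_nat n :: complex)"
  define c where "c = a + t * b"
  have t: "t = of_rat (of_nat n)" by (simp add: t_def)
  have cK: "c \<in> K" unfolding c_def t using a b add mult rat by blast
  define F where "F = Qadj c"
  have ratF: "of_rat q \<in> F" for q unfolding F_def by (rule Qadj_of_rat)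
  have F: "0 \<in> F" "1 \<in> F" "c \<in> F" "t \<in> F" "\<And>x y. x \<in> F \<Longrightarrow> y \<in> F \<Longrightarrow> x + y \<in> F"
    "\<And>x y. x \<in> F \<Longrightarrow> y \<in> F \<Longrightarrow> x * y \<in> F" "\<And>x. x \<in> F \<Longrightarrow> - x \<in> F"
    using ratF[of 0] ratF[of 1] ratF[of "of_nat n"] Qadj_self Qadj_add Qadj_mult Qadj_uminus
    by (simp_all add: F_def t_def)
  have FK: "F \<subseteq> K"
  proof -
    have "poly (cpoly P) c \<in> K" for P
      by (induction P) (use rat[of 0] cK add mult rat in auto)
    then show ?thesis by (auto simp: F_def Qadj_def)
  qed
  have Fi: "inverse x \<in> F" if x: "x \<in> F" for x
  proof -
    obtain P where "P \<noteq> 0" "poly (cpoly P) x = 0" using alg x FK by blast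
    then have "inverse x \<in> Qadj x" by (rule Qadj_inverse)
    then show ?thesis using Qadj_trans[of x c] x by (auto simp: F_def)
  qed
  define h where "h = pcompose (cpoly f) [:c, - t:]"
  have hF: "Polynomial.coeff h i \<in> F" for i
  proof -
    have lin: "Polynomial.coeff ([:c, - t:] * p) i \<in> F" if "\<And>i. Polynomial.coeff p i \<in> F" for p i
    proof (cases i)
      case 0
      then show ?thesis using that F by simp
    next
      case (Suc j)
      have "Polynomial.coeff ([:c, - t:] * p) (Suc j) = c * Polynomial.coeff p (Suc j) + - (t * Polynomial.coeff p j)"
        by (simp add: coeff_pCons)
      then show ?thesis unfolding Suc using that F(3-7) by metis
    qed
    have "\<forall>i. Polynomial.coeff (pcompose (cpoly f) [:c, - t:]) i \<in> F"
    proof (induction f)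
      case 0
      then show ?case using F by simp
    next
      case (pCons r f)
      have "Polynomial.coeff [:of_rat r:] i \<in> F" for i
        using F(1) Qadj_of_rat[of r c] by (cases i) (auto simp: F_def)
      then show ?case using lin pCons F(5) by (simp add: pcompose_pCons)
    qed
    then show ?thesis by (simp add: h_def)
  qed
  have hb: "poly h b = 0" using f by (simp add: h_def poly_pcompose c_def mult.commute)
  have gF: "Polynomial.coeff (cpoly g) i \<in> F" for i using Qadj_of_rat by (simp add: F_def)
  let ?Q = "\<lambda>d. d \<noteq> 0 \<and> (\<forall>i. Polynomial.coeff d i \<in> F) \<and> poly d b = 0"
  have gQ: "?Q (cpoly g)" using g gF by (auto simp: minpoly_def)
  \<comment> \<open>A minimal polynomial of \<open>b\<close> over \<open>F\<close>; it plays the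
    role of the common divisor.\<close>
  obtain d where d: "?Q d" and dmin: "\<And>e. ?Q e \<Longrightarrow> Polynomial.degree d \<le> Polynomial.degree e"
    using ex_has_least_nat[of ?Q "cpoly g" Polynomial.degree, OF gQ] by blast
  have d0: "d \<noteq> 0" and dF: "\<And>i. Polynomial.coeff d i \<in> F" and db: "poly d b = 0" using d by auto
  have dvd: "d dvd p" if pF: "\<And>i. Polynomial.coeff p i \<in> F" and pb: "poly p b = 0" for p
  proof -
    obtain q r where qr: "p = d * q + r" "r = 0 \<or> Polynomial.degree r < Polynomial.degree d" "\<forall>i. Polynomial.coeff r i \<in> F"
      using division_coeffs[OF F(1,5,6,7) Fi d0 dF pF] by blast
    have "poly r b = 0" using qr(1) pb db by simp
    then have "r = 0" using dmin[of r] qr by force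
    then show ?thesis using qr(1) by simp
  qed
  have dg: "d dvd cpoly g" and dh: "d dvd h" using dvd gF hF hb g by (auto simp: minpoly_def)
  have only: "z = b" if dz: "poly d z = 0" for z
  proof (rule ccontr)
    assume "z \<noteq> b"
    have "z \<in> B" using dg dz by (auto simp: B_def dvd_def)
    moreover have "poly h z = 0" using dh dz by (auto simp: dvd_def)
    then have "c - t * z \<in> A" by (simp add: A_def h_def poly_pcompose mult.commute)
    ultimately have "((c - t * z) - a) / (b - z) \<in> bad" unfolding bad_def by (intro image_eqI[of _ _ "(c - t * z, z)"]) auto
    moreover have "((c - t * z) - a) / (b - z) = t" using \<open>z \<noteq> b\<close> by (simp add: c_def field_simps)
    ultimately show False using n by (simp add: t_def)
  qed
  obtain e where e: "d = [:- b, 1:] * e" using db by (auto simp: poly_eq_0_iff_dvd dvd_def)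
  \<comment> \<open>A further root of \<open>d\<close> could only be \<open>b\<close> again, making
    \<open>b\<close> a double root of \<open>cpoly g\<close>.\<close>
  have "Polynomial.degree e = 0"
  proof (rule ccontr)
    assume "Polynomial.degree e \<noteq> 0"
    then obtain z where "poly e z = 0"
      using fundamental_theorem_of_algebra[of e] by (auto simp: constant_degree)
    then have "poly e b = 0" using only[of z] by (simp add: e)
    then have "[:- b, 1:] dvd e" by (simp add: poly_eq_0_iff_dvd)
    then obtain e' where e': "e = [:- b, 1:] * e'" by (rule dvdE)
    obtain k where k: "cpoly g = d * k" using dg by (rule dvdE)
    define l where "l = [:- b, 1:]"
    have gl: "cpoly g = l * (l * (e' * k))" unfolding k e e' l_def by (simp only: mult.assoc)
    have "poly l b = 0" by (simp add: l_def)
    then have "poly (pderiv (cpoly g)) b = 0" unfolding gl pderiv_mult by simp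
    then show False using minpoly_pderiv[OF g] by (simp add: cpoly_pderiv)
  qed
  then obtain w where w: "e = [:w:]" using degree_0_id by metis
  have dw: "d = [:- b * w, w:]" by (simp add: e w)
  have w0: "w \<noteq> 0" using d0 dw by auto
  \<comment> \<open>The linear polynomial \<open>d\<close> has coefficients in \<open>F\<close>;
    their quotient recovers \<open>b\<close>.\<close>
  have "Polynomial.coeff d 0 = - b * w" "Polynomial.coeff d 1 = w" by (simp_all add: dw)
  then have "- (- b * w * inverse w) \<in> F" using dF F(6,7) Fi by metis
  moreover have "- (- b * w * inverse w) = b" using w0 by (simp add: field_simps)
  ultimately have bF: "b \<in> F" by metis
  have "a = c + - (t * b)" by (simp add: c_def)
  then have "a \<in> F" using bF F by metis
  then show ?thesis using that[of c] cK bF by (simp add: F_def)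
qed

lemma primitive_element:
  assumes alg: "\<And>x. x \<in> K \<Longrightarrow> \<exists>P. P \<noteq> 0 \<and> poly (cpoly P) x = 0"
    and add: "\<And>x y. x \<in> K \<Longrightarrow> y \<in> K \<Longrightarrow> x + y \<in> K"
    and mult: "\<And>x y. x \<in> K \<Longrightarrow> y \<in> K \<Longrightarrow> x * y \<in> K"
    and rat: "\<And>q. of_rat q \<in> K"
    and S: "finite S" "S \<subseteq> K"
  obtains c where "c \<in> K" "S \<subseteq> Qadj c"
proof -
  have "\<exists>c\<in>K. S \<subseteq> Qadj c"
    using S
  proof (induction S rule: finite_induct)
    case empty
    then show ?case using rat[of 0] by auto
  next
    case (insert a S)
    then obtain b where b: "b \<in> K" "S \<subseteq> Qadj b" by auto
    obtain c where c: "c \<in> K" "a \<in> Qadj c" "b \<in> Qadj c"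
      using primitive_element_two[OF alg add mult rat, of a b] insert.prems b by blast
    then show ?case using b Qadj_trans[OF c(3)] by blast
  qed
  then show ?thesis using that by blast
qed

text \<open>Up to a power of the leading coefficient this is the resultant of \<open>G\<close> and
  \<open>P\<close>, computed by the Euclidean algorithm: reduce \<open>P\<close> modulo
  \<open>G\<close>, then exchange the roles of \<open>G\<close> and the remainder. The roots are
  enumerated with multiplicity because remainders may have repeated roots.\<close>

lemma prod_roots_rational:
  assumes "G \<noteq> 0" "smult (lead_coeff (cpoly G)) (\<Prod>i<Polynomial.degree G. [:- rts i, 1:]) = cpoly G"
  shows "\<exists>q. (\<Prod>i<Polynomial.degree G. poly (cpoly P) (rts i)) = of_rat q"
  using assms
proof (induction "Polynomial.degree G" arbitrary: G P rts rule: less_induct)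
  case less
  show ?case
  proof (cases "Polynomial.degree G = 0")
    case True
    then show ?thesis by (auto intro!: exI[of _ 1])
  next
    case pos: False
    define R where "R = P mod G"
    have pG: "poly (cpoly G) x = lead_coeff (cpoly G) * (\<Prod>i<Polynomial.degree G. x - rts i)" for x
      by (subst less.prems(2)[symmetric]) (simp add: poly_prod)
    have Groot: "poly (cpoly G) (rts i) = 0" if "i < Polynomial.degree G" for i
      using that unfolding pG by auto
    have PR: "poly (cpoly P) (rts i) = poly (cpoly R) (rts i)" if "i < Polynomial.degree G" for i
    proof -
      have "P = P div G * G + R" by (simp add: R_def)
      then have "cpoly P = cpoly (P div G) * cpoly G + cpoly R" by (metis cpoly_add cpoly_mult)
      then show ?thesis using Groot[OF that] by simp
    qed
    have eq: "(\<Prod>i<Polynomial.degree G. poly (cpoly P) (rts i)) = (\<Prod>i<Polynomial.degree G. poly (cpoly R) (rts i))"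
      using PR by (intro prod.cong) auto
    show ?thesis
    proof (cases "R = 0")
      case True
      then show ?thesis unfolding eq using pos by (auto intro!: exI[of _ 0])
    next
      case R0: False
      have degR: "Polynomial.degree R < Polynomial.degree G"
        using degree_mod_less[OF less.prems(1), of P] R0 by (simp add: R_def)
      obtain rt where rt: "smult (lead_coeff (cpoly R)) (\<Prod>i<Polynomial.degree (cpoly R). [:- rt i, 1:]) = cpoly R"
        using complex_poly_decompose' by metis
      then have rt': "smult (lead_coeff (cpoly R)) (\<Prod>i<Polynomial.degree R. [:- rt i, 1:]) = cpoly R" by simp
      have pR: "poly (cpoly R) x = lead_coeff (cpoly R) * (\<Prod>i<Polynomial.degree R. x - rt i)" for x
        by (subst rt'[symmetric]) (simp add: poly_prod)
      obtain q where q: "(\<Prod>i<Polynomial.degree R. poly (cpoly G) (rt i)) = of_rat q"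
        using less.hyps[OF degR R0 rt'] by blast
      let ?n = "Polynomial.degree G" and ?m = "Polynomial.degree R"
      let ?D = "\<Prod>j<?m. \<Prod>i<?n. rt j - rts i"
      \<comment> \<open>Both products are expressed through the double product over pairs of roots;
        exchanging the two polynomials costs only a sign and powers of leading coefficients.\<close>
      have q': "of_rat q = of_rat (lead_coeff G) ^ ?m * ?D"
        unfolding q[symmetric] pG by (simp add: prod.distrib)
      have lcG: "of_rat (lead_coeff G) \<noteq> (0::complex)" using less.prems(1) by simp
      have "(\<Prod>i<?n. poly (cpoly R) (rts i)) = of_rat (lead_coeff R) ^ ?n * (\<Prod>i<?n. \<Prod>j<?m. rts i - rt j)"
        unfolding pR by (simp add: prod.distrib)
      also have "(\<Prod>i<?n. \<Prod>j<?m. rts i - rt j) = (\<Prod>j<?m. \<Prod>i<?n. - 1 * (rt j - rts i))"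
        by (subst prod.swap) simp
      also have "\<dots> = ((- 1) ^ ?n) ^ ?m * ?D" by (simp only: prod.distrib prod_constant card_lessThan)
      also have "?D = of_rat q / of_rat (lead_coeff G) ^ ?m" using q' lcG by (simp add: field_simps)
      finally have "(\<Prod>i<?n. poly (cpoly R) (rts i)) =
          of_rat (lead_coeff R ^ ?n * (((- 1) ^ ?n) ^ ?m * (q / lead_coeff G ^ ?m)))"
        by (simp add: of_rat_mult of_rat_divide of_rat_power of_rat_minus)
      then show ?thesis unfolding eq by (rule exI)
    qed
  qed
qed

text \<open>For a generator \<open>x\<close> of a number field this product is the norm of the
  element P(x).\<close>

lemma prod_minpoly_roots_rational:
  assumes "minpoly x g"
  obtains q where "(\<Prod>z|poly (cpoly g) z = 0. poly (cpoly P) z) = of_rat q"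
proof -
  let ?Z = "{z. poly (cpoly g) z = 0}"
  have fin: "finite ?Z" using assms by (intro poly_roots_finite) (simp add: minpoly_def)
  obtain rts where rts: "bij_betw rts {..<Polynomial.degree g} ?Z"
    using finite_same_card_bij[of "{..<Polynomial.degree g}" ?Z] fin minpoly_card_roots[OF assms] by auto
  have "smult (lead_coeff (cpoly g)) (\<Prod>i<Polynomial.degree g. [:- rts i, 1:]) = cpoly g"
    unfolding prod.reindex_bij_betw[OF rts, of "\<lambda>z. [:- z, 1:]"]
    by (rule complex_poly_decompose_rsquarefree[OF minpoly_rsquarefree[OF assms]])
  from prod_roots_rational[OF _ this, of P] assms that show ?thesis
    unfolding prod.reindex_bij_betw[OF rts, of "\<lambda>z. poly (cpoly P) z"] by (auto simp: minpoly_def)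
qed

section \<open>Local degrees\<close>

lemma complex_ring_simps [simp]:
  "carrier (ring_of_type_algebra :: complex ring) = UNIV"
  "x \<otimes>\<^bsub>ring_of_type_algebra\<^esub> y = (x * y :: complex)"
  "x \<oplus>\<^bsub>ring_of_type_algebra\<^esub> y = (x + y :: complex)"
  "\<one>\<^bsub>ring_of_type_algebra\<^esub> = (1 :: complex)"
  "\<zero>\<^bsub>ring_of_type_algebra\<^esub> = (0 :: complex)"
  by (simp_all add: ring_of_type_algebra_def)

lemma complex_ring_a_inv [simp]: "\<ominus>\<^bsub>ring_of_type_algebra\<^esub> x = (- x :: complex)"
proof -
  interpret field "ring_of_type_algebra :: complex ring" by (rule field_from_type_algebra)
  show ?thesis by (rule minus_equality) auto
qed

lemma complex_ring_inv [simp]: "x \<noteq> 0 \<Longrightarrow> inv\<^bsub>ring_of_type_algebra\<^esub> x = inverse (x :: complex)"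
proof -
  interpret field "ring_of_type_algebra :: complex ring" by (rule field_from_type_algebra)
  show "x \<noteq> 0 \<Longrightarrow> inv\<^bsub>ring_of_type_algebra\<^esub> x = inverse (x :: complex)"
    by (rule comm_inv_char) auto
qed

lemma field_ring_simps [simp]:
  "carrier (field_ring K) = K"
  "x \<otimes>\<^bsub>field_ring K\<^esub> y = x * y" "x \<oplus>\<^bsub>field_ring K\<^esub> y = x + y"
  "\<one>\<^bsub>field_ring K\<^esub> = 1" "\<zero>\<^bsub>field_ring K\<^esub> = 0"
  by (simp_all add: field_ring_def)

lemma subfield_abs_of_subfield:
  assumes "subfield K (ring_of_type_algebra :: complex ring)" "absolute_value (field_ring K) v"
  shows "subfield_abs K v"
proof -
  interpret C: field "ring_of_type_algebra :: complex ring" by (rule field_from_type_algebra)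
  note E = subringE[OF subfieldE(1)[OF assms(1)], simplified]
  have "inverse x \<in> K" if "x \<in> K" for x
    using C.subfield_m_inv(1)[OF assms(1), of x] that by (cases "x = 0") auto
  moreover have "x - y \<in> K" if "x \<in> K" "y \<in> K" for x y
    using E(7)[OF that(1) E(5)[OF that(2)]] by simp
  ultimately show ?thesis
    using assms(2) E by unfold_locales (auto simp: absolute_value_def)
qed

lemma valued_field_field_ring:
  assumes "subfield K (ring_of_type_algebra :: complex ring)" "absolute_value (field_ring K) v"
  shows "valued_field (field_ring K) v"
proof -
  interpret C: field "ring_of_type_algebra :: complex ring" by (rule field_from_type_algebra)
  have "field (field_ring K)" unfolding field_ring_def using C.subfield_iff(2)[OF assms(1)] by simp
  then show ?thesis using assms(2) by (intro valued_field.intro valued_field_axioms.intro)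
qed

lemma field_ring_minus:
  assumes "subfield K (ring_of_type_algebra :: complex ring)" "absolute_value (field_ring K) v" "x \<in> K" "y \<in> K"
  shows "x \<ominus>\<^bsub>field_ring K\<^esub> y = x - y"
proof -
  interpret valued_field "field_ring K" v by (rule valued_field_field_ring[OF assms(1,2)])
  interpret S: subfield_abs K v by (rule subfield_abs_of_subfield[OF assms(1,2)])
  have "\<ominus>\<^bsub>field_ring K\<^esub> y = - y" by (rule minus_equality) (use assms in auto)
  then show ?thesis by (simp add: a_minus_def)
qed

section \<open>Maximal locally independent families\<close>

context place_over
begin

text \<open>Dividing a combination by the coefficient of \<open>y\<close> and applying
  \<open>far\<close> controls that coefficient. Subtracting its term then controls the combination
  of the old family, at the price of the factor \<open>D\<close>.\<close>

lemma vindep_extend: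
  assumes "vindep a v n b" "\<And>i. i < n \<Longrightarrow> b i \<in> K" "y \<in> K" "0 < \<delta>"
    and far: "\<And>q :: nat \<Rightarrow> rat. \<delta> \<le> v (y - (\<Sum>i<n. of_rat (q i) * b i))"
  shows "vindep a v (Suc n) (b(n := y))"
proof -
  obtain c where c: "0 < c" "\<And>q i. i < n \<Longrightarrow> c * a (q i) \<le> v (\<Sum>i<n. of_rat (q i) * b i)"
    using assms(1) unfolding vindep_def by blast
  define D where "D = 1 + v y / \<delta>"
  have D: "1 \<le> D" using assms(3,4) by (simp add: D_def)
  define c' where "c' = min \<delta> (c / D)"
  have c': "0 < c'" "c' \<le> \<delta>" "c' \<le> c / D" using c D assms(4) by (auto simp: c'_def)
  have "c' * a (q i) \<le> v (\<Sum>i<Suc n. of_rat (q i) * (b(n := y)) i)" if i: "i < Suc n" for q :: "nat \<Rightarrow> rat" and i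
  proof -
    define T where "T = (\<Sum>i<n. of_rat (q i) * b i)"
    have TK: "T \<in> K" unfolding T_def using assms(2) by (intro sum_mem mult_mem) auto
    have S: "(\<Sum>i<Suc n. of_rat (q i) * (b(n := y)) i) = T + of_rat (q n) * y" by (simp add: T_def)
    have 1: "\<delta> * a (q n) \<le> v (T + of_rat (q n) * y)"
    proof (cases "q n = 0")
      case True
      have a0: "a 0 = 0" by simp
      show ?thesis using TK True by (simp add: a0)
    next
      case False
      define p where "p i = - q i / q n" for i
      have "(\<Sum>i<n. of_rat (p i) * b i) = - T / of_rat (q n)"
        unfolding T_def sum_negf[symmetric] sum_divide_distrib
        by (rule sum.cong) (auto simp: p_def of_rat_divide of_rat_minus)
      then have "T + of_rat (q n) * y = of_rat (q n) * (y - (\<Sum>i<n. of_rat (p i) * b i))"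
        using False by (simp add: field_simps)
      moreover have "y - (\<Sum>i<n. of_rat (p i) * b i) \<in> K"
        using assms(2,3) by (intro diff_mem sum_mem mult_mem) auto
      ultimately have "v (T + of_rat (q n) * y) = a (q n) * v (y - (\<Sum>i<n. of_rat (p i) * b i))" by simp
      then show ?thesis using mult_left_mono[OF far[of p] a_nonneg[of "q n"]]
        by (simp add: mult.commute)
    qed
    have 2: "c * a (q i) \<le> D * v (T + of_rat (q n) * y)" if "i < n" for i
    proof -
      have "c * a (q i) \<le> v T" using c(2)[OF that] by (simp add: T_def)
      also have "v T \<le> v (T + of_rat (q n) * y) + a (q n) * v y"
        using abs_diff[of "T + of_rat (q n) * y" "of_rat (q n) * y"] TK assms(3) by simp
      also have "a (q n) * v y \<le> v (T + of_rat (q n) * y) / \<delta> * v y"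
        using 1 assms(3,4) by (intro mult_right_mono) (auto simp: field_simps)
      finally show ?thesis by (simp add: D_def algebra_simps)
    qed
    show ?thesis unfolding S
    proof (cases "i = n")
      case True
      have "c' * a (q n) \<le> \<delta> * a (q n)" using c' by (intro mult_right_mono) auto
      then show "c' * a (q i) \<le> v (T + of_rat (q n) * y)" using 1 True by simp
    next
      case False
      then have "i < n" using i by simp
      have "c' * a (q i) \<le> c / D * a (q i)" using c' by (intro mult_right_mono) auto
      also have "\<dots> \<le> v (T + of_rat (q n) * y)" using 2[OF \<open>i < n\<close>] D by (simp add: field_simps)
      finally show "c' * a (q i) \<le> v (T + of_rat (q n) * y)" .
    qed
  qed
  then show ?thesis unfolding vindep_def using c'(1) by blast
qed

lemma vindep_le:
  assumes "vindep a v n b" "\<And>i. i < n \<Longrightarrow> b i \<in> K" "finite S" "K \<subseteq> rat_vec.span S"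
  shows "n \<le> card S"
  using sum_vindep_le[of "{v}" K a "\<lambda>_. n" "\<lambda>_. b" S] assms place_over_axioms by auto

text \<open>The sizes are bounded by the dimension over the rationals, so a largest family exists.
  An element at positive distance from its rational combinations could be added to it; hence these
  combinations are dense in \<open>K\<close>.\<close>

lemma exists_maximal_vindep:
  assumes "finite S" "K \<subseteq> rat_vec.span S"
  obtains n b where "vindep a v n b" "\<And>i. i < n \<Longrightarrow> b i \<in> K"
    "\<And>k b'. vindep a v k b' \<Longrightarrow> (\<And>i. i < k \<Longrightarrow> b' i \<in> K) \<Longrightarrow> k \<le> n"
    "\<And>y \<epsilon>. y \<in> K \<Longrightarrow> 0 < \<epsilon> \<Longrightarrow> \<exists>q :: nat \<Rightarrow> rat. v (y - (\<Sum>i<n. of_rat (q i) * b i)) < \<epsilon>"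
proof -
  define Q where "Q k \<longleftrightarrow> (\<exists>b. vindep a v k b \<and> (\<forall>i<k. b i \<in> K))" for k
  define n where "n = (GREATEST k. Q k)"
  have bound: "k \<le> card S" if "Q k" for k
    using that vindep_le[OF _ _ assms] unfolding Q_def by blast
  have "Q 0" unfolding Q_def vindep_def by (auto intro!: exI[of _ 1])
  then have "Q n" unfolding n_def using GreatestI_nat[of Q 0 "card S"] bound by blast
  have max: "k \<le> n" if "Q k" for k
    unfolding n_def using Greatest_le_nat[of Q k "card S"] bound that by blast
  obtain b where b: "vindep a v n b" "\<And>i. i < n \<Longrightarrow> b i \<in> K" using \<open>Q n\<close> unfolding Q_def by blast
  show ?thesis
  proof (rule that[OF b])
    show "k \<le> n" if "vindep a v k b'" "\<And>i. i < k \<Longrightarrow> b' i \<in> K" for k b'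
      using max[of k] that unfolding Q_def by blast
    fix y \<epsilon> assume y: "y \<in> K" and "(0::real) < \<epsilon>"
    show "\<exists>q :: nat \<Rightarrow> rat. v (y - (\<Sum>i<n. of_rat (q i) * b i)) < \<epsilon>"
    proof (rule ccontr)
      assume "\<not> ?thesis"
      then have "vindep a v (Suc n) (b(n := y))"
        using vindep_extend[OF b y \<open>0 < \<epsilon>\<close>] by (simp add: not_less)
      then have "Q (Suc n)" unfolding Q_def using b(2) y by (intro exI[of _ "b(n := y)"]) auto
      then show False using max by force
    qed
  qed auto
qed

end

context valued_field
begin

lemma Co_minus: assumes "s \<in> Cau" shows "\<ominus>\<^bsub>Co\<^esub> cls s = cls (\<lambda>i. \<ominus> s i)"
proof -
  interpret Co: field Co by (rule field_Co)
  show ?thesis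
    by (rule Co.minus_equality) (use assms in \<open>auto simp: cls_add cls_zero Cau_minus l_neg\<close>)
qed

lemma combine_cls:
  assumes "\<And>i. i \<in> set is \<Longrightarrow> s i \<in> Cau" "\<And>i. i \<in> set is \<Longrightarrow> b i \<in> carrier R"
  shows "ring.combine Co (map (\<lambda>i. cls (s i)) is) (map (\<lambda>i. completion_embed R v (b i)) is) =
      cls (\<lambda>t. foldr (\<lambda>i x. s i t \<otimes> b i \<oplus> x) is \<zero>) \<and>
    (\<lambda>t. foldr (\<lambda>i x. s i t \<otimes> b i \<oplus> x) is \<zero>) \<in> Cau"
  using assms
proof (induction "is")
  case Nil
  interpret Co: field Co by (rule field_Co)
  show ?case by (simp add: cls_zero)
next
  case (Cons i "is")
  interpret Co: field Co by (rule field_Co)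
  show ?case using Cons by (simp add: completion_embed_def cls_mult cls_add Cau_mult Cau_add)
qed

end

section \<open>The completion of K over the completed rationals\<close>

context
  fixes K :: "complex set" and v :: "complex \<Rightarrow> real" and a :: "rat \<Rightarrow> real"
  assumes sub: "subfield K (ring_of_type_algebra :: complex ring)"
    and abs_v: "absolute_value (field_ring K) v" and place: "place_over K v a"
begin

interpretation place_over K v a by (rule place)
interpretation V: valued_field "field_ring K" v by (rule valued_field_field_ring[OF sub abs_v])
interpretation Co: field "local_field K v" unfolding local_field_def by (rule V.field_Co)

lemma field_ring_diff: "x \<in> K \<Longrightarrow> y \<in> K \<Longrightarrow> x \<ominus>\<^bsub>field_ring K\<^esub> y = x - y"
  by (rule field_ring_minus[OF sub abs_v])

lemma field_ring_neg: "x \<in> K \<Longrightarrow> \<ominus>\<^bsub>field_ring K\<^esub> x = - x"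
  using field_ring_diff[of 0 x] by (simp add: a_minus_def)

lemma Cau_K: "s \<in> V.Cau \<Longrightarrow> s i \<in> K"
  using V.Cau_closed[of s i] by simp

text \<open>The only delicate point is inversion: the representative from \<open>Cau_inv\<close> has
  entries that are 0 or inverses of rationals, so it is again a rational sequence.\<close>

lemma subfield_local_base: "subfield (local_base K v) (local_field K v)"
proof (rule Co.subfieldI')
  let ?B = "{s \<in> V.Cau. range s \<subseteq> \<rat>}"
  show "subring (local_base K v) (local_field K v)"
  proof (rule Co.subringI)
    show "local_base K v \<subseteq> carrier (local_field K v)"
      by (auto simp: local_base_def local_field_def)
    show "\<one>\<^bsub>local_field K v\<^esub> \<in> local_base K v"
      unfolding local_base_def local_field_def V.cls_one by (rule imageI) auto
  next
    fix h assume "h \<in> local_base K v"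
    then obtain s where s: "s \<in> V.Cau" "range s \<subseteq> \<rat>" "h = V.cls s" by (auto simp: local_base_def)
    have "\<ominus>\<^bsub>local_field K v\<^esub> h = V.cls (\<lambda>i. - s i)"
      using V.Co_minus[OF s(1)] s(3) field_ring_neg[OF Cau_K[OF s(1)]] by (simp add: local_field_def)
    moreover have "(\<lambda>i. - s i) \<in> V.Cau"
      using V.Cau_minus[OF s(1)] field_ring_neg[OF Cau_K[OF s(1)]] by simp
    ultimately show "\<ominus>\<^bsub>local_field K v\<^esub> h \<in> local_base K v"
      unfolding local_base_def using s(2) by (auto intro!: image_eqI[of _ _ "\<lambda>i. - s i"])
  next
    fix g h assume "g \<in> local_base K v" "h \<in> local_base K v"
    then obtain s t where s: "s \<in> V.Cau" "range s \<subseteq> \<rat>" "g = V.cls s"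
      and t: "t \<in> V.Cau" "range t \<subseteq> \<rat>" "h = V.cls t" by (auto simp: local_base_def)
    have "g \<otimes>\<^bsub>local_field K v\<^esub> h = V.cls (\<lambda>i. s i * t i)" "g \<oplus>\<^bsub>local_field K v\<^esub> h = V.cls (\<lambda>i. s i + t i)"
      using V.cls_mult[OF s(1) t(1)] V.cls_add[OF s(1) t(1)] s(3) t(3) by (simp_all add: local_field_def)
    moreover have "(\<lambda>i. s i * t i) \<in> V.Cau" "(\<lambda>i. s i + t i) \<in> V.Cau"
      using V.Cau_mult[OF s(1) t(1)] V.Cau_add[OF s(1) t(1)] by simp_all
    moreover have "s i * t i \<in> \<rat>" "s i + t i \<in> \<rat>" for i
      using s(2) t(2) by (auto intro!: Rats_mult Rats_add simp: subset_iff)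
    ultimately show "g \<otimes>\<^bsub>local_field K v\<^esub> h \<in> local_base K v" "g \<oplus>\<^bsub>local_field K v\<^esub> h \<in> local_base K v"
      unfolding local_base_def by (auto simp: image_iff)
  qed
  fix k assume k: "k \<in> local_base K v - {\<zero>\<^bsub>local_field K v\<^esub>}"
  then obtain s where s: "s \<in> V.Cau" "range s \<subseteq> \<rat>" "k = V.cls s" by (auto simp: local_base_def)
  have "\<not> (\<lambda>i. v (s i)) \<longlonglongrightarrow> 0"
    using V.cls_eq_zero_iff[OF s(1)] k s(3) by (simp add: local_field_def)
  from V.Cau_inv[OF s(1) this] obtain t where t: "t \<in> V.Cau"
    "V.cls s \<otimes>\<^bsub>V.Co\<^esub> V.cls t = \<one>\<^bsub>V.Co\<^esub>"
    "\<And>i. t i = (if s i = \<zero>\<^bsub>field_ring K\<^esub> then \<zero>\<^bsub>field_ring K\<^esub> else inv\<^bsub>field_ring K\<^esub> s i)" by blast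
  have "inv\<^bsub>local_field K v\<^esub> k = V.cls t"
    using s t by (intro Co.comm_inv_char) (auto simp: local_field_def)
  moreover have "t i \<in> \<rat>" for i
  proof (cases "s i = 0")
    case False
    have "inv\<^bsub>field_ring K\<^esub> s i = inverse (s i)"
      using False Cau_K[OF s(1)] by (intro V.comm_inv_char) auto
    then show ?thesis using s(2) False t(3) by (auto intro!: Rats_inverse simp: subset_iff)
  qed (use t(3) in auto)
  ultimately show "inv\<^bsub>local_field K v\<^esub> k \<in> local_base K v"
    unfolding local_base_def using t(1) by auto
qed

lemma combine_local:
  assumes "\<And>i. i < n \<Longrightarrow> s i \<in> V.Cau" "\<And>i. i < n \<Longrightarrow> b i \<in> K"
  shows "Co.combine (map (\<lambda>i. V.cls (s i)) [0..<n]) (map (\<lambda>i. completion_embed (field_ring K) v (b i)) [0..<n]) =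
      V.cls (\<lambda>t. \<Sum>i<n. s i t * b i)" "(\<lambda>t. \<Sum>i<n. s i t * b i) \<in> V.Cau"
proof -
  have fold: "foldr (\<lambda>i x. s i t * b i + x) [0..<n] 0 = (\<Sum>i<n. s i t * b i)" for t
  proof -
    have "foldr (\<lambda>i x. s i t * b i + x) is 0 = sum_list (map (\<lambda>i. s i t * b i) is)" for "is"
      by (induction "is") auto
    then show ?thesis by (simp add: interv_sum_list_conv_sum_set_nat atLeast0LessThan)
  qed
  have c: "ring.combine V.Co (map (\<lambda>i. V.cls (s i)) [0..<n]) (map (\<lambda>i. completion_embed (field_ring K) v (b i)) [0..<n]) =
      V.cls (\<lambda>t. foldr (\<lambda>i x. s i t \<otimes>\<^bsub>field_ring K\<^esub> b i \<oplus>\<^bsub>field_ring K\<^esub> x) [0..<n] \<zero>\<^bsub>field_ring K\<^esub>) \<and>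
    (\<lambda>t. foldr (\<lambda>i x. s i t \<otimes>\<^bsub>field_ring K\<^esub> b i \<oplus>\<^bsub>field_ring K\<^esub> x) [0..<n] \<zero>\<^bsub>field_ring K\<^esub>) \<in> V.Cau"
    by (rule V.combine_cls) (use assms in auto)
  then show "Co.combine (map (\<lambda>i. V.cls (s i)) [0..<n]) (map (\<lambda>i. completion_embed (field_ring K) v (b i)) [0..<n]) =
      V.cls (\<lambda>t. \<Sum>i<n. s i t * b i)" "(\<lambda>t. \<Sum>i<n. s i t * b i) \<in> V.Cau"
    unfolding field_ring_simps fold local_field_def by simp_all
qed

text \<open>The \<open>vindep\<close> bound applies entrywise to rational sequences representing the
  coefficients: if the combination is null, so is each coefficient sequence.\<close>

lemma independent_local:
  assumes "vindep a v n b" "\<And>i. i < n \<Longrightarrow> b i \<in> K"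
  shows "Co.independent (local_base K v) (map (\<lambda>i. completion_embed (field_ring K) v (b i)) [0..<n])"
proof -
  let ?Us = "map (\<lambda>i. completion_embed (field_ring K) v (b i)) [0..<n]"
  have Us: "set ?Us \<subseteq> carrier (local_field K v)"
    using assms(2) by (auto simp: completion_embed_def local_field_def)
  obtain c where c: "0 < c" "\<And>q i. i < n \<Longrightarrow> c * a (q i) \<le> v (\<Sum>i<n. of_rat (q i) * b i)"
    using assms(1) unfolding vindep_def by blast
  show ?thesis
  proof (rule Co.trivial_combine_imp_independent[OF subfield_local_base Us])
    fix Ks assume Ks: "set Ks \<subseteq> local_base K v" "Co.combine Ks ?Us = \<zero>\<^bsub>local_field K v\<^esub>"
    \<comment> \<open>\<open>combine\<close> stops at the shorter of its two lists, and
      \<open>Ks\<close> may have any length.\<close>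
    define m where "m = min (length Ks) n"
    have "\<exists>s. s \<in> V.Cau \<and> range s \<subseteq> \<rat> \<and> Ks ! i = V.cls s" if "i < m" for i
    proof -
      have "Ks ! i \<in> local_base K v" using that Ks(1) by (auto simp: m_def)
      then show ?thesis by (auto simp: local_base_def)
    qed
    then obtain s where s: "\<And>i. i < m \<Longrightarrow> s i \<in> V.Cau" "\<And>i. i < m \<Longrightarrow> range (s i) \<subseteq> \<rat>"
      "\<And>i. i < m \<Longrightarrow> Ks ! i = V.cls (s i)" by metis
    have zip: "zip Ks ?Us = zip (map (\<lambda>i. V.cls (s i)) [0..<m]) (map (\<lambda>i. completion_embed (field_ring K) v (b i)) [0..<m])"
      by (rule nth_equalityI) (auto simp: m_def s(3))
    have "V.cls (\<lambda>t. \<Sum>i<m. s i t * b i) = \<zero>\<^bsub>V.Co\<^esub>"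
      using Ks(2) combine_local(1)[of m s b] s(1) assms(2)
      unfolding Co.combine_eq_foldr zip by (simp add: local_field_def m_def)
    then have lim: "(\<lambda>t. v (\<Sum>i<m. s i t * b i)) \<longlonglongrightarrow> 0"
      using V.cls_eq_zero_iff[OF combine_local(2)[of m s b]] s(1) assms(2) by (simp add: m_def)
    have "V.cls (s i) = \<zero>\<^bsub>V.Co\<^esub>" if i: "i < m" for i
    proof -
      have "v (s i t) \<le> v (\<Sum>i<m. s i t * b i) / c" for t
      proof -
        have "\<exists>q. s j t = of_rat q" if "j < m" for j
          using s(2)[OF that] by (auto simp: Rats_def subset_iff)
        then obtain q where q: "\<And>j. j < m \<Longrightarrow> s j t = of_rat (q j)" by metis
        define q' where "q' j = (if j < m then q j else 0)" for j
        have "(\<Sum>j<n. of_rat (q' j) * b j) = (\<Sum>j<m. of_rat (q' j) * b j)"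
          by (rule sum.mono_neutral_right) (auto simp: m_def q'_def)
        also have "\<dots> = (\<Sum>j<m. s j t * b j)" by (rule sum.cong) (auto simp: q q'_def)
        finally have "c * a (q' i) \<le> v (\<Sum>j<m. s j t * b j)" using c(2)[of i q'] i by (simp add: m_def)
        moreover have "v (s i t) = a (q' i)" using i q by (simp add: q'_def)
        ultimately show ?thesis using c(1) by (simp add: field_simps)
      qed
      then have up: "\<forall>\<^sub>F t in sequentially. v (s i t) \<le> v (\<Sum>i<m. s i t * b i) / c"
        by (rule always_eventually[rule_format])
      have low: "\<forall>\<^sub>F t in sequentially. 0 \<le> v (s i t)"
        using abs_nonneg[OF Cau_K[OF s(1)[OF i]]] by (rule always_eventually[rule_format])
      have "(\<lambda>t. v (\<Sum>i<m. s i t * b i) / c) \<longlonglongrightarrow> 0 / c"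
        using c(1) by (intro tendsto_divide lim tendsto_const) simp
      then have "(\<lambda>t. v (\<Sum>i<m. s i t * b i) / c) \<longlonglongrightarrow> 0" by simp
      from tendsto_sandwich[OF low up tendsto_const this] have "(\<lambda>t. v (s i t)) \<longlonglongrightarrow> 0" .
      then show ?thesis using V.cls_eq_zero_iff[OF s(1)[OF i]] by simp
    qed
    then show "set (take (length ?Us) Ks) \<subseteq> {\<zero>\<^bsub>local_field K v\<^esub>}"
      using s(3) by (auto simp: set_conv_nth m_def local_field_def)
  qed
qed

text \<open>Represent an element of the completion by a Cauchy sequence in \<open>K\<close> and
  approximate its t-th entry by a rational combination within 1/(t + 1). The \<open>vindep\<close>
  bound transfers the Cauchy property to each coefficient sequence, whose class is then a scalar in
  \<open>local_base\<close>.\<close>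

lemma Span_local:
  assumes "vindep a v n b" "\<And>i. i < n \<Longrightarrow> b i \<in> K"
    and dense: "\<And>y \<epsilon>. y \<in> K \<Longrightarrow> 0 < \<epsilon> \<Longrightarrow> \<exists>q :: nat \<Rightarrow> rat. v (y - (\<Sum>i<n. of_rat (q i) * b i)) < \<epsilon>"
  shows "Co.Span (local_base K v) (map (\<lambda>i. completion_embed (field_ring K) v (b i)) [0..<n]) = carrier (local_field K v)"
proof
  let ?Us = "map (\<lambda>i. completion_embed (field_ring K) v (b i)) [0..<n]"
  have Us: "set ?Us \<subseteq> carrier (local_field K v)"
    using assms(2) by (auto simp: completion_embed_def local_field_def)
  show "Co.Span (local_base K v) ?Us \<subseteq> carrier (local_field K v)"
    using Co.Span_in_carrier[OF subfieldE(3)[OF subfield_local_base] Us] .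
  obtain c where c: "0 < c" "\<And>q i. i < n \<Longrightarrow> c * a (q i) \<le> v (\<Sum>i<n. of_rat (q i) * b i)"
    using assms(1) unfolding vindep_def by blast
  show "carrier (local_field K v) \<subseteq> Co.Span (local_base K v) ?Us"
  proof
    fix x assume "x \<in> carrier (local_field K v)"
    then obtain y where y: "y \<in> V.Cau" "x = V.cls y" by (auto simp: local_field_def V.carrier_Co)
    have "\<forall>t. \<exists>q :: nat \<Rightarrow> rat. v (y t - (\<Sum>i<n. of_rat (q i) * b i)) < inverse (of_nat (Suc t))"
      using dense Cau_K[OF y(1)] by simp
    then obtain q :: "nat \<Rightarrow> nat \<Rightarrow> rat" where
      q: "\<And>t. v (y t - (\<Sum>i<n. of_rat (q t i) * b i)) < inverse (of_nat (Suc t))" by metis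
    define w where "w t = (\<Sum>i<n. of_rat (q t i) * b i)" for t
    have wK: "w t \<in> K" for t unfolding w_def using assms(2) by (intro sum_mem mult_mem) auto
    define s where "s i t = (of_rat (q t i) :: complex)" for i t
    have sC: "s i \<in> V.Cau" if i: "i < n" for i
    proof (rule V.CauI)
      show "s i t \<in> carrier (field_ring K)" for t by (simp add: s_def)
      fix e :: real assume "0 < e"
      \<comment> \<open>One third for each approximation and one for the original sequence; the
        factor \<open>c\<close> is lost in passing from combinations to coefficients.\<close>
      then have e3: "0 < c * e / 3" using c by simp
      obtain N1 where N1: "\<forall>t\<ge>N1. \<forall>u\<ge>N1. v (y t \<ominus>\<^bsub>field_ring K\<^esub> y u) < c * e / 3" using V.CauD[OF y(1) e3] by blast
      obtain N2 where N2: "inverse (of_nat (Suc N2)) < c * e / 3" using reals_Archimedean[OF e3] by blast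
      have "v (s i t \<ominus>\<^bsub>field_ring K\<^esub> s i u) < e" if tu: "t \<ge> max N1 N2" "u \<ge> max N1 N2" for t u
      proof -
        have small: "v (y t - w t) < c * e / 3" if "t \<ge> max N1 N2" for t
        proof -
          have "inverse (of_nat (Suc t)) \<le> (inverse (of_nat (Suc N2)) :: real)"
            using that by (intro le_imp_inverse_le) auto
          moreover have "v (y t - w t) < inverse (of_nat (Suc t))" using q[of t] by (simp only: w_def)
          ultimately show ?thesis using N2 by linarith
        qed
        have "v (y t - y u) < c * e / 3"
          using N1 tu field_ring_diff[OF Cau_K[OF y(1)] Cau_K[OF y(1)]] by simp
        moreover have "v (w t - w u) \<le> v (y t - w t) + v (y t - y u) + v (y u - w u)"
        proof -
          have "v (w t - w u) \<le> v (w t - y t) + v (y t - w u)"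
            using abs_diff_triangle[of "w t" "y t" "w u"] wK Cau_K[OF y(1)] by simp
          moreover have "v (y t - w u) \<le> v (y t - y u) + v (y u - w u)"
            using abs_diff_triangle[of "y t" "y u" "w u"] wK Cau_K[OF y(1)] by simp
          moreover have "v (w t - y t) = v (y t - w t)"
            using abs_uminus[of "y t - w t"] wK Cau_K[OF y(1)] by simp
          ultimately show ?thesis by linarith
        qed
        moreover have "c * v (s i t - s i u) \<le> v (w t - w u)"
          using c(2)[of i "\<lambda>i. q t i - q u i"] i
          by (simp add: s_def w_def of_rat_diff left_diff_distrib sum_subtractf flip: abs_of_rat)
        ultimately have "c * v (s i t - s i u) < c * e" using small[OF tu(1)] small[OF tu(2)] by linarith
        then have "v (s i t - s i u) < e" using c(1) by simp
        then show ?thesis using field_ring_diff by (simp add: s_def)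
      qed
      then show "\<exists>N. \<forall>t\<ge>N. \<forall>u\<ge>N. v (s i t \<ominus>\<^bsub>field_ring K\<^esub> s i u) < e" by blast
    qed
    have sw: "(\<lambda>t. \<Sum>i<n. s i t * b i) = w" by (simp add: s_def w_def fun_eq_iff)
    note cl = combine_local[of n s b, OF sC assms(2), unfolded sw]
    have "(\<lambda>t. v (y t - w t)) \<longlonglongrightarrow> 0"
    proof (rule tendsto_sandwich[of "\<lambda>_. 0" _ _ "\<lambda>t. inverse (of_nat (Suc t))"])
      show "(\<lambda>t. inverse (of_nat (Suc t)) :: real) \<longlonglongrightarrow> 0" by (rule LIMSEQ_inverse_real_of_nat)
    qed (use q wK Cau_K[OF y(1)] in \<open>auto simp: w_def less_imp_le intro!: always_eventually\<close>)
    then have "V.cls y = V.cls w"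
      using V.cls_eq_iff[OF y(1) cl(2)] field_ring_diff[OF Cau_K[OF y(1)] wK] by simp
    then have "x = Co.combine (map (\<lambda>i. V.cls (s i)) [0..<n]) ?Us" using cl(1) y(2) by simp
    moreover have "set (map (\<lambda>i. V.cls (s i)) [0..<n]) \<subseteq> local_base K v"
      using sC by (auto simp: local_base_def s_def)
    ultimately show "x \<in> Co.Span (local_base K v) ?Us"
      unfolding Co.Span_mem_iff_length_version[OF subfield_local_base Us]
      by (intro exI[of _ "map (\<lambda>i. V.cls (s i)) [0..<n]"]) auto
  qed
qed

text \<open>A maximal locally independent family becomes a basis of the completion. After this the
  local degree is known entirely through families in \<open>K\<close>.\<close>

lemma local_degree_vindep:
  assumes "finite S" "K \<subseteq> rat_vec.span S"
  obtains b where "vindep a v (local_degree K v) b" "\<And>i. i < local_degree K v \<Longrightarrow> b i \<in> K"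
    "\<And>k b'. vindep a v k b' \<Longrightarrow> (\<And>i. i < k \<Longrightarrow> b' i \<in> K) \<Longrightarrow> k \<le> local_degree K v"
proof -
  obtain n b where nb: "vindep a v n b" "\<And>i. i < n \<Longrightarrow> b i \<in> K"
    "\<And>k b'. vindep a v k b' \<Longrightarrow> (\<And>i. i < k \<Longrightarrow> b' i \<in> K) \<Longrightarrow> k \<le> n"
    "\<And>y \<epsilon>. y \<in> K \<Longrightarrow> 0 < \<epsilon> \<Longrightarrow> \<exists>q :: nat \<Rightarrow> rat. v (y - (\<Sum>i<n. of_rat (q i) * b i)) < \<epsilon>"
    using exists_maximal_vindep[OF assms] by blast
  let ?Us = "map (\<lambda>i. completion_embed (field_ring K) v (b i)) [0..<n]"
  have "Co.dimension (length ?Us) (local_base K v) (Co.Span (local_base K v) ?Us)"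
    using Co.dimension_independent[OF independent_local[OF nb(1,2)]] .
  then have "Co.dimension n (local_base K v) (carrier (local_field K v))"
    using Span_local[OF nb(1,2,4)] by simp
  then have "local_degree K v = n"
    using Co.dimI[OF subfield_local_base] by (simp add: local_degree_def over_def)
  then show ?thesis using that nb by blast
qed

end

section \<open>Places of a number field above a place of the rationals\<close>

lemma subfield_Rats: "subfield \<rat> (ring_of_type_algebra :: complex ring)"
proof -
  interpret C: field "ring_of_type_algebra :: complex ring" by (rule field_from_type_algebra)
  show ?thesis
  proof (rule C.subfieldI')
    show "subring \<rat> (ring_of_type_algebra :: complex ring)"
      by (rule C.subringI) auto
  qed auto
qed

lemma absolute_value_of_place: "place_over K v a \<Longrightarrow> absolute_value (field_ring K) v"
proof -
  assume "place_over K v a"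
  then interpret place_over K v a .
  show ?thesis by (simp add: absolute_value_def abs_add)
qed

lemma Span_Rats_subset:
  "x \<in> ring.Span (ring_of_type_algebra :: complex ring) \<rat> Us \<Longrightarrow> x \<in> rat_vec.span (set Us)"
proof (induction Us arbitrary: x)
  case Nil
  interpret C: field "ring_of_type_algebra :: complex ring" by (rule field_from_type_algebra)
  show ?case using Nil by simp
next
  case (Cons u Us)
  interpret C: field "ring_of_type_algebra :: complex ring" by (rule field_from_type_algebra)
  obtain k y where ky: "k \<in> \<rat>" "y \<in> C.Span \<rat> Us" "x = k * u + y"
    using Cons.prems by (auto simp: C.line_extension_mem_iff)
  obtain q where q: "k = of_rat q" using ky(1) by (auto elim: Rats_cases)
  have "y \<in> rat_vec.span (set (u # Us))"
    using Cons.IH[OF ky(2)] rat_vec.span_mono[of "set Us" "set (u # Us)"] by auto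
  moreover have "of_rat q * u \<in> rat_vec.span (set (u # Us))"
    by (rule rat_vec.span_scale) (rule rat_vec.span_base, simp)
  ultimately show ?case unfolding ky(3) q by (intro rat_vec.span_add)
qed

lemma number_field_span:
  assumes "number_field K"
  obtains S where "finite S" "S \<subseteq> K" "K \<subseteq> rat_vec.span S"
proof -
  interpret C: field "ring_of_type_algebra :: complex ring" by (rule field_from_type_algebra)
  obtain n where "C.dimension n \<rat> K"
    using assms unfolding number_field_def C.finite_dimension_def by blast
  from C.exists_base[OF subfield_Rats this] obtain Us where Us: "C.Span \<rat> Us = K" by blast
  show ?thesis
  proof (rule that[of "set Us"])
    show "set Us \<subseteq> K" using C.Span_base_incl[OF subfield_Rats, of Us] Us by auto
    show "K \<subseteq> rat_vec.span (set Us)" using Span_Rats_subset Us by blast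
  qed simp
qed

lemma nf_degree_pos: assumes "number_field K" shows "0 < nf_degree K"
proof -
  interpret C: field "ring_of_type_algebra :: complex ring" by (rule field_from_type_algebra)
  have "C.dimension (nf_degree K) \<rat> K"
    using C.finite_dimensionE[OF subfield_Rats] assms
    unfolding number_field_def nf_degree_def over_def by blast
  moreover have "1 \<in> K"
    using assms subringE(3)[OF subfieldE(1)] unfolding number_field_def by force
  ultimately show ?thesis using C.dimension_zero[OF subfield_Rats, of K] by (cases "nf_degree K = 0") auto
qed

text \<open>The powers of \<open>x\<close> with exponents up to \<open>card S\<close> are one too
  many to be independent.\<close>

lemma number_field_algebraic:
  assumes "number_field K" "x \<in> K"
  obtains P where "P \<noteq> 0" "poly (cpoly P) x = 0"
proof -
  have sub: "subfield K (ring_of_type_algebra :: complex ring)" using assms by (simp add: number_field_def)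
  note E = subringE[OF subfieldE(1)[OF sub], simplified]
  obtain S where S: "finite S" "K \<subseteq> rat_vec.span S" using number_field_span[OF assms(1)] .
  have xp: "x ^ i \<in> K" for i by (induction i) (use assms(2) E in auto)
  have "\<not> (\<forall>q. (\<Sum>i\<in>{..card S}. of_rat (q i) * x ^ i) = 0 \<longrightarrow> (\<forall>i\<in>{..card S}. q i = (0::rat)))"
  proof
    assume "\<forall>q. (\<Sum>i\<in>{..card S}. of_rat (q i) * x ^ i) = 0 \<longrightarrow> (\<forall>i\<in>{..card S}. q i = (0::rat))"
    then have "card {..card S} \<le> card S"
      using xp S by (intro independent_family_card_le[of _ "\<lambda>i. x ^ i"]) auto
    then show False by simp
  qed
  then obtain q i where q: "(\<Sum>i\<le>card S. of_rat (q i) * x ^ i) = 0" "i \<le> card S" "q i \<noteq> (0::rat)" by auto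
  define P where "P = (\<Sum>i\<le>card S. Polynomial.monom (q i) i)"
  have "Polynomial.coeff P i = q i" unfolding P_def coeff_sum using q(2) by simp
  then have "P \<noteq> 0" using q(3) by auto
  moreover have "poly (cpoly P) x = 0"
  proof -
    have "cpoly (\<Sum>i\<in>I. Polynomial.monom (q i) i) = (\<Sum>i\<in>I. Polynomial.monom (of_rat (q i)) i)" if "finite I" for I
      using that by (induction I rule: finite_induct) (simp_all add: cpoly_add map_poly_monom)
    then show ?thesis using q(1) by (simp add: P_def poly_sum poly_monom)
  qed
  ultimately show ?thesis using that by blast
qed

lemma number_field_primitive:
  assumes "number_field K"
  obtains \<theta> g where "minpoly \<theta> g" "K = Qadj \<theta>"
proof -
  have sub: "subfield K (ring_of_type_algebra :: complex ring)" using assms by (simp add: number_field_def)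
  note E = subringE[OF subfieldE(1)[OF sub], simplified]
  obtain S where S: "finite S" "S \<subseteq> K" "K \<subseteq> rat_vec.span S" using number_field_span[OF assms] .
  have rat: "of_rat q \<in> K" for q
  proof -
    interpret C: field "ring_of_type_algebra :: complex ring" by (rule field_from_type_algebra)
    have nat: "of_nat n \<in> K" for n by (induction n) (use E in auto)
    have int: "of_int n \<in> K" for n by (cases n rule: int_cases2) (use nat E in auto)
    have "inverse x \<in> K" if "x \<in> K" for x
      using C.subfield_m_inv(1)[OF sub, of x] that by (cases "x = 0") auto
    then show ?thesis by (cases q) (use int E in \<open>auto simp: of_rat_rat divide_inverse\<close>)
  qed
  obtain c where c: "c \<in> K" "S \<subseteq> Qadj c"
    using primitive_element[of K S] number_field_algebraic[OF assms] E rat S by metis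
  obtain P where "P \<noteq> 0" "poly (cpoly P) c = 0" using number_field_algebraic[OF assms c(1)] .
  then obtain g where g: "minpoly c g" by (rule minpoly_exists)
  have "rat_vec.subspace (Qadj c)"
    unfolding rat_vec.subspace_def
    using Qadj_of_rat[of 0 c] Qadj_add Qadj_mult[OF Qadj_of_rat] by auto
  then have "K \<subseteq> Qadj c" using rat_vec.span_minimal[OF c(2)] S(3) by blast
  moreover have "poly (cpoly P) c \<in> K" for P
    by (induction P) (use c rat[of 0] E rat in auto)
  then have "Qadj c \<subseteq> K" by (auto simp: Qadj_def)
  ultimately show ?thesis using that g by blast
qed

text \<open>Lagrange interpolation: \<open>R\<close> is the sum of its values on \<open>E\<close>
  times the basis polynomials \<open>L\<close>, so its coefficients are bounded by \<open>M\<close>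
  times the coefficients of these polynomials.\<close>

lemma interpolation_bound:
  assumes "place_over A w a" "finite E" "E \<subseteq> A"
  obtains c where "0 < c"
    "\<And>R M i. (\<And>i. card E \<le> i \<Longrightarrow> Polynomial.coeff R i = 0) \<Longrightarrow> (\<And>\<beta>. \<beta> \<in> E \<Longrightarrow> w (poly (cpoly R) \<beta>) \<le> M) \<Longrightarrow>
       0 \<le> M \<Longrightarrow> c * a (Polynomial.coeff R i) \<le> M"
proof -
  interpret place_over A w a by fact
  have polyA: "(\<forall>i. Polynomial.coeff (p * q) i \<in> A)" if "\<forall>i. Polynomial.coeff p i \<in> A" "\<forall>i. Polynomial.coeff q i \<in> A" for p q
    using that by (auto simp: coeff_mult intro!: sum_mem mult_mem)
  define L where "L \<beta> = smult (\<Prod>\<gamma>\<in>E - {\<beta>}. inverse (\<beta> - \<gamma>)) (\<Prod>\<gamma>\<in>E - {\<beta>}. [:- \<gamma>, 1:])" for \<beta>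
  have LA: "Polynomial.coeff (L \<beta>) i \<in> A" if b: "\<beta> \<in> E" for \<beta> i
  proof -
    have "\<forall>i. Polynomial.coeff (\<Prod>\<gamma>\<in>F. [:- \<gamma>, 1:]) i \<in> A" if "F \<subseteq> A" "finite F" for F
      using that(2,1)
    proof (induction F rule: finite_induct)
      case (insert \<gamma> F)
      have "\<forall>i. Polynomial.coeff [:- \<gamma>, 1:] i \<in> A" using insert.prems by (auto simp: coeff_pCons split: nat.splits)
      then show ?case using insert polyA by (simp del: mult_pCons_left)
    qed (auto simp: coeff_1)
    moreover have "E - {\<beta>} \<subseteq> A" "finite (E - {\<beta>})" using assms by auto
    moreover have "(\<Prod>\<gamma>\<in>E - {\<beta>}. inverse (\<beta> - \<gamma>)) \<in> A"
      using assms(3) b by (intro prod_mem inverse_mem diff_mem) auto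
    ultimately show ?thesis unfolding L_def by simp
  qed
  have Lval: "poly (L \<beta>) \<gamma> = (if \<gamma> = \<beta> then 1 else 0)" if "\<beta> \<in> E" "\<gamma> \<in> E" for \<beta> \<gamma>
  proof (cases "\<gamma> = \<beta>")
    case True
    have "(\<Prod>\<gamma>\<in>E - {\<beta>}. inverse (\<beta> - \<gamma>)) * (\<Prod>\<gamma>\<in>E - {\<beta>}. \<beta> - \<gamma>) = (\<Prod>\<gamma>\<in>E - {\<beta>}. inverse (\<beta> - \<gamma>) * (\<beta> - \<gamma>))"
      by (simp add: prod.distrib)
    also have "\<dots> = 1" by (rule prod.neutral) (auto intro!: left_inverse)
    finally show ?thesis using True by (simp add: L_def poly_prod)
  next
    case False
    then have "(\<Prod>x\<in>E - {\<beta>}. poly [:- x, 1:] \<gamma>) = 0" using that assms(2) by (intro prod_zero) auto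
    then show ?thesis using False by (simp only: L_def poly_prod poly_smult) simp
  qed
  have Ldeg: "Polynomial.degree (L \<beta>) < card E" if "\<beta> \<in> E" for \<beta>
  proof -
    have "Polynomial.degree (L \<beta>) \<le> Polynomial.degree (\<Prod>\<gamma>\<in>E - {\<beta>}. [:- \<gamma>, 1:])"
      unfolding L_def by (rule degree_smult_le)
    also have "\<dots> = card (E - {\<beta>})" by (simp add: degree_prod_eq_sum_degree)
    also have "\<dots> < card E" using that assms(2) by (intro psubset_card_mono) auto
    finally show ?thesis .
  qed
  \<comment> \<open>The summand 1 keeps \<open>C\<close> positive, also for empty
    \<open>E\<close>.\<close>
  define C where "C = 1 + (\<Sum>i<card E. \<Sum>\<beta>\<in>E. w (Polynomial.coeff (L \<beta>) i))"
  have C: "1 \<le> C" unfolding C_def using LA by (simp add: sum_nonneg)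
  show ?thesis
  proof (rule that[of "inverse C"])
    show "0 < inverse C" using C by simp
    fix R :: "rat poly" and M i
    assume R: "\<And>i. card E \<le> i \<Longrightarrow> Polynomial.coeff R i = 0"
      and M: "\<And>\<beta>. \<beta> \<in> E \<Longrightarrow> w (poly (cpoly R) \<beta>) \<le> M" "0 \<le> M"
    show "inverse C * a (Polynomial.coeff R i) \<le> M"
    proof (cases "i < card E")
      case False
      have a0: "a 0 = 0" by simp
      show ?thesis using R[of i] False M(2) by (simp add: a0)
    next
      case True
      then have E0: "0 < card E" by simp
      have "cpoly R = (\<Sum>\<beta>\<in>E. smult (poly (cpoly R) \<beta>) (L \<beta>))"
      proof (rule poly_eqI_degree[of E])
        fix \<gamma> assume g: "\<gamma> \<in> E"
        have "poly (\<Sum>\<beta>\<in>E. smult (poly (cpoly R) \<beta>) (L \<beta>)) \<gamma> = (\<Sum>\<beta>\<in>E. if \<beta> = \<gamma> then poly (cpoly R) \<beta> else 0)"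
          unfolding poly_sum by (rule sum.cong) (use Lval g in auto)
        then show "poly (cpoly R) \<gamma> = poly (\<Sum>\<beta>\<in>E. smult (poly (cpoly R) \<beta>) (L \<beta>)) \<gamma>"
          using g assms(2) by simp
      next
        show "Polynomial.degree (cpoly R) < card E"
        proof (rule ccontr)
          assume "\<not> Polynomial.degree (cpoly R) < card E"
          then have "Polynomial.coeff R (Polynomial.degree R) = 0" using R by simp
          then have "R = 0" by simp
          then show False using E0 \<open>\<not> Polynomial.degree (cpoly R) < card E\<close> by simp
        qed
        have "Polynomial.degree (\<Sum>\<beta>\<in>E. smult (poly (cpoly R) \<beta>) (L \<beta>)) \<le> card E - 1"
        proof (rule degree_sum_le[OF assms(2)])
          fix \<beta> assume "\<beta> \<in> E"
          then show "Polynomial.degree (smult (poly (cpoly R) \<beta>) (L \<beta>)) \<le> card E - 1"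
            using Ldeg[of \<beta>] degree_smult_le[of "poly (cpoly R) \<beta>" "L \<beta>"] by linarith
        qed
        then show "Polynomial.degree (\<Sum>\<beta>\<in>E. smult (poly (cpoly R) \<beta>) (L \<beta>)) < card E" using E0 by simp
      qed
      from arg_cong[OF this, of "\<lambda>p. Polynomial.coeff p i"]
      have e: "of_rat (Polynomial.coeff R i) = (\<Sum>\<beta>\<in>E. poly (cpoly R) \<beta> * Polynomial.coeff (L \<beta>) i)"
        by (simp only: coeff_sum coeff_smult coeff_cpoly)
      have RA: "poly (cpoly R) \<beta> \<in> A" if "\<beta> \<in> E" for \<beta> using that assms(3) by (intro poly_mem) auto
      have "a (Polynomial.coeff R i) = w (\<Sum>\<beta>\<in>E. poly (cpoly R) \<beta> * Polynomial.coeff (L \<beta>) i)"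
        unfolding e[symmetric] by simp
      also have "\<dots> \<le> (\<Sum>\<beta>\<in>E. w (poly (cpoly R) \<beta> * Polynomial.coeff (L \<beta>) i))"
        using RA LA by (intro abs_sum mult_mem) auto
      also have "\<dots> \<le> (\<Sum>\<beta>\<in>E. M * w (Polynomial.coeff (L \<beta>) i))"
        using RA LA M by (intro sum_mono) (auto intro!: mult_right_mono)
      also have "\<dots> = M * (\<Sum>\<beta>\<in>E. w (Polynomial.coeff (L \<beta>) i))" by (simp add: sum_distrib_left)
      also have "\<dots> \<le> M * C"
      proof (intro mult_left_mono M(2))
        have "(\<Sum>\<beta>\<in>E. w (Polynomial.coeff (L \<beta>) i)) \<le> (\<Sum>i<card E. \<Sum>\<beta>\<in>E. w (Polynomial.coeff (L \<beta>) i))"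
          using True LA by (intro member_le_sum[of i "{..<card E}" "\<lambda>i. \<Sum>\<beta>\<in>E. w (Polynomial.coeff (L \<beta>) i)"] sum_nonneg) auto
        then show "(\<Sum>\<beta>\<in>E. w (Polynomial.coeff (L \<beta>) i)) \<le> C" by (simp add: C_def)
      qed
      finally show ?thesis using C by (simp add: field_simps)
    qed
  qed
qed

text \<open>The field \<open>A\<close> contains all conjugates of the primitive element, so the
  embeddings of \<open>K\<close> into \<open>A\<close> correspond to the roots of \<open>g\<close>;
  \<open>w\<close> is a place of \<open>A\<close> above \<open>a\<close>.\<close>

locale number_field_places =
  fixes K :: "complex set" and \<theta> :: complex and g :: "rat poly"
    and A :: "complex set" and w :: "complex \<Rightarrow> real" and a :: "rat \<Rightarrow> real"
  assumes K: "number_field K" and g: "minpoly \<theta> g" and K_eq: "K = Qadj \<theta>"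
    and w: "place_over A w a" and roots_A: "{z. poly (cpoly g) z = 0} \<subseteq> A"
begin

definition Z :: "complex set" where "Z = {z. poly (cpoly g) z = 0}"

text \<open>Pullback of \<open>w\<close> along the embedding sending \<theta> to \<beta>. The
  polynomial representing \<open>x\<close> is chosen arbitrarily; \<open>conjugate_eq\<close> makes
  the value independent of it.\<close>

definition place_of :: "complex \<Rightarrow> complex \<Rightarrow> real" where
  "place_of \<beta> = restrict (\<lambda>x. w (poly (cpoly (SOME P. x = poly (cpoly P) \<theta>)) \<beta>)) K"

definition above :: "(complex \<Rightarrow> real) set" where
  "above = {v \<in> extensional K. place_over K v a}"

interpretation w: place_over A w a by (rule w)

lemma finite_Z: "finite Z"
  unfolding Z_def using g by (intro poly_roots_finite) (simp add: minpoly_def)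

lemma card_Z: "card Z = Polynomial.degree g"
  unfolding Z_def by (rule minpoly_card_roots[OF g])

lemma conjugate_eq:
  assumes "\<beta> \<in> Z" "poly (cpoly P) \<theta> = poly (cpoly Q) \<theta>"
  shows "poly (cpoly P) \<beta> = poly (cpoly Q) \<beta>"
proof -
  have "poly (cpoly (P + smult (- 1) Q)) \<theta> = 0"
    using assms(2) by (simp add: cpoly_add cpoly_smult del: smult_minus_left)
  then obtain k where "P + smult (- 1) Q = g * k" using minpoly_dvd[OF g] by (auto simp: dvd_def)
  then have "poly (cpoly (P + smult (- 1) Q)) \<beta> = 0"
    using assms(1) by (simp add: cpoly_mult Z_def)
  then show ?thesis by (simp add: cpoly_add cpoly_smult del: smult_minus_left)
qed

lemma place_of_poly:
  assumes "\<beta> \<in> Z" shows "place_of \<beta> (poly (cpoly P) \<theta>) = w (poly (cpoly P) \<beta>)"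
proof -
  define Q where "Q = (SOME Q. poly (cpoly P) \<theta> = poly (cpoly Q) \<theta>)"
  have "poly (cpoly P) \<theta> = poly (cpoly Q) \<theta>" unfolding Q_def by (rule someI[of _ P]) simp
  then have "poly (cpoly P) \<beta> = poly (cpoly Q) \<beta>" by (rule conjugate_eq[OF assms])
  moreover have "poly (cpoly P) \<theta> \<in> K" by (simp add: K_eq QadjI)
  ultimately show ?thesis unfolding place_of_def by (simp add: Q_def)
qed

lemma subfield_K: "subfield K (ring_of_type_algebra :: complex ring)"
  using K by (simp add: number_field_def)

lemma conjugate_in_A: "\<beta> \<in> Z \<Longrightarrow> poly (cpoly P) \<beta> \<in> A"
  using roots_A by (intro w.poly_mem) (auto simp: Z_def)

lemma place_of_above: assumes b: "\<beta> \<in> Z" shows "place_of \<beta> \<in> above"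
proof -
  interpret C: field "ring_of_type_algebra :: complex ring" by (rule field_from_type_algebra)
  note E = subringE[OF subfieldE(1)[OF subfield_K], simplified]
  have repr: "\<exists>P. x = poly (cpoly P) \<theta>" if "x \<in> K" for x using that by (auto simp: K_eq Qadj_def)
  have "place_over K (place_of \<beta>) a"
  proof
    show "1 \<in> K" using E by simp
    show "x - y \<in> K" if "x \<in> K" "y \<in> K" for x y using E(7)[OF that(1) E(5)[OF that(2)]] by simp
    show "x * y \<in> K" if "x \<in> K" "y \<in> K" for x y using E that by simp
    show "inverse x \<in> K" if "x \<in> K" for x
      using C.subfield_m_inv(1)[OF subfield_K, of x] that by (cases "x = 0") auto
    show "0 \<le> place_of \<beta> x" if "x \<in> K" for x
      using repr[OF that] conjugate_in_A[OF b] by (auto simp: place_of_poly[OF b])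
    show "(place_of \<beta> x = 0) = (x = 0)" if xK: "x \<in> K" for x
    proof -
      obtain P where P: "x = poly (cpoly P) \<theta>" using repr[OF xK] by blast
      have "poly (cpoly P) \<beta> = 0 \<longleftrightarrow> poly (cpoly P) \<theta> = 0"
      proof
        assume "poly (cpoly P) \<beta> = 0"
        moreover have "minpoly \<beta> g" using minpoly_root[OF g] b by (simp add: Z_def)
        ultimately have "g dvd P" using minpoly_dvd by blast
        then obtain k where "P = g * k" by (rule dvdE)
        then show "poly (cpoly P) \<theta> = 0" using g by (simp add: cpoly_mult minpoly_def)
      next
        assume "poly (cpoly P) \<theta> = 0"
        then show "poly (cpoly P) \<beta> = 0" using conjugate_eq[OF b, of P 0] by simp
      qed
      then show ?thesis using conjugate_in_A[OF b] by (simp add: P place_of_poly[OF b])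
    qed
    show "place_of \<beta> (x * y) = place_of \<beta> x * place_of \<beta> y" if xy: "x \<in> K" "y \<in> K" for x y
    proof -
      obtain P Q where PQ: "x = poly (cpoly P) \<theta>" "y = poly (cpoly Q) \<theta>" using repr[OF xy(1)] repr[OF xy(2)] by blast
      have "x * y = poly (cpoly (P * Q)) \<theta>" by (simp add: PQ cpoly_mult)
      then show ?thesis
        using conjugate_in_A[OF b] by (simp only: PQ place_of_poly[OF b]) (simp add: cpoly_mult)
    qed
    show "place_of \<beta> (x + y) \<le> place_of \<beta> x + place_of \<beta> y" if xy: "x \<in> K" "y \<in> K" for x y
    proof -
      obtain P Q where PQ: "x = poly (cpoly P) \<theta>" "y = poly (cpoly Q) \<theta>" using repr[OF xy(1)] repr[OF xy(2)] by blast
      have "x + y = poly (cpoly (P + Q)) \<theta>" by (simp add: PQ cpoly_add)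
      then show ?thesis
        using w.abs_add conjugate_in_A[OF b] by (simp only: PQ place_of_poly[OF b]) (simp add: cpoly_add)
    qed
    show "place_of \<beta> (of_rat q) = a q" for q
      using place_of_poly[OF b, of "[:q:]"] by simp
    show "\<exists>r. 1 < a r" by (rule w.nontrivial)
  qed
  then show ?thesis by (simp add: above_def place_of_def)
qed

definition fibre :: "(complex \<Rightarrow> real) \<Rightarrow> complex set" where
  "fibre v = {\<beta> \<in> Z. place_of \<beta> = v}"

text \<open>Every conjugate in the fibre assigns to R(\<theta>) the same absolute value, namely the
  one at \<open>v\<close>. A polynomial of degree below the fibre size is determined by its values
  on the fibre, so \<open>interpolation_bound\<close> bounds its coefficients by this single
  number.\<close>

lemma vindep_powers:
  assumes "v \<in> above"
  shows "vindep a v (card (fibre v)) (\<lambda>l. \<theta> ^ l)"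
proof -
  interpret v: place_over K v a using assms by (simp add: above_def)
  have f: "finite (fibre v)" "fibre v \<subseteq> A" using finite_Z roots_A by (auto simp: fibre_def Z_def)
  obtain c where c: "0 < c"
    "\<And>R M i. (\<And>i. card (fibre v) \<le> i \<Longrightarrow> Polynomial.coeff R i = 0) \<Longrightarrow>
       (\<And>\<beta>. \<beta> \<in> fibre v \<Longrightarrow> w (poly (cpoly R) \<beta>) \<le> M) \<Longrightarrow> 0 \<le> M \<Longrightarrow> c * a (Polynomial.coeff R i) \<le> M"
    using interpolation_bound[OF w f] by blast
  have "c * a (q i) \<le> v (\<Sum>i<card (fibre v). of_rat (q i) * \<theta> ^ i)" if i: "i < card (fibre v)" for q :: "nat \<Rightarrow> rat" and i
  proof -
    define R where "R = (\<Sum>i<card (fibre v). Polynomial.monom (q i) i)"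
    have co: "Polynomial.coeff R j = (if j < card (fibre v) then q j else 0)" for j
      unfolding R_def coeff_sum by simp
    have "cpoly (\<Sum>i\<in>I. Polynomial.monom (q i) i) = (\<Sum>i\<in>I. Polynomial.monom (of_rat (q i)) i)" if "finite I" for I
      using that by (induction I rule: finite_induct) (simp_all add: cpoly_add map_poly_monom)
    then have val: "poly (cpoly R) z = (\<Sum>i<card (fibre v). of_rat (q i) * z ^ i)" for z
      by (simp add: R_def poly_sum poly_monom)
    have vb: "w (poly (cpoly R) \<beta>) = v (poly (cpoly R) \<theta>)" if "\<beta> \<in> fibre v" for \<beta>
      using that place_of_poly[of \<beta> R] by (auto simp: fibre_def)
    have "0 \<le> v (poly (cpoly R) \<theta>)" using QadjI by (intro v.abs_nonneg) (simp add: K_eq)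
    then have "c * a (Polynomial.coeff R i) \<le> v (poly (cpoly R) \<theta>)"
      using vb by (intro c(2)) (auto simp: co)
    then show ?thesis using i by (simp add: co val)
  qed
  then show ?thesis unfolding vindep_def using c(1) by blast
qed

lemma K_span: "K \<subseteq> rat_vec.span ((\<lambda>i. \<theta> ^ i) ` {..<Polynomial.degree g})"
proof
  fix x assume "x \<in> K"
  then obtain P where P: "x = poly (cpoly P) \<theta>" by (auto simp: K_eq Qadj_def)
  define R where "R = P mod g"
  have "P = P div g * g + R" by (simp add: R_def)
  then have "cpoly P = cpoly (P div g) * cpoly g + cpoly R" by (metis cpoly_add cpoly_mult)
  then have xR: "x = poly (cpoly R) \<theta>" using g by (simp add: P minpoly_def)
  have deg: "Polynomial.coeff R i = 0" if "Polynomial.degree g \<le> i" for i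
  proof -
    have "R = 0 \<or> Polynomial.degree R < Polynomial.degree g"
      unfolding R_def using g by (intro degree_mod_less) (auto simp: minpoly_def)
    then show ?thesis using that by (auto intro: coeff_eq_0)
  qed
  have "x = (\<Sum>i\<le>Polynomial.degree R. of_rat (Polynomial.coeff R i) * \<theta> ^ i)"
    by (simp add: xR poly_altdef)
  also have "\<dots> \<in> rat_vec.span ((\<lambda>i. \<theta> ^ i) ` {..<Polynomial.degree g})"
  proof (rule rat_vec.span_sum)
    fix i
    show "of_rat (Polynomial.coeff R i) * \<theta> ^ i \<in> rat_vec.span ((\<lambda>i. \<theta> ^ i) ` {..<Polynomial.degree g})"
    proof (cases "i < Polynomial.degree g")
      case True
      then show ?thesis by (intro rat_vec.span_scale rat_vec.span_base) auto
    next
      case False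
      then show ?thesis using deg[of i] rat_vec.span_zero by simp
    qed
  qed
  finally show "x \<in> rat_vec.span ((\<lambda>i. \<theta> ^ i) ` {..<Polynomial.degree g})" .
qed

lemma sum_local_degree_le:
  assumes "finite V" "V \<subseteq> above"
  shows "(\<Sum>v\<in>V. local_degree K v) \<le> Polynomial.degree g"
proof -
  let ?S = "(\<lambda>i. \<theta> ^ i) ` {..<Polynomial.degree g}"
  have pl: "place_over K v a" if "v \<in> V" for v using that assms(2) by (auto simp: above_def)
  have "\<exists>b. vindep a v (local_degree K v) b \<and> (\<forall>i<local_degree K v. b i \<in> K)" if v: "v \<in> V" for v
    by (rule local_degree_vindep[OF subfield_K absolute_value_of_place[OF pl[OF v]] pl[OF v] _ K_span]) auto
  then obtain b where b: "\<And>v. v \<in> V \<Longrightarrow> vindep a v (local_degree K v) (b v)"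
    "\<And>v i. v \<in> V \<Longrightarrow> i < local_degree K v \<Longrightarrow> b v i \<in> K" by metis
  have "(\<Sum>v\<in>V. local_degree K v) \<le> card ?S"
  proof (rule sum_vindep_le[of V K a "local_degree K" b])
    fix u v assume uv: "u \<in> V" "v \<in> V" "u \<noteq> v"
    then have "u \<in> extensional K" "v \<in> extensional K" using assms(2) by (auto simp: above_def)
    then show "\<exists>x\<in>K. v x \<noteq> u x" using uv(3) extensionalityI by metis
  qed (use assms(1) pl b K_span in auto)
  also have "\<dots> \<le> Polynomial.degree g" using card_image_le[of "{..<Polynomial.degree g}"] by simp
  finally show ?thesis .
qed

text \<open>Powers of \<theta> are locally independent up to the fibre size. The family consisting
  of 1 alone gives positivity even for an empty fibre, which later rules out places not induced by a
  conjugate.\<close>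

lemma fibre_le_local_degree:
  assumes "v \<in> above" shows "card (fibre v) \<le> local_degree K v" "0 < local_degree K v"
proof -
  have pl: "place_over K v a" using assms by (simp add: above_def)
  interpret v: place_over K v a by (rule pl)
  have max: "k \<le> local_degree K v" if "vindep a v k b'" "\<And>i. i < k \<Longrightarrow> b' i \<in> K" for k b'
    using local_degree_vindep[OF subfield_K absolute_value_of_place[OF pl] pl _ K_span] that
    by (metis finite_imageI finite_lessThan)
  have "\<theta> \<in> K" using Qadj_self by (simp add: K_eq)
  then show "card (fibre v) \<le> local_degree K v"
    using max[OF vindep_powers[OF assms]] by simp
  have "vindep a v 1 (\<lambda>_. 1)" unfolding vindep_def by (auto intro!: exI[of _ 1])
  then show "0 < local_degree K v" using max[of 1] by fastforce
qed

text \<open>The fibres partition the conjugates, so their sizes add up to the degree of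
  \<open>g\<close>, while the sum of the local degrees is at most this degree. Equality must hold at
  each place, and one more place would add a positive local degree.\<close>

lemma above_eq: "above = place_of ` Z" "\<And>v. v \<in> above \<Longrightarrow> local_degree K v = card (fibre v)"
proof -
  let ?V = "place_of ` Z"
  have V: "finite ?V" "?V \<subseteq> above" using finite_Z place_of_above by auto
  have fib: "(\<Sum>v\<in>?V. card (fibre v)) = card Z"
    unfolding fibre_def using sum.image_gen[OF finite_Z, of "\<lambda>_. 1::nat" place_of] by simp
  have le: "(\<Sum>v\<in>?V. card (fibre v)) \<le> (\<Sum>v\<in>?V. local_degree K v)"
    using V fibre_le_local_degree by (intro sum_mono) auto
  have le2: "(\<Sum>v\<in>?V. local_degree K v) \<le> card Z"
    using sum_local_degree_le[OF V] card_Z by simp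
  show eq: "above = ?V"
  proof (rule ccontr)
    assume "above \<noteq> ?V"
    then obtain u where u: "u \<in> above" "u \<notin> ?V" using V(2) by blast
    have "(\<Sum>v\<in>insert u ?V. local_degree K v) \<le> card Z"
      using sum_local_degree_le[of "insert u ?V"] V u card_Z by simp
    then show False using V(1) u(2) fibre_le_local_degree(2)[OF u(1)] fib le by simp
  qed
  show "local_degree K v = card (fibre v)" if "v \<in> above" for v
  proof (rule ccontr)
    assume ne: "local_degree K v \<noteq> card (fibre v)"
    have "(\<Sum>v\<in>?V. card (fibre v)) < (\<Sum>v\<in>?V. local_degree K v)"
    proof (rule sum_strict_mono_ex1[OF V(1)])
      show "\<forall>v\<in>?V. card (fibre v) \<le> local_degree K v" using V fibre_le_local_degree by auto
      show "\<exists>v\<in>?V. card (fibre v) < local_degree K v"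
        using that ne fibre_le_local_degree(1)[OF that] unfolding eq by (intro bexI[of _ v]) simp_all
    qed
    then show False using fib le2 by simp
  qed
qed

lemma finite_above: "finite above"
  using above_eq(1) finite_Z by simp

text \<open>With the local degree equal to the fibre size, each power is a product over the fibre.
  Together the fibres give \<open>w\<close> of the norm, which is rational.\<close>

lemma prod_above:
  assumes "(\<Prod>z\<in>Z. poly (cpoly P) z) = of_rat q"
  shows "(\<Prod>v\<in>above. v (poly (cpoly P) \<theta>) ^ local_degree K v) = a q"
proof -
  have "(\<Prod>v\<in>above. v (poly (cpoly P) \<theta>) ^ local_degree K v) = (\<Prod>v\<in>place_of ` Z. \<Prod>\<beta>\<in>fibre v. w (poly (cpoly P) \<beta>))"
  proof (rule prod.cong[OF above_eq(1)])
    fix v assume "v \<in> place_of ` Z"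
    then have v: "v \<in> above" by (simp add: above_eq(1))
    have "(\<Prod>\<beta>\<in>fibre v. w (poly (cpoly P) \<beta>)) = (\<Prod>\<beta>\<in>fibre v. v (poly (cpoly P) \<theta>))"
      by (rule prod.cong) (auto simp: fibre_def place_of_poly)
    then show "v (poly (cpoly P) \<theta>) ^ local_degree K v = (\<Prod>\<beta>\<in>fibre v. w (poly (cpoly P) \<beta>))"
      by (simp add: above_eq(2)[OF v])
  qed
  also have "\<dots> = (\<Prod>\<beta>\<in>Z. w (poly (cpoly P) \<beta>))"
    unfolding fibre_def by (rule prod.image_gen[OF finite_Z, symmetric])
  also have "\<dots> = w (\<Prod>\<beta>\<in>Z. poly (cpoly P) \<beta>)"
    using conjugate_in_A by (intro w.abs_prod[symmetric]) auto
  also have "\<dots> = a q" unfolding assms by simp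
  finally show ?thesis .
qed

end

section \<open>The product formula\<close>

lemma padic_abs_of_int_divide:
  assumes p: "prime p" and x: "x \<noteq> 0" and y: "y \<noteq> 0"
  shows "padic_abs p (of_int x / of_int y) =
    real p powi (int (multiplicity (int p) y) - int (multiplicity (int p) x))"
proof -
  let ?m = "multiplicity (int p)"
  have pe: "prime_elem (int p)" using p by simp
  obtain n d where nd: "quotient_of (of_int x / of_int y) = (n, d)" by (cases "quotient_of (of_int x / of_int y)") auto
  have d: "d > 0" using quotient_of_denom_pos[OF nd] .
  have q: "(of_int x / of_int y :: rat) = of_int n / of_int d" using quotient_of_div[OF nd] .
  have n: "n \<noteq> 0" using q x y d by auto
  have "(of_int (x * d) :: rat) = of_int (n * y)" using q y d by (simp add: field_simps)
  \<comment> \<open>\<open>padic_abs\<close> is defined through lowest terms; comparing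
    multiplicities in this identity allows any fraction instead.\<close>
  then have "x * d = n * y" by (simp only: of_int_eq_iff)
  then have "?m x + ?m d = ?m n + ?m y"
    using prime_elem_multiplicity_mult_distrib[OF pe x, of d] prime_elem_multiplicity_mult_distrib[OF pe n y] d by simp
  then have "int (?m d) - int (?m n) = int (?m y) - int (?m x)" by linarith
  moreover have "(of_int x / of_int y :: rat) \<noteq> 0" using x y by simp
  ultimately show ?thesis unfolding padic_abs_def by (simp add: nd)
qed

lemma rat_as_quotient: obtains x y :: int where "y \<noteq> 0" "q = of_int x / (of_int y :: rat)"
proof -
  obtain x y where "quotient_of q = (x, y)" by (cases "quotient_of q") auto
  then show ?thesis using that[of y x] quotient_of_div quotient_of_denom_pos by fastforce
qed

lemma padic_abs_0 [simp]: "padic_abs p 0 = 0"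
  by (simp add: padic_abs_def)

lemma padic_abs_nonneg [simp]: "0 \<le> padic_abs p q"
  by (simp add: padic_abs_def)

lemma padic_abs_eq_0_iff [simp]: "prime p \<Longrightarrow> padic_abs p q = 0 \<longleftrightarrow> q = 0"
  by (auto simp: padic_abs_def dest: prime_gt_0_nat)

lemma padic_abs_mult: assumes p: "prime p" shows "padic_abs p (q * r) = padic_abs p q * padic_abs p r"
proof (cases "q = 0 \<or> r = 0")
  case False
  obtain x y where xy: "y \<noteq> 0" "q = of_int x / of_int y" by (rule rat_as_quotient)
  obtain z u where zu: "u \<noteq> 0" "r = of_int z / of_int u" by (rule rat_as_quotient)
  have nz: "x \<noteq> 0" "z \<noteq> 0" using False xy zu by auto
  have pe: "prime_elem (int p)" using p by simp
  have "q * r = of_int (x * z) / of_int (y * u)" by (simp add: xy zu)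
  then have "padic_abs p (q * r) =
      real p powi (int (multiplicity (int p) (y * u)) - int (multiplicity (int p) (x * z)))"
    using padic_abs_of_int_divide[OF p, of "x * z" "y * u"] nz xy zu by simp
  also have "\<dots> = real p powi ((int (multiplicity (int p) y) - int (multiplicity (int p) x)) +
      (int (multiplicity (int p) u) - int (multiplicity (int p) z)))"
    using nz xy zu by (simp add: prime_elem_multiplicity_mult_distrib[OF pe] algebra_simps)
  also have "\<dots> = padic_abs p q * padic_abs p r"
    using padic_abs_of_int_divide[OF p nz(1) xy(1)] padic_abs_of_int_divide[OF p nz(2) zu(1)] p
    by (simp add: xy(2) zu(2) power_int_add prime_gt_0_nat)
  finally show ?thesis .
qed auto

lemma padic_abs_of_int_le: assumes p: "prime p" shows "padic_abs p (of_int x) \<le> 1"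
proof (cases "x = 0")
  case False
  have "padic_abs p (of_int x) = real p powi (- int (multiplicity (int p) x))"
    using padic_abs_of_int_divide[OF p False, of 1] by simp
  also have "\<dots> = inverse (real p ^ multiplicity (int p) x)" by (simp add: power_int_minus)
  also have "\<dots> \<le> 1"
    using prime_ge_1_nat[OF p] by (intro inverse_le_1_iff[THEN iffD2] disjI2 one_le_power) auto
  finally show ?thesis .
qed auto

text \<open>Over a common denominator, a power of \<open>p\<close> dividing both numerators divides
  their sum.\<close>

lemma padic_abs_add_max: assumes p: "prime p" shows "padic_abs p (q + r) \<le> max (padic_abs p q) (padic_abs p r)"
proof (cases "q = 0 \<or> r = 0 \<or> q + r = 0")
  case False
  obtain x y where xy: "y \<noteq> 0" "q = of_int x / of_int y" by (rule rat_as_quotient)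
  obtain z u where zu: "u \<noteq> 0" "r = of_int z / of_int u" by (rule rat_as_quotient)
  let ?m = "multiplicity (int p)"
  define s where "s = x * u"
  define t where "t = z * y"
  define d where "d = y * u"
  have d: "d \<noteq> 0" using xy zu by (simp add: d_def)
  have q: "q = of_int s / of_int d" "r = of_int t / of_int d" "q + r = of_int (s + t) / of_int d"
    using xy zu by (simp_all add: s_def t_def d_def field_simps)
  have nz: "s \<noteq> 0" "t \<noteq> 0" "s + t \<noteq> 0" using False q by auto
  have "int p ^ min (?m s) (?m t) dvd s + t"
    by (intro dvd_add multiplicity_dvd') auto
  then have "min (?m s) (?m t) \<le> ?m (s + t)"
    using p nz(3) by (subst power_dvd_iff_le_multiplicity[symmetric]) auto
  then have "int (?m d) - int (?m (s + t)) \<le> max (int (?m d) - int (?m s)) (int (?m d) - int (?m t))" by linarith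
  then have "real p powi (int (?m d) - int (?m (s + t))) \<le> real p powi (max (int (?m d) - int (?m s)) (int (?m d) - int (?m t)))"
    using prime_ge_1_nat[OF p] by (intro power_int_increasing) auto
  also have "\<dots> \<le> max (real p powi (int (?m d) - int (?m s))) (real p powi (int (?m d) - int (?m t)))"
    by (simp add: max_def)
  also have "real p powi (int (?m d) - int (?m s)) = padic_abs p q"
    unfolding q(1) by (rule padic_abs_of_int_divide[OF p nz(1) d, symmetric])
  also have "real p powi (int (?m d) - int (?m t)) = padic_abs p r"
    unfolding q(2) by (rule padic_abs_of_int_divide[OF p nz(2) d, symmetric])
  finally show ?thesis
    unfolding q(3) padic_abs_of_int_divide[OF p nz(3) d] .
next
  case True
  then show ?thesis by (elim disjE) (auto simp: le_max_iff_disj)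
qed

lemma padic_abs_inverse_prime: assumes p: "prime p" shows "padic_abs p (1 / of_nat p) = p"
proof -
  have "int p \<noteq> 0" using prime_gt_0_nat[OF p] by simp
  then have "padic_abs p (of_int 1 / of_int (int p)) = real p powi (int (multiplicity (int p) (int p)) - int (multiplicity (int p) 1))"
    by (intro padic_abs_of_int_divide p) auto
  moreover have "multiplicity (int p) (int p) = 1"
    using p by (intro multiplicity_self) auto
  ultimately show ?thesis by simp
qed

lemma padic_abs_other_prime: assumes "prime p" "prime l" "p \<noteq> l" shows "padic_abs p (1 / of_nat l) = 1"
proof -
  have l: "int l \<noteq> 0" using prime_gt_0_nat[OF assms(2)] by simp
  have "padic_abs p (of_int 1 / of_int (int l)) = real p powi (int (multiplicity (int p) (int l)) - int (multiplicity (int p) 1))"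
    by (intro padic_abs_of_int_divide assms l) auto
  moreover have "\<not> int p dvd int l"
    using assms by (metis int_dvd_int_iff primes_dvd_imp_eq)
  then have "multiplicity (int p) (int l) = 0" by (rule not_dvd_imp_multiplicity_0)
  ultimately show ?thesis by simp
qed

text \<open>With \<open>T\<close> the primes dividing numerator or denominator, unique factorisation
  makes the p-adic product equal to denominator over numerator, the reciprocal of the real absolute
  value.\<close>

lemma rational_product_formula:
  assumes "q \<noteq> 0"
  obtains T where "finite T" "\<And>p. p \<in> T \<Longrightarrow> prime p"
    "\<And>p. prime p \<Longrightarrow> p \<notin> T \<Longrightarrow> padic_abs p q = 1" "(\<Prod>p\<in>T. padic_abs p q) * \<bar>of_rat q\<bar> = 1"
proof -
  obtain n d where nd: "quotient_of q = (n, d)" by (cases "quotient_of q") auto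
  have d: "d > 0" using quotient_of_denom_pos[OF nd] .
  have q: "q = of_int n / of_int d" using quotient_of_div[OF nd] .
  have n: "n \<noteq> 0" using assms q by auto
  define N where "N = nat \<bar>n\<bar>"
  define D where "D = nat d"
  have ND: "N \<noteq> 0" "D \<noteq> 0" using n d by (auto simp: N_def D_def)
  have mult: "multiplicity (int p) x = multiplicity p (nat \<bar>x\<bar>)" if "prime p" "x \<noteq> 0" for p x
  proof (rule antisym)
    have p: "\<not> is_unit (int p)" "\<not> is_unit p" using that(1) by auto
    have eq: "int p ^ k dvd x \<longleftrightarrow> p ^ k dvd nat \<bar>x\<bar>" for k
      by (metis dvd_abs_iff int_dvd_int_iff int_nat_eq abs_ge_zero of_nat_power)
    have "int p ^ multiplicity p (nat \<bar>x\<bar>) dvd x" unfolding eq by (rule multiplicity_dvd)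
    then show "multiplicity p (nat \<bar>x\<bar>) \<le> multiplicity (int p) x"
      using power_dvd_iff_le_multiplicity[OF that(2) p(1)] by blast
    have "p ^ multiplicity (int p) x dvd nat \<bar>x\<bar>" unfolding eq[symmetric] by (rule multiplicity_dvd)
    then show "multiplicity (int p) x \<le> multiplicity p (nat \<bar>x\<bar>)"
      using power_dvd_iff_le_multiplicity[of "nat \<bar>x\<bar>" p] that(2) p(2) by simp
  qed
  define T where "T = prime_factors N \<union> prime_factors D"
  have padic: "padic_abs p q = real p ^ multiplicity p D / real p ^ multiplicity p N" if "prime p" for p
  proof -
    have "padic_abs p q = real p powi (int (multiplicity p D) - int (multiplicity p N))"
      unfolding q using padic_abs_of_int_divide[OF that n, of d] d mult[OF that] n by (simp add: N_def D_def)
    then show ?thesis using prime_gt_0_nat[OF that] by (simp add: power_int_diff)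
  qed
  have prod: "(\<Prod>p\<in>T. p ^ multiplicity p M) = M" if "M \<noteq> 0" "prime_factors M \<subseteq> T" for M :: nat
  proof -
    have "(\<Prod>p\<in>T. p ^ multiplicity p M) = (\<Prod>p\<in>prime_factors M. p ^ multiplicity p M)"
    proof (rule prod.mono_neutral_right)
      show "\<forall>i\<in>T - prime_factors M. i ^ multiplicity i M = 1"
      proof
        fix i assume i: "i \<in> T - prime_factors M"
        then have "prime i" by (auto simp: T_def)
        then have "\<not> i dvd M" using i that(1) by (auto simp: prime_factors_dvd)
        then show "i ^ multiplicity i M = 1" by (simp add: not_dvd_imp_multiplicity_0)
      qed
    qed (use that(2) in \<open>auto simp: T_def\<close>)
    then show ?thesis using prod_prime_factors[OF that(1)] by simp
  qed
  show ?thesis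
  proof (rule that[of T])
    show "finite T" by (simp add: T_def)
    show "p \<in> T \<Longrightarrow> prime p" for p by (auto simp: T_def)
    show "padic_abs p q = 1" if "prime p" "p \<notin> T" for p
    proof -
      have "\<not> p dvd N" "\<not> p dvd D" using that ND by (auto simp: T_def prime_factors_dvd)
      then show ?thesis using padic[OF that(1)] by (simp add: not_dvd_imp_multiplicity_0)
    qed
    have "(\<Prod>p\<in>T. padic_abs p q) = (\<Prod>p\<in>T. real p ^ multiplicity p D / real p ^ multiplicity p N)"
      by (rule prod.cong[OF refl], rule padic) (auto simp: T_def)
    also have "\<dots> = real (\<Prod>p\<in>T. p ^ multiplicity p D) / real (\<Prod>p\<in>T. p ^ multiplicity p N)"
      by (simp add: prod_dividef)
    also have "\<dots> = real D / real N" using prod[OF ND(1)] prod[OF ND(2)] by (simp add: T_def)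
    finally have "(\<Prod>p\<in>T. padic_abs p q) = real D / real N" .
    moreover have "\<bar>of_rat q :: real\<bar> = real N / real D"
      using d n by (simp add: q of_rat_divide N_def D_def)
    ultimately show "(\<Prod>p\<in>T. padic_abs p q) * \<bar>of_rat q\<bar> = 1" using ND by simp
  qed
qed

section \<open>Valued fields containing the conjugates\<close>

lemma eval_rev_coeffs: "ring.eval (ring_of_type_algebra :: complex ring) (rev (coeffs p)) x = poly p x"
proof -
  interpret C: field "ring_of_type_algebra :: complex ring" by (rule field_from_type_algebra)
  show ?thesis
  proof (induction p)
    case (pCons c p)
    then have "coeffs (pCons c p) = c # coeffs p" by (auto simp: cCons_def)
    then show ?case using pCons C.eval_append_aux[of "rev (coeffs p)" c x] by (simp add: mult.commute)
  qed simp
qed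

text \<open>Adjoining finitely many algebraic numbers gives a finite extension of the rationals, to
  which the p-adic absolute value extends by the operator norm argument.\<close>

lemma exists_padic_place:
  assumes p: "prime p" and "finite Z" "\<And>z. z \<in> Z \<Longrightarrow> \<exists>P. P \<noteq> 0 \<and> poly (cpoly P) z = 0"
  obtains A w where "place_over A w (padic_abs p)" "Z \<subseteq> A"
proof -
  interpret C: field "ring_of_type_algebra :: complex ring" by (rule field_from_type_algebra)
  obtain zs where zs: "set zs = Z" using assms(2) finite_list by blast
  have alg: "(C.algebraic over \<rat>) z" if z: "z \<in> Z" for z
  proof -
    obtain P where P: "P \<noteq> 0" "poly (cpoly P) z = 0" using assms(3)[OF z] by blast
    show ?thesis
    proof (rule C.algebraicI)
      have "coeffs (cpoly P) \<noteq> []" using P(1) by simp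
      then have "hd (rev (coeffs (cpoly P))) \<noteq> 0"
        using P(1) by (simp add: hd_rev last_coeffs_eq_coeff_degree)
      moreover have "set (coeffs (cpoly P)) \<subseteq> \<rat>" by (auto simp: coeffs_def split: if_splits)
      ultimately show "rev (coeffs (cpoly P)) \<in> carrier (\<rat> [X]\<^bsub>ring_of_type_algebra\<^esub>)"
        by (simp add: univ_poly_carrier[symmetric] polynomial_def)
      show "rev (coeffs (cpoly P)) \<noteq> []" using P(1) by simp
    qed (use P(2) in \<open>simp add: eval_rev_coeffs\<close>)
  qed
  define A where "A = C.finite_extension \<rat> zs"
  have A: "subfield A ring_of_type_algebra" "C.finite_dimension \<rat> A"
    unfolding A_def using C.finite_extension_is_subfield[OF subfield_Rats, of zs]
      C.finite_extension_finite_dimension(1)[OF subfield_Rats, of zs] alg zs by auto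
  have RA: "\<rat> \<subseteq> A" and ZA: "Z \<subseteq> A"
    unfolding A_def using C.finite_extension_incl[of \<rat> zs] C.finite_extension_mem[OF subfieldE(1)[OF subfield_Rats], of zs] zs
    by auto
  define u where "u x = padic_abs p (THE q. x = of_rat q)" for x :: complex
  have u: "u (of_rat q) = padic_abs p q" for q by (simp add: u_def)
  have ua: "absolute_value (ring_of_type_algebra\<lparr>carrier := \<rat>\<rparr>) u"
    unfolding absolute_value_def
  proof (intro conjI ballI)
    fix x assume "x \<in> carrier (ring_of_type_algebra\<lparr>carrier := (\<rat> :: complex set)\<rparr>)"
    then obtain q where q: "x = of_rat q" by (auto elim: Rats_cases)
    show "0 \<le> u x" by (simp add: q u)
    show "(u x = 0) = (x = \<zero>\<^bsub>ring_of_type_algebra\<lparr>carrier := \<rat>\<rparr>\<^esub>)" using p by (simp add: q u)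
    fix y assume "y \<in> carrier (ring_of_type_algebra\<lparr>carrier := (\<rat> :: complex set)\<rparr>)"
    then obtain r where r: "y = of_rat r" by (auto elim: Rats_cases)
    show "u (x \<otimes>\<^bsub>ring_of_type_algebra\<lparr>carrier := \<rat>\<rparr>\<^esub> y) = u x * u y"
      by (simp add: q r u padic_abs_mult[OF p] flip: of_rat_mult)
    have "padic_abs p (q + r) \<le> padic_abs p q + padic_abs p r"
      using padic_abs_add_max[OF p, of q r] padic_abs_nonneg[of p q] padic_abs_nonneg[of p r] by linarith
    then show "u (x \<oplus>\<^bsub>ring_of_type_algebra\<lparr>carrier := \<rat>\<rparr>\<^esub> y) \<le> u x + u y"
      by (simp add: q r u flip: of_rat_add)
  qed
  interpret X: field_extension_abs ring_of_type_algebra \<rat> A u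
    by (intro field_extension_abs.intro field_extension_abs_axioms.intro C.field_axioms subfield_Rats A RA ua)
  obtain w where w: "absolute_value (ring_of_type_algebra\<lparr>carrier := A\<rparr>) w" "\<And>c. c \<in> \<rat> \<Longrightarrow> w c = u c"
    using X.exists_extension_finite[OF A(2)] by blast
  have "subfield_abs A w" by (rule subfield_abs_of_subfield[OF A(1)]) (use w(1) in \<open>simp add: field_ring_def\<close>)
  then have "place_over A w (padic_abs p)"
    by (intro place_over.intro place_over_axioms.intro)
       (use w(2) u padic_abs_inverse_prime[OF p] prime_gt_1_nat[OF p] in \<open>auto intro!: exI[of _ "1 / of_nat p"]\<close>)
  then show ?thesis using that ZA by blast
qed

lemma place_over_UNIV: "place_over UNIV norm (\<lambda>q. \<bar>of_rat q\<bar>)"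
proof
  fix q :: rat
  show "norm (of_rat q :: complex) = \<bar>of_rat q\<bar>"
    by (cases q) (simp add: of_rat_rat norm_divide abs_divide)
  show "\<exists>r::rat. 1 < \<bar>of_rat r :: real\<bar>" by (intro exI[of _ 2]) simp
qed (auto simp: norm_mult norm_triangle_ineq)

text \<open>An exponential eventually beats any polynomial factor. The exponent 3 is the one
  produced by the maximum modulus argument.\<close>

lemma le_of_power_growth:
  fixes s t c :: real
  assumes "0 \<le> t" and growth: "\<And>k. s ^ k \<le> c * (real k + 1) ^ 3 * t ^ k"
  shows "s \<le> t"
proof (rule ccontr)
  assume "\<not> s \<le> t"
  then have st: "t < s" by simp
  show False
  proof (cases "t = 0")
    case True
    then show False using growth[of 1] st by simp
  next
    case False
    then have t: "0 < t" using assms(1) by simp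
    \<comment> \<open>Bernoulli gives a linear lower bound for powers of \<open>r\<close>; its
      fourth power exceeds the cube. The minimum with 1 in \<open>m\<close> absorbs the constant
      term, giving \<open>m * (k + 1)\<close>.\<close>
    define r where "r = root 4 (s / t)"
    have r: "1 < r" "r ^ 4 = s / t" using st t by (auto simp: r_def)
    define m where "m = min 1 (r - 1)"
    have m: "0 < m" "m \<le> 1" "m \<le> r - 1" using r by (auto simp: m_def)
    have "m ^ 4 * (real k + 1) \<le> c" for k :: nat
    proof -
      have "m * (real k + 1) \<le> 1 + real k * (r - 1)"
        using mult_left_mono[OF m(3), of "real k"] m(2) by (simp add: algebra_simps)
      also have "\<dots> \<le> (1 + (r - 1)) ^ k" using r by (intro Bernoulli_inequality) auto
      finally have "m * (real k + 1) \<le> r ^ k" by simp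
      then have "(m * (real k + 1)) ^ 4 \<le> (r ^ k) ^ 4" using m by (intro power_mono) auto
      also have "(r ^ k) ^ 4 = (s / t) ^ k" by (simp add: r(2)[symmetric] mult.commute flip: power_mult)
      also have "\<dots> \<le> c * (real k + 1) ^ 3" using growth[of k] t by (simp add: power_divide field_simps)
      finally have "m ^ 4 * (real k + 1) * (real k + 1) ^ 3 \<le> c * (real k + 1) ^ 3"
        by (simp add: power_mult_distrib power4_eq_xxxx power3_eq_cube mult_ac)
      then show ?thesis by (rule mult_right_le_imp_le) simp
    qed
    moreover obtain k where "c < real k * m ^ 4" using reals_Archimedean3[of "m ^ 4"] m by auto
    ultimately show False using m by (smt (verit) mult.commute mult_left_mono zero_le_power)
  qed
qed

text \<open>Expand the k-th power binomially: the integer coefficients have absolute value at most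
  1, so only the number k + 1 of terms is lost, and taking k large removes it.\<close>

lemma (in subfield_abs) ultrametric:
  assumes int: "\<And>n. v (of_nat n) \<le> 1" and x: "x \<in> K" and y: "y \<in> K"
  shows "v (x + y) \<le> max (v x) (v y)"
proof (rule le_of_power_growth)
  let ?M = "max (v x) (v y)"
  show M: "0 \<le> ?M" using x by (simp add: le_max_iff_disj)
  fix k :: nat
  have "v (x + y) ^ k = v (\<Sum>i\<le>k. of_nat (k choose i) * x ^ i * y ^ (k - i))"
    using x y by (simp add: binomial_ring flip: abs_power)
  also have "\<dots> \<le> (\<Sum>i\<le>k. v (of_nat (k choose i) * x ^ i * y ^ (k - i)))"
    using x y by (intro abs_sum mult_mem) auto
  also have "\<dots> \<le> (\<Sum>i\<le>k. ?M ^ k)"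
  proof (rule sum_mono)
    fix i assume "i \<in> {..k}"
    have "v (of_nat (k choose i) * x ^ i * y ^ (k - i)) = v (of_nat (k choose i)) * (v x ^ i * v y ^ (k - i))"
      using x y by (simp add: mult.assoc)
    also have "\<dots> \<le> 1 * (?M ^ i * ?M ^ (k - i))"
      using x y int M by (intro mult_mono power_mono) auto
    also have "\<dots> = ?M ^ k" using \<open>i \<in> {..k}\<close> by (simp flip: power_add)
    finally show "v (of_nat (k choose i) * x ^ i * y ^ (k - i)) \<le> ?M ^ k" .
  qed
  also have "\<dots> = (real k + 1) * ?M ^ k" by simp
  also have "\<dots> \<le> 1 * (real k + 1) ^ 3 * ?M ^ k"
    using M self_le_power[of "real k + 1" 3] by (intro mult_right_mono) auto
  finally show "v (x + y) ^ k \<le> 1 * (real k + 1) ^ 3 * ?M ^ k" .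
qed

lemma (in subfield_abs) ultrametric_sum:
  assumes int: "\<And>n. v (of_nat n) \<le> 1" and "0 \<le> M"
    and f: "\<And>i. i \<in> I \<Longrightarrow> f i \<in> K" "\<And>i. i \<in> I \<Longrightarrow> v (f i) \<le> M"
  shows "v (\<Sum>i\<in>I. f i) \<le> M"
  using f
proof (induction I rule: infinite_finite_induct)
  case (insert x F)
  then have "v (f x + sum f F) \<le> max (v (f x)) (v (sum f F))" by (intro ultrametric int sum_mem) auto
  moreover have "v (f x) \<le> M" "v (sum f F) \<le> M" using insert by auto
  ultimately show ?case using insert.hyps by simp
qed (use assms in auto)

lemma padic_place_integers:
  assumes "prime p" "place_over K v (padic_abs p)" shows "v (of_nat n) \<le> 1"
proof -
  interpret place_over K v "padic_abs p" by fact
  show ?thesis using abs_of_rat[of "of_nat n"] padic_abs_of_int_le[OF assms(1), of "int n"] by simp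
qed

text \<open>Outside finitely many primes all nonzero coefficients of \<open>P\<close> are units. If
  \<open>x\<close> had absolute value above 1 there, the leading term would strictly dominate the
  others, contradicting the ultrametric inequality.\<close>

lemma abs_le_1_almost_everywhere:
  assumes P: "P \<noteq> 0" "poly (cpoly P) x = 0"
  obtains T where "finite T" "\<And>p v. prime p \<Longrightarrow> p \<notin> T \<Longrightarrow> place_over K v (padic_abs p) \<Longrightarrow> x \<in> K \<Longrightarrow> v x \<le> 1"
proof -
  have "\<exists>T. finite T \<and> (\<forall>p. prime p \<longrightarrow> p \<notin> T \<longrightarrow> padic_abs p q = 1)" if "q \<noteq> 0" for q
    using rational_product_formula[OF that] by metis
  then obtain T where T: "\<And>q. q \<noteq> 0 \<Longrightarrow> finite (T q)" "\<And>q p. q \<noteq> 0 \<Longrightarrow> prime p \<Longrightarrow> p \<notin> T q \<Longrightarrow> padic_abs p q = 1"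
    by metis
  define U where "U = (\<Union>q\<in>set (coeffs P) - {0}. T q)"
  show ?thesis
  proof (rule that[of U])
    show "finite U" using T(1) by (auto simp: U_def)
    fix p v assume p: "prime p" "p \<notin> U" and v: "place_over K v (padic_abs p)" and x: "x \<in> K"
    interpret place_over K v "padic_abs p" by (rule v)
    have co: "padic_abs p (Polynomial.coeff P i) = (if Polynomial.coeff P i = 0 then 0 else 1)" for i
    proof (cases "Polynomial.coeff P i = 0")
      case False
      then have "Polynomial.coeff P i \<in> set (coeffs P)" by (simp add: coeff_in_coeffs le_degree P(1))
      then show ?thesis using False T(2) p by (auto simp: U_def)
    qed auto
    show "v x \<le> 1"
    proof (rule ccontr)
      assume "\<not> v x \<le> 1"
      then have vx: "1 < v x" by simp
      let ?n = "Polynomial.degree P"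
      have n: "0 < ?n"
      proof (rule ccontr)
        assume "\<not> 0 < ?n"
        then obtain c where "P = [:c:]" using degree_0_id by (metis gr0I)
        then show False using P by simp
      qed
      have split: "of_rat (lead_coeff P) * x ^ ?n = - (\<Sum>i<?n. of_rat (Polynomial.coeff P i) * x ^ i)"
      proof -
        have "(\<Sum>i\<le>?n. of_rat (Polynomial.coeff P i) * x ^ i) = 0" using P(2) by (simp add: poly_altdef)
        moreover have "{..?n} = insert ?n {..<?n}" by auto
        ultimately show ?thesis by (simp add: eq_neg_iff_add_eq_0)
      qed
      have sK: "(\<Sum>i<?n. of_rat (Polynomial.coeff P i) * x ^ i) \<in> K" using x by (intro sum_mem mult_mem) auto
      have "v (of_rat (lead_coeff P) * x ^ ?n) = v x ^ ?n" using x co[of ?n] P(1) by simp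
      then have "v x ^ ?n = v (\<Sum>i<?n. of_rat (Polynomial.coeff P i) * x ^ i)"
        unfolding split using sK by simp
      also have "\<dots> \<le> v x ^ (?n - 1)"
      proof (rule ultrametric_sum)
        fix i assume i: "i \<in> {..<?n}"
        have "v x ^ i \<le> v x ^ (?n - 1)" using vx i by (intro power_increasing) auto
        then show "v (of_rat (Polynomial.coeff P i) * x ^ i) \<le> v x ^ (?n - 1)" using x co[of i] vx by simp
      qed (use x padic_place_integers[OF p(1) v] in auto)
      also have "\<dots> < v x ^ ?n" using vx n by (intro power_strict_increasing) auto
      finally show False by simp
    qed
  qed
qed

section \<open>Places of K grouped by the rational place below\<close>

definition padic_places :: "complex set \<Rightarrow> nat \<Rightarrow> (complex \<Rightarrow> real) set" where
  "padic_places K p = {v \<in> extensional K. place_over K v (padic_abs p)}"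

lemma finite_places_Union:
  assumes "number_field K" shows "finite_places K = (\<Union>p\<in>{p. prime p}. padic_places K p)"
proof -
  have sub: "subfield K (ring_of_type_algebra :: complex ring)" using assms by (simp add: number_field_def)
  have "place_over K v (padic_abs p) \<longleftrightarrow> absolute_value (field_ring K) v \<and> (\<forall>q::rat. v (of_rat q) = padic_abs p q)"
    if "prime p" for p v
  proof
    assume "place_over K v (padic_abs p)"
    then show "absolute_value (field_ring K) v \<and> (\<forall>q::rat. v (of_rat q) = padic_abs p q)"
      using absolute_value_of_place place_over.abs_of_rat by blast
  next
    assume *: "absolute_value (field_ring K) v \<and> (\<forall>q::rat. v (of_rat q) = padic_abs p q)"
    show "place_over K v (padic_abs p)"
    proof (intro place_over.intro place_over_axioms.intro)
      show "subfield_abs K v" using subfield_abs_of_subfield[OF sub] * by blast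
      show "\<exists>r. 1 < padic_abs p r"
        using padic_abs_inverse_prime[OF that] prime_gt_1_nat[OF that] by (intro exI[of _ "1 / of_nat p"]) simp
    qed (use * in blast)
  qed
  then show ?thesis unfolding finite_places_def padic_places_def by blast
qed

lemma infinite_places_eq:
  assumes "number_field K"
  shows "infinite_places K = {v \<in> extensional K. place_over K v (\<lambda>q. \<bar>of_rat q\<bar>)}"
proof -
  have sub: "subfield K (ring_of_type_algebra :: complex ring)" using assms by (simp add: number_field_def)
  have "place_over K v (\<lambda>q. \<bar>of_rat q\<bar>) \<longleftrightarrow> absolute_value (field_ring K) v \<and> (\<forall>q::rat. v (of_rat q) = \<bar>of_rat q\<bar>)" for v
  proof
    assume "place_over K v (\<lambda>q. \<bar>of_rat q\<bar>)"
    then show "absolute_value (field_ring K) v \<and> (\<forall>q::rat. v (of_rat q) = \<bar>of_rat q\<bar>)"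
      using absolute_value_of_place place_over.abs_of_rat by blast
  next
    assume *: "absolute_value (field_ring K) v \<and> (\<forall>q::rat. v (of_rat q) = \<bar>of_rat q\<bar>)"
    show "place_over K v (\<lambda>q. \<bar>of_rat q\<bar>)"
    proof (intro place_over.intro place_over_axioms.intro)
      show "subfield_abs K v" using subfield_abs_of_subfield[OF sub] * by blast
      show "\<exists>r::rat. 1 < \<bar>of_rat r :: real\<bar>" by (intro exI[of _ 2]) simp
    qed (use * in blast)
  qed
  then show ?thesis unfolding infinite_places_def by blast
qed

text \<open>The rational 1/l tells the two primes apart: its l-adic absolute value is l, its p-adic
  one is 1.\<close>

lemma padic_places_disjoint:
  assumes "prime p" "prime l" "p \<noteq> l" shows "padic_places K p \<inter> padic_places K l = {}"
proof (rule ccontr)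
  assume "\<not> ?thesis"
  then obtain v where "place_over K v (padic_abs p)" "place_over K v (padic_abs l)"
    by (auto simp: padic_places_def)
  then have "padic_abs p (1 / of_nat l) = padic_abs l (1 / of_nat l)" by (metis place_over.abs_of_rat)
  then show False
    using padic_abs_other_prime[OF assms] padic_abs_inverse_prime[OF assms(2)] prime_gt_1_nat[OF assms(2)] by simp
qed

context
  fixes K :: "complex set"
  assumes K: "number_field K"
begin

lemma padic_places_product:
  assumes "minpoly \<theta> g" "K = Qadj \<theta>" "prime p"
  shows "finite (padic_places K p)" "\<And>v. v \<in> padic_places K p \<Longrightarrow> 0 < local_degree K v"
    "\<And>P q. (\<Prod>z|poly (cpoly g) z = 0. poly (cpoly P) z) = of_rat q \<Longrightarrow>
       (\<Prod>v\<in>padic_places K p. v (poly (cpoly P) \<theta>) ^ local_degree K v) = padic_abs p q"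
proof -
  have g0: "g \<noteq> 0" using assms(1) by (simp add: minpoly_def)
  have "finite {z. poly (cpoly g) z = 0}" using g0 by (intro poly_roots_finite) simp
  then obtain A w where w: "place_over A w (padic_abs p)" "{z. poly (cpoly g) z = 0} \<subseteq> A"
    using exists_padic_place[OF assms(3)] g0 by (metis (mono_tags, lifting) mem_Collect_eq)
  interpret number_field_places K \<theta> g A w "padic_abs p"
    by (intro number_field_places.intro K assms w)
  have eq: "above = padic_places K p" by (simp add: above_def padic_places_def)
  show "finite (padic_places K p)" using finite_above eq by simp
  show "0 < local_degree K v" if "v \<in> padic_places K p" for v using fibre_le_local_degree(2) that eq by simp
  show "(\<Prod>v\<in>padic_places K p. v (poly (cpoly P) \<theta>) ^ local_degree K v) = padic_abs p q"
    if "(\<Prod>z|poly (cpoly g) z = 0. poly (cpoly P) z) = of_rat q" for P q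
    using prod_above[of P q] that eq by (simp add: Z_def)
qed

lemma infinite_places_product:
  assumes "minpoly \<theta> g" "K = Qadj \<theta>"
  shows "finite (infinite_places K)" "\<And>v. v \<in> infinite_places K \<Longrightarrow> 0 < local_degree K v"
    "\<And>P q. (\<Prod>z|poly (cpoly g) z = 0. poly (cpoly P) z) = of_rat q \<Longrightarrow>
       (\<Prod>v\<in>infinite_places K. v (poly (cpoly P) \<theta>) ^ local_degree K v) = \<bar>of_rat q\<bar>"
proof -
  interpret number_field_places K \<theta> g UNIV norm "\<lambda>q. \<bar>of_rat q\<bar>"
    by (intro number_field_places.intro K assms place_over_UNIV) auto
  have eq: "above = infinite_places K" by (simp only: above_def infinite_places_eq[OF K])
  show "finite (infinite_places K)" using finite_above unfolding eq .
  show "0 < local_degree K v" if "v \<in> infinite_places K" for v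
    by (rule fibre_le_local_degree(2)) (use that eq in blast)
  show "(\<Prod>v\<in>infinite_places K. v (poly (cpoly P) \<theta>) ^ local_degree K v) = \<bar>of_rat q\<bar>"
    if "(\<Prod>z|poly (cpoly g) z = 0. poly (cpoly P) z) = of_rat q" for P q
    using prod_above[of P q] that unfolding eq Z_def by blast
qed

lemma local_degree_pos: assumes "v \<in> places K" shows "0 < local_degree K v"
proof -
  obtain \<theta> g where "minpoly \<theta> g" "K = Qadj \<theta>" using number_field_primitive[OF K] .
  from padic_places_product(2)[OF this] infinite_places_product(2)[OF this] assms
  show ?thesis unfolding places_def finite_places_Union[OF K] by blast
qed

lemma finite_infinite_places: "finite (infinite_places K)"
  using number_field_primitive[OF K] infinite_places_product(1) by metis

text \<open>The bound by 1 holds for \<open>x\<close> and for its inverse outside finitely many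
  primes.\<close>

lemma almost_all_units:
  assumes x: "x \<in> K" "x \<noteq> 0"
  obtains T where "finite T" "\<And>p v. prime p \<Longrightarrow> p \<notin> T \<Longrightarrow> v \<in> padic_places K p \<Longrightarrow> v x = 1"
proof -
  have "inverse x \<in> K"
  proof -
    obtain \<theta> g where tg: "minpoly \<theta> g" "K = Qadj \<theta>" using number_field_primitive[OF K] .
    obtain P where "P \<noteq> 0" "poly (cpoly P) x = 0" using number_field_algebraic[OF K x(1)] .
    then have "inverse x \<in> Qadj x" by (rule Qadj_inverse)
    then show ?thesis using Qadj_trans[of x \<theta>] x(1) tg(2) by blast
  qed
  obtain P where P: "P \<noteq> 0" "poly (cpoly P) x = 0" using number_field_algebraic[OF K x(1)] .
  obtain Q where Q: "Q \<noteq> 0" "poly (cpoly Q) (inverse x) = 0" using number_field_algebraic[OF K \<open>inverse x \<in> K\<close>] .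
  obtain T where T: "finite T" "\<And>p v. prime p \<Longrightarrow> p \<notin> T \<Longrightarrow> place_over K v (padic_abs p) \<Longrightarrow> x \<in> K \<Longrightarrow> v x \<le> 1"
    using abs_le_1_almost_everywhere[OF P] by blast
  obtain U where U: "finite U" "\<And>p v. prime p \<Longrightarrow> p \<notin> U \<Longrightarrow> place_over K v (padic_abs p) \<Longrightarrow> inverse x \<in> K \<Longrightarrow> v (inverse x) \<le> 1"
    using abs_le_1_almost_everywhere[OF Q] by blast
  show ?thesis
  proof (rule that[of "T \<union> U"])
    show "finite (T \<union> U)" using T U by simp
    fix p v assume p: "prime p" "p \<notin> T \<union> U" "v \<in> padic_places K p"
    then interpret place_over K v "padic_abs p" by (simp add: padic_places_def)
    have "v x \<le> 1" using T(2)[OF p(1) _ place_over_axioms x(1)] p(2) by blast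
    moreover have "v (inverse x) \<le> 1" using U(2)[OF p(1) _ place_over_axioms \<open>inverse x \<in> K\<close>] p(2) by blast
    moreover have "0 < v x" using abs_pos x by blast
    ultimately show "v x = 1" using x(1) by (simp add: inverse_le_1_iff)
  qed
qed

lemma finite_support:
  assumes "x \<in> K" "x \<noteq> 0" shows "finite {v \<in> finite_places K. v x \<noteq> 1}"
proof -
  obtain \<theta> g where tg: "minpoly \<theta> g" "K = Qadj \<theta>" using number_field_primitive[OF K] .
  obtain T where T: "finite T" "\<And>p v. prime p \<Longrightarrow> p \<notin> T \<Longrightarrow> v \<in> padic_places K p \<Longrightarrow> v x = 1"
    using almost_all_units[OF assms] by blast
  have "{v \<in> finite_places K. v x \<noteq> 1} \<subseteq> (\<Union>p\<in>{p \<in> T. prime p}. padic_places K p)"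
    using T(2) unfolding finite_places_Union[OF K] by blast
  then show ?thesis
    by (rule finite_subset) (use T(1) padic_places_product(1)[OF tg] in auto)
qed

text \<open>Grouped by the rational place below, the product becomes the rational product formula
  for the norm of \<open>x\<close>. Any finite \<open>W\<close> covering the places where
  \<open>x\<close> is not a unit is allowed, so that one set can later serve several
  numbers.\<close>

theorem product_formula:
  assumes x: "x \<in> K" "x \<noteq> 0"
    and W: "finite W" "W \<subseteq> finite_places K" "\<And>v. v \<in> finite_places K \<Longrightarrow> v x \<noteq> 1 \<Longrightarrow> v \<in> W"
  shows "(\<Prod>v\<in>W. v x ^ local_degree K v) * (\<Prod>v\<in>infinite_places K. v x ^ local_degree K v) = 1"
proof -
  obtain \<theta> g where tg: "minpoly \<theta> g" "K = Qadj \<theta>" using number_field_primitive[OF K] .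
  obtain P where P: "x = poly (cpoly P) \<theta>" using x(1) by (auto simp: tg(2) Qadj_def)
  obtain q where q: "(\<Prod>z|poly (cpoly g) z = 0. poly (cpoly P) z) = of_rat q"
    using prod_minpoly_roots_rational[OF tg(1)] by blast
  have inf: "(\<Prod>v\<in>infinite_places K. v x ^ local_degree K v) = \<bar>of_rat q\<bar>"
    unfolding P by (rule infinite_places_product(3)[OF tg q])
  have "q \<noteq> 0"
  proof
    assume "q = 0"
    then have "(\<Prod>v\<in>infinite_places K. v x ^ local_degree K v) = 0" using inf by simp
    then obtain v where v: "v \<in> infinite_places K" "v x = 0"
      using infinite_places_product(1)[OF tg] by (auto simp: prod_zero_iff)
    then interpret place_over K v "\<lambda>q. \<bar>of_rat q\<bar>" by (simp add: infinite_places_eq[OF K])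
    show False using v(2) x by simp
  qed
  obtain T0 where T0: "finite T0" "\<And>p. p \<in> T0 \<Longrightarrow> prime p"
    "\<And>p. prime p \<Longrightarrow> p \<notin> T0 \<Longrightarrow> padic_abs p q = 1" "(\<Prod>p\<in>T0. padic_abs p q) * \<bar>of_rat q\<bar> = 1"
    using rational_product_formula[OF \<open>q \<noteq> 0\<close>] by blast
  obtain T1 where T1: "finite T1" "\<And>p v. prime p \<Longrightarrow> p \<notin> T1 \<Longrightarrow> v \<in> padic_places K p \<Longrightarrow> v x = 1"
    using almost_all_units[OF x] by blast
  \<comment> \<open>The primes of \<open>T0\<close> carry the norm, those of \<open>T1\<close> all
    finite places at which \<open>x\<close> is not a unit.\<close>
  define T where "T = T0 \<union> {p \<in> T1. prime p}"
  have T: "finite T" "\<And>p. p \<in> T \<Longrightarrow> prime p" using T0 T1 by (auto simp: T_def)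
  define W' where "W' = (\<Union>p\<in>T. padic_places K p)"
  have W': "finite W'" "W' \<subseteq> finite_places K"
    using T padic_places_product(1)[OF tg] by (auto simp: W'_def finite_places_Union[OF K])
  let ?S = "{v \<in> finite_places K. v x \<noteq> 1}"
  have "?S \<subseteq> W'"
    using T1(2) unfolding finite_places_Union[OF K] by (auto simp: W'_def T_def)
  then have "(\<Prod>v\<in>W'. v x ^ local_degree K v) = (\<Prod>v\<in>?S. v x ^ local_degree K v)"
    using W' by (intro prod.mono_neutral_right) auto
  moreover have "(\<Prod>v\<in>W. v x ^ local_degree K v) = (\<Prod>v\<in>?S. v x ^ local_degree K v)"
    using W by (intro prod.mono_neutral_right) auto
  ultimately have "(\<Prod>v\<in>W. v x ^ local_degree K v) = (\<Prod>v\<in>W'. v x ^ local_degree K v)" by metis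
  also have "\<dots> = (\<Prod>p\<in>T. \<Prod>v\<in>padic_places K p. v x ^ local_degree K v)"
    unfolding W'_def
  proof (rule prod.UNION_disjoint[OF T(1)])
    show "\<forall>p\<in>T. finite (padic_places K p)" using padic_places_product(1)[OF tg T(2)] by blast
    show "\<forall>p\<in>T. \<forall>l\<in>T. p \<noteq> l \<longrightarrow> padic_places K p \<inter> padic_places K l = {}"
      using padic_places_disjoint T(2) by blast
  qed
  also have "\<dots> = (\<Prod>p\<in>T. padic_abs p q)"
    unfolding P by (rule prod.cong[OF refl], rule padic_places_product(3)[OF tg T(2) q])
  also have "\<dots> = (\<Prod>p\<in>T0. padic_abs p q)"
  proof (rule prod.mono_neutral_right[OF T(1)])
    show "T0 \<subseteq> T" by (simp add: T_def)
    show "\<forall>p\<in>T - T0. padic_abs p q = 1" using T(2) T0(3) by blast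
  qed
  finally show ?thesis unfolding inf using T0(4) by metis
qed

end

section \<open>The maximum modulus principle\<close>

text \<open>\<open>U\<close> abstracts the roots of unity of 2-power order in \<open>Omega\<close>:
  elements of absolute value 1, closed under negation and containing square roots. The last
  assumption is what makes dividing by 2 affordable at every place.\<close>

locale modulus_field = valued_field Om V + subfield_abs K v
  for Om (structure) and V and K :: "complex set" and v +
  fixes \<phi> :: "complex \<Rightarrow> 'a" and U :: "'a set"
  assumes phi_closed [simp]: "x \<in> K \<Longrightarrow> \<phi> x \<in> carrier Om"
    and phi_add: "x \<in> K \<Longrightarrow> y \<in> K \<Longrightarrow> \<phi> (x + y) = \<phi> x \<oplus> \<phi> y"
    and phi_mult: "x \<in> K \<Longrightarrow> y \<in> K \<Longrightarrow> \<phi> (x * y) = \<phi> x \<otimes> \<phi> y"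
    and phi_one: "\<phi> 1 = \<one>"
    and V_phi [simp]: "x \<in> K \<Longrightarrow> V (\<phi> x) = v x"
    and U_closed [simp]: "u \<in> U \<Longrightarrow> u \<in> carrier Om"
    and one_U: "\<one> \<in> U"
    and V_U [simp]: "u \<in> U \<Longrightarrow> V u = 1"
    and sqrt_U: "u \<in> U \<Longrightarrow> \<exists>t\<in>U. t \<otimes> t = u"
    and neg_U: "u \<in> U \<Longrightarrow> \<ominus> u \<in> U"
    and two_ge: "1 / 2 \<le> v 2"
begin

section \<open>Evaluation of polynomials at elements of the large field\<close>

lemma phi_zero: "\<phi> 0 = \<zero>"
  using v_eq_0_iff[OF phi_closed[OF zero_mem]] V_phi[OF zero_mem] abs_zero by metis

definition ev :: "complex poly \<Rightarrow> 'a \<Rightarrow> 'a" where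
  "ev T z = eval (map \<phi> (rev (coeffs T))) z"

abbreviation polyK :: "complex poly \<Rightarrow> bool" where
  "polyK T \<equiv> \<forall>i. Polynomial.coeff T i \<in> K"

lemma polyK_pCons: "polyK (pCons c T) \<longleftrightarrow> c \<in> K \<and> polyK T"
  by (metis coeff_pCons_0 coeff_pCons_Suc not0_implies_Suc)

lemma set_coeffs_K: "polyK T \<Longrightarrow> set (coeffs T) \<subseteq> K"
  by (auto simp: coeffs_def split: if_splits)

lemma map_coeffs_closed: "polyK T \<Longrightarrow> set (map \<phi> (rev (coeffs T))) \<subseteq> carrier Om"
  using set_coeffs_K[of T] by auto

lemma ev_closed [simp]: "polyK T \<Longrightarrow> z \<in> carrier Om \<Longrightarrow> ev T z \<in> carrier Om"
  unfolding ev_def by (rule eval_in_carrier[OF map_coeffs_closed])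

lemma ev_zero [simp]: "ev 0 z = \<zero>"
  by (simp add: ev_def)

lemma ev_pCons:
  assumes "c \<in> K" "polyK T" "z \<in> carrier Om"
  shows "ev (pCons c T) z = \<phi> c \<oplus> z \<otimes> ev T z"
proof (cases "T = 0 \<and> c = 0")
  case True
  then show ?thesis using assms by (simp add: phi_zero)
next
  case False
  then have "coeffs (pCons c T) = c # coeffs T" by (auto simp: cCons_def)
  then have "ev (pCons c T) z = eval (map \<phi> (rev (coeffs T)) @ [\<phi> c]) z" by (simp add: ev_def)
  also have "\<dots> = ev T z \<otimes> z \<oplus> \<phi> c"
    unfolding ev_def by (rule eval_append_aux[OF map_coeffs_closed[OF assms(2)] phi_closed[OF assms(1)] assms(3)])
  finally show ?thesis using assms by (simp add: m_comm a_comm)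
qed

lemma polyK_mult: "polyK S \<Longrightarrow> polyK T \<Longrightarrow> polyK (S * T)"
  by (auto simp: coeff_mult intro!: sum_mem mult_mem)

lemma polyK_power: "polyK T \<Longrightarrow> polyK (T ^ k)"
proof (induction k)
  case (Suc k)
  then show ?case using polyK_mult[of T "T ^ k"] by simp
qed (simp add: coeff_1)

lemma ev_add:
  assumes "polyK S" "polyK T" "z \<in> carrier Om" shows "ev (S + T) z = ev S z \<oplus> ev T z"
  using assms(1,2)
proof (induction S arbitrary: T)
  case 0
  then show ?case using assms(3) by simp
next
  case (pCons c S)
  obtain d T' where T: "T = pCons d T'" by (cases T) auto
  have K: "c \<in> K" "polyK S" "d \<in> K" "polyK T'" using pCons.prems T by (auto simp: polyK_pCons)
  have eq: "(a \<oplus> b) \<oplus> z \<otimes> (x \<oplus> y) = (a \<oplus> z \<otimes> x) \<oplus> (b \<oplus> z \<otimes> y)"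
    if "a \<in> carrier Om" "b \<in> carrier Om" "x \<in> carrier Om" "y \<in> carrier Om" for a b x y
    using that assms(3) by algebra
  show ?case
    unfolding T add_pCons
    using K pCons.IH[OF K(2,4)] assms(3) eq[of "\<phi> c" "\<phi> d" "ev S z" "ev T' z"]
    by (simp add: ev_pCons phi_add)
qed

lemma ev_smult:
  assumes "c \<in> K" "polyK T" "z \<in> carrier Om" shows "ev (smult c T) z = \<phi> c \<otimes> ev T z"
  using assms(2)
proof (induction T)
  case 0
  then show ?case using assms by simp
next
  case (pCons d T)
  have K: "d \<in> K" "polyK T" using pCons.prems by (auto simp: polyK_pCons)
  have eq: "a \<otimes> b \<oplus> z \<otimes> (a \<otimes> x) = a \<otimes> (b \<oplus> z \<otimes> x)"
    if "a \<in> carrier Om" "b \<in> carrier Om" "x \<in> carrier Om" for a b x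
    using that assms(3) by algebra
  show ?case
    unfolding smult_pCons
    using K pCons.IH[OF K(2)] assms eq[of "\<phi> c" "\<phi> d" "ev T z"] by (simp add: ev_pCons phi_mult)
qed

lemma ev_mult:
  assumes "polyK S" "polyK T" "z \<in> carrier Om" shows "ev (S * T) z = ev S z \<otimes> ev T z"
  using assms(1)
proof (induction S)
  case 0
  then show ?case using assms by simp
next
  case (pCons c S)
  have K: "c \<in> K" "polyK S" using pCons.prems by (auto simp: polyK_pCons)
  have ST: "polyK (S * T)" "polyK (pCons 0 (S * T))" "polyK (smult c T)"
    using polyK_mult[OF K(2) assms(2)] K(1) assms(2) by (auto simp: polyK_pCons)
  have eq: "a \<otimes> t \<oplus> z \<otimes> (x \<otimes> t) = (a \<oplus> z \<otimes> x) \<otimes> t"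
    if "a \<in> carrier Om" "t \<in> carrier Om" "x \<in> carrier Om" for a t x
    using that assms(3) by algebra
  have "ev (pCons c S * T) z = ev (smult c T) z \<oplus> ev (pCons 0 (S * T)) z"
    unfolding mult_pCons_left by (rule ev_add[OF ST(3,2) assms(3)])
  also have "\<dots> = \<phi> c \<otimes> ev T z \<oplus> z \<otimes> (ev S z \<otimes> ev T z)"
    using ev_smult[OF K(1) assms(2,3)] ev_pCons[OF zero_mem ST(1) assms(3)] pCons.IH[OF K(2)] ST(1) K assms
    by (simp add: phi_zero)
  also have "\<dots> = ev (pCons c S) z \<otimes> ev T z"
    using eq[of "\<phi> c" "ev T z" "ev S z"] K assms by (simp add: ev_pCons)
  finally show ?case .
qed

lemma ev_power:
  assumes "polyK T" "z \<in> carrier Om" shows "ev (T ^ k) z = ev T z [^] k"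
proof (induction k)
  case 0
  have "ev (pCons 1 0) z = \<one>" using ev_pCons[of 1 0 z] assms(2) by (simp add: phi_one)
  then show ?case by (simp add: one_pCons)
next
  case (Suc k)
  then show ?case using ev_mult[OF polyK_power[OF assms(1), of k] assms] by (simp add: mult.commute)
qed

text \<open>The supremum in \<open>Omega_nu\<close> is a real one; it bounds the values only once
  the set of values is known to be bounded above.\<close>

lemma ev_bounded:
  assumes "polyK T"
  shows "\<exists>B. \<forall>z\<in>carrier Om. V z = 1 \<longrightarrow> V (ev T z) \<le> B"
  using assms
proof (induction T)
  case 0
  then show ?case by (auto intro!: exI[of _ 0])
next
  case (pCons c T)
  have K: "c \<in> K" "polyK T" using pCons.prems by (auto simp: polyK_pCons)
  obtain B where B: "\<forall>z\<in>carrier Om. V z = 1 \<longrightarrow> V (ev T z) \<le> B" using pCons.IH K by blast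
  have "V (ev (pCons c T) z) \<le> v c + B" if z: "z \<in> carrier Om" "V z = 1" for z
  proof -
    have "V (ev (pCons c T) z) \<le> V (\<phi> c) + V (z \<otimes> ev T z)"
      unfolding ev_pCons[OF K z(1)] using K z by (intro v_add) auto
    also have "\<dots> = v c + V (ev T z)" using K z by simp
    finally show ?thesis using B z by fastforce
  qed
  then show ?case by blast
qed

text \<open>Prepending a coefficient exchanges the even and the odd part, up to a shift of the
  former odd part.\<close>

lemma ev_even_odd:
  assumes "polyK T"
  shows "\<exists>A B. polyK A \<and> polyK B \<and>
    (\<forall>i. Polynomial.coeff T (2 * i) = Polynomial.coeff A i \<and> Polynomial.coeff T (2 * i + 1) = Polynomial.coeff B i) \<and>
    (\<forall>z\<in>carrier Om. ev T z = ev A (z \<otimes> z) \<oplus> z \<otimes> ev B (z \<otimes> z))"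
  using assms
proof (induction T)
  case 0
  show ?case by (intro exI[of _ 0]) auto
next
  case (pCons c T)
  have K: "c \<in> K" "polyK T" using pCons.prems by (auto simp: polyK_pCons)
  obtain A B where AB: "polyK A" "polyK B"
    and co: "\<And>i. Polynomial.coeff T (2 * i) = Polynomial.coeff A i" "\<And>i. Polynomial.coeff T (2 * i + 1) = Polynomial.coeff B i"
    and evT: "\<And>z. z \<in> carrier Om \<Longrightarrow> ev T z = ev A (z \<otimes> z) \<oplus> z \<otimes> ev B (z \<otimes> z)"
    using pCons.IH[OF K(2)] by blast
  have "polyK (pCons c B)" using K AB by (simp add: polyK_pCons)
  moreover have "Polynomial.coeff (pCons c T) (2 * i) = Polynomial.coeff (pCons c B) i" for i
  proof (cases i)
    case (Suc j)
    then have "2 * i = Suc (2 * j + 1)" by simp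
    then show ?thesis using co(2)[of j] Suc by (simp only: coeff_pCons_Suc)
  qed simp
  moreover have "Polynomial.coeff (pCons c T) (2 * i + 1) = Polynomial.coeff A i" for i
    using co(1)[of i] by simp
  moreover have "ev (pCons c T) z = ev (pCons c B) (z \<otimes> z) \<oplus> z \<otimes> ev A (z \<otimes> z)" if z: "z \<in> carrier Om" for z
  proof -
    have eq: "c \<oplus> z \<otimes> (a \<oplus> z \<otimes> b) = (c \<oplus> (z \<otimes> z) \<otimes> b) \<oplus> z \<otimes> a"
      if "a \<in> carrier Om" "b \<in> carrier Om" "c \<in> carrier Om" for a b c
      using that z by algebra
    show ?thesis
      using eq[of "ev A (z \<otimes> z)" "ev B (z \<otimes> z)" "\<phi> c"] K AB z by (simp add: ev_pCons evT)
  qed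
  ultimately show ?case using AB(1) by blast
qed

section \<open>Coefficients bounded by values at roots of unity\<close>

lemma V_two: "1 / 2 \<le> V (\<one> \<oplus> \<one>)"
  using two_ge phi_add[of 1 1] V_phi[of 2] add_mem[of 1 1] by (simp add: phi_one)

text \<open>With \<open>t\<close> a square root of \<open>u\<close>, the sum and difference of T(t)
  and T(-t) are 2A(u) and 2tB(u). Dividing by 2 costs a factor 2 and the sum of two values another,
  so each halving of the length costs 4.\<close>

lemma coeff_bound:
  assumes "polyK T" "\<And>i. 2 ^ j \<le> i \<Longrightarrow> Polynomial.coeff T i = 0" "\<And>u. u \<in> U \<Longrightarrow> V (ev T u) \<le> S"
  shows "v (Polynomial.coeff T i) \<le> 4 ^ j * S"
  using assms
proof (induction j arbitrary: T S i)
  case 0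
  have S: "0 \<le> S" using 0(1) 0(3)[OF one_U] v_nonneg[of "ev T \<one>"] one_closed ev_closed order_trans by blast
  obtain c T' where T: "T = pCons c T'" by (cases T) auto
  have "T' = 0"
  proof (rule poly_eqI)
    fix n show "Polynomial.coeff T' n = Polynomial.coeff 0 n" using 0(2)[of "Suc n"] by (simp add: T)
  qed
  have c: "c \<in> K" using 0(1) by (simp add: T polyK_pCons)
  have "ev T \<one> = \<phi> c" using ev_pCons[OF c, of 0 "\<one>"] c by (simp add: T \<open>T' = 0\<close>)
  then have "v c \<le> S" using 0(3)[OF one_U] c by simp
  then show ?case using S by (cases i) (auto simp: T \<open>T' = 0\<close>)
next
  case (Suc j)
  obtain A B where AB: "polyK A" "polyK B"
    and co: "\<And>i. Polynomial.coeff T (2 * i) = Polynomial.coeff A i" "\<And>i. Polynomial.coeff T (2 * i + 1) = Polynomial.coeff B i"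
    and evT: "\<And>z. z \<in> carrier Om \<Longrightarrow> ev T z = ev A (z \<otimes> z) \<oplus> z \<otimes> ev B (z \<otimes> z)"
    using ev_even_odd[OF Suc.prems(1)] by blast
  have half: "V (ev A u) \<le> 4 * S \<and> V (ev B u) \<le> 4 * S" if u: "u \<in> U" for u
  proof -
    obtain t where t: "t \<in> U" "t \<otimes> t = u" using sqrt_U[OF u] by blast
    have nt: "\<ominus> t \<in> U" "(\<ominus> t) \<otimes> (\<ominus> t) = u" using neg_U t by (auto simp: l_minus r_minus)
    define p where "p = ev A u"
    define q where "q = ev B u"
    have pq: "p \<in> carrier Om" "q \<in> carrier Om" using AB u by (auto simp: p_def q_def)
    have e: "ev T t = p \<oplus> t \<otimes> q" "ev T (\<ominus> t) = p \<oplus> (\<ominus> t) \<otimes> q"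
      using evT[of t] evT[of "\<ominus> t"] t nt by (simp_all add: p_def q_def)
    have tc: "t \<in> carrier Om" using t by simp
    have sum1: "(\<one> \<oplus> \<one>) \<otimes> p = ev T t \<oplus> ev T (\<ominus> t)" unfolding e using pq tc by algebra
    have sum2: "(\<one> \<oplus> \<one>) \<otimes> (t \<otimes> q) = ev T t \<ominus> ev T (\<ominus> t)" unfolding e using pq tc by algebra
    have cl: "ev T t \<in> carrier Om" "ev T (\<ominus> t) \<in> carrier Om" using Suc.prems(1) tc by auto
    have "V (\<one> \<oplus> \<one>) * V p \<le> 2 * S"
      using v_add[OF cl] Suc.prems(3)[OF t(1)] Suc.prems(3)[OF nt(1)] pq
      by (simp flip: sum1)
    moreover have "V (\<one> \<oplus> \<one>) * V q \<le> 2 * S"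
      using v_diff[OF cl] Suc.prems(3)[OF t(1)] Suc.prems(3)[OF nt(1)] pq t(1)
      by (simp flip: sum2)
    moreover have "1 / 2 * V p \<le> V (\<one> \<oplus> \<one>) * V p" "1 / 2 * V q \<le> V (\<one> \<oplus> \<one>) * V q"
      using mult_right_mono[OF V_two v_nonneg[OF pq(1)]] mult_right_mono[OF V_two v_nonneg[OF pq(2)]] by auto
    ultimately show ?thesis by (simp add: p_def q_def)
  qed
  have "v (Polynomial.coeff A i) \<le> 4 ^ j * (4 * S)" for i
  proof (rule Suc.IH[OF AB(1)])
    show "Polynomial.coeff A i = 0" if "2 ^ j \<le> i" for i using Suc.prems(2)[of "2 * i"] co(1)[of i] that by simp
  qed (use half in blast)
  moreover have "v (Polynomial.coeff B i) \<le> 4 ^ j * (4 * S)" for i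
  proof (rule Suc.IH[OF AB(2)])
    show "Polynomial.coeff B i = 0" if "2 ^ j \<le> i" for i using Suc.prems(2)[of "2 * i + 1"] co(2)[of i] that by simp
  qed (use half in blast)
  moreover have "i = 2 * (i div 2) \<or> i = 2 * (i div 2) + 1" by linarith
  ultimately have "v (Polynomial.coeff T i) \<le> 4 ^ j * (4 * S)" using co by metis
  then show ?case by simp
qed

lemma exists_power_of_two: "\<exists>j. n < 2 ^ j \<and> (2::nat) ^ j \<le> 2 * (n + 1)"
proof (induction n)
  case 0
  then show ?case by (auto intro!: exI[of _ 0])
next
  case (Suc n)
  then obtain j where j: "n < 2 ^ j" "(2::nat) ^ j \<le> 2 * (n + 1)" by blast
  show ?case
  proof (cases "Suc n < 2 ^ j")
    case True
    then show ?thesis using j by (intro exI[of _ j]) auto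
  next
    case False
    then have "2 ^ j = Suc n" using j by simp
    then show ?thesis by (intro exI[of _ "Suc j"]) auto
  qed
qed

text \<open>
  The coefficient bound loses a factor polynomial in the degree. It is removed by applying
  the bound to the powers of \<open>T\<close>.
\<close>

lemma maximum_modulus:
  assumes T: "polyK T" "Polynomial.degree T \<le> d" and S: "\<And>u. u \<in> U \<Longrightarrow> V (ev T u) \<le> S"
    and x: "x \<in> K"
  shows "v (poly T x) \<le> S * max 1 (v x) ^ d"
proof (rule le_of_power_growth[where c = "4 * (real d + 1) ^ 3"])
  let ?M = "max 1 (v x)"
  have S0: "0 \<le> S" using T(1) S[OF one_U] v_nonneg[of "ev T \<one>"] one_closed ev_closed order_trans by blast
  show "0 \<le> S * ?M ^ d" using S0 by simp
  fix k :: nat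
  \<comment> \<open>Keeping \<open>2 ^ j\<close> within a constant factor of the degree makes the
    loss \<open>4 ^ j\<close> quadratic in it.\<close>
  obtain j where j: "d * k < 2 ^ j" "(2::nat) ^ j \<le> 2 * (d * k + 1)" using exists_power_of_two by blast
  have deg: "Polynomial.degree (T ^ k) \<le> d * k"
    using order_trans[OF degree_power_le mult_le_mono1[OF T(2)]] by simp
  have co: "v (Polynomial.coeff (T ^ k) i) \<le> 4 ^ j * S ^ k" for i
  proof (rule coeff_bound[OF polyK_power[OF T(1)]])
    show "Polynomial.coeff (T ^ k) i = 0" if "2 ^ j \<le> i" for i
      using deg j(1) that by (intro coeff_eq_0) linarith
    show "V (ev (T ^ k) u) \<le> S ^ k" if "u \<in> U" for u
      using S[OF that] T(1) that v_nonneg[of "ev T u"] by (simp add: ev_power power_mono)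
  qed
  have co': "v (Polynomial.coeff (T ^ k) i) \<le> (2 * (real (d * k) + 1)) ^ 2 * S ^ k" for i
  proof -
    have "(4::real) ^ j = (real (2 ^ j)) ^ 2" by (simp add: power2_eq_square flip: power_mult_distrib)
    also have "\<dots> \<le> (real (2 * (d * k + 1))) ^ 2" by (rule power_mono[OF of_nat_mono[OF j(2)]]) simp
    also have "real (2 * (d * k + 1)) = 2 * (real (d * k) + 1)" by simp
    finally have "4 ^ j * S ^ k \<le> (2 * (real (d * k) + 1)) ^ 2 * S ^ k"
      using S0 by (intro mult_right_mono) auto
    then show ?thesis using co[of i] by linarith
  qed
  have "v (poly T x) ^ k = v (poly (T ^ k) x)"
    using T(1) x by (simp add: poly_power flip: abs_power)
  also have "poly (T ^ k) x = (\<Sum>i\<le>d * k. Polynomial.coeff (T ^ k) i * x ^ i)"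
    unfolding poly_altdef using deg by (intro sum.mono_neutral_left) (auto simp: coeff_eq_0)
  also have "v \<dots> \<le> (\<Sum>i\<le>d * k. v (Polynomial.coeff (T ^ k) i * x ^ i))"
    using polyK_power[OF T(1)] x by (intro abs_sum mult_mem) auto
  also have "\<dots> \<le> (\<Sum>i\<le>d * k. (2 * (real (d * k) + 1)) ^ 2 * S ^ k * ?M ^ (d * k))"
  proof (rule sum_mono)
    fix i assume i: "i \<in> {..d * k}"
    have "v x ^ i \<le> ?M ^ i" using x by (intro power_mono) auto
    also have "\<dots> \<le> ?M ^ (d * k)" using i by (intro power_increasing) auto
    finally have "v (Polynomial.coeff (T ^ k) i) * v x ^ i \<le> (2 * (real (d * k) + 1)) ^ 2 * S ^ k * ?M ^ (d * k)"
      using co'[of i] S0 x by (intro mult_mono) auto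
    then show "v (Polynomial.coeff (T ^ k) i * x ^ i) \<le> (2 * (real (d * k) + 1)) ^ 2 * S ^ k * ?M ^ (d * k)"
      using polyK_power[OF T(1), of k] x by simp
  qed
  \<comment> \<open>The quadratic loss per coefficient times the \<open>d * k + 1\<close> terms
    gives the cube.\<close>
  also have "\<dots> = 4 * (real (d * k) + 1) ^ 3 * (S ^ k * ?M ^ (d * k))"
    by (simp add: power2_eq_square power3_eq_cube algebra_simps)
  also have "\<dots> \<le> 4 * ((real d + 1) ^ 3 * (real k + 1) ^ 3) * (S ^ k * ?M ^ (d * k))"
  proof -
    have "real (d * k) + 1 \<le> (real d + 1) * (real k + 1)" by (simp add: algebra_simps)
    then have "(real (d * k) + 1) ^ 3 \<le> ((real d + 1) * (real k + 1)) ^ 3" by (intro power_mono) auto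
    then show ?thesis using S0 by (intro mult_right_mono mult_left_mono) (auto simp: power_mult_distrib)
  qed
  also have "\<dots> = 4 * (real d + 1) ^ 3 * (real k + 1) ^ 3 * (S * ?M ^ d) ^ k"
    by (simp add: power_mult_distrib power_mult)
  finally show "v (poly T x) ^ k \<le> 4 * (real d + 1) ^ 3 * (real k + 1) ^ 3 * (S * ?M ^ d) ^ k" .
qed

end

lemma (in algebraically_closed) exists_square_root:
  assumes "x \<in> carrier L" shows "\<exists>y\<in>carrier L. y \<otimes> y = x"
proof -
  define p where "p = [\<one>, \<zero>, \<ominus> x]"
  have p: "p \<in> carrier (poly_ring L)"
    using assms unfolding p_def univ_poly_carrier[symmetric] polynomial_def by auto
  have "size (roots p) = 2" using roots_over_carrier[OF p] unfolding splitted_def by (simp add: p_def)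
  then obtain y where "y \<in># roots p" by (metis multiset_nonemptyE size_empty zero_neq_numeral)
  then have "is_root p y" using roots_mem_iff_is_root[OF p] by simp
  then have y: "y \<in> carrier L" "eval p y = \<zero>" unfolding is_root_def by auto
  have "y \<otimes> y \<ominus> x = \<zero>"
    using y assms by (simp add: p_def a_minus_def numeral_2_eq_2)
  then have "y \<otimes> y = x" using y assms by simp
  then show ?thesis using y by blast
qed

section \<open>The field \<open>\<Omega>\<^sub>v\<close> and \<open>\<nu>\<^sub>v\<close>\<close>

text \<open>The 2-adic value of 2 is exactly 1/2, its other p-adic values are 1, and its real value
  is 2.\<close>

lemma place_of_places:
  assumes "number_field K" "v \<in> places K"
  obtains a where "place_over K v a" "1 / 2 \<le> v 2"
proof -
  consider p where "prime p" "v \<in> padic_places K p" | "v \<in> infinite_places K"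
    using assms by (auto simp: places_def finite_places_Union)
  then show ?thesis
  proof cases
    case 1
    then have pl: "place_over K v (padic_abs p)" by (simp add: padic_places_def)
    interpret place_over K v "padic_abs p" by (rule pl)
    have "padic_abs p (1 / of_nat 2) \<le> 2"
      using padic_abs_inverse_prime[of 2] padic_abs_other_prime[OF 1(1), of 2] two_is_prime_nat
      by (cases "p = 2") auto
    moreover have "v (of_rat (1 / of_nat 2)) = 1 / v 2" using of_nat_mem[of 2] by (simp add: of_rat_divide)
    moreover have "0 < v 2" using abs_pos[of 2] of_nat_mem[of 2] by simp
    ultimately have "1 / v 2 \<le> 2" "0 < v 2" using abs_of_rat[of "1 / of_nat 2"] by linarith+
    then have "1 / 2 \<le> v 2" by (simp add: field_simps)
    then show ?thesis using that pl by blast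
  next
    case 2
    then have pl: "place_over K v (\<lambda>q. \<bar>of_rat q\<bar>)" using infinite_places_eq[OF assms(1)] by blast
    then have "v (of_rat 2) = \<bar>of_rat 2\<bar>" by (rule place_over.abs_of_rat)
    then show ?thesis using that pl by simp
  qed
qed

text \<open>An extension of the absolute value to the algebraic closure exists, so the choice in
  \<open>local_closure_abs\<close> has the required properties; the abstract setting then applies
  with 2-power roots of unity taken in the closure and mapped into \<open>Omega\<close>.\<close>

lemma omega_modulus_field:
  assumes K: "number_field K" and v: "v \<in> places K"
  obtains U where "modulus_field (Omega K v) (completion_abs (local_closure_abs K v)) K v (Omega_embed K v) U"
proof -
  obtain a where pl: "place_over K v a" and two: "1 / 2 \<le> v 2" using place_of_places[OF K v] .
  interpret P: place_over K v a by (rule pl)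
  have sub: "subfield K (ring_of_type_algebra :: complex ring)" using K by (simp add: number_field_def)
  interpret V: valued_field "field_ring K" v
    by (rule valued_field_field_ring[OF sub absolute_value_of_place[OF pl]])
  interpret Co: valued_field "local_field K v" "completion_abs v"
    unfolding local_field_def by (rule V.valued_field_Co)
  let ?i = "Co.indexed_const :: _ \<Rightarrow> ((nat \<Rightarrow> complex) set list \<times> nat) multiset \<Rightarrow> (nat \<Rightarrow> complex) set"
  let ?K' = "?i ` carrier (local_field K v)"
  interpret L: algebraic_closure "local_closure K v" ?K'
    unfolding local_closure_def by (rule Co.alg_closureE(1))
  have hom: "?i \<in> ring_hom (local_field K v) (local_closure K v)"
    unfolding local_closure_def by (rule Co.alg_closureE(2))
  \<comment> \<open>The absolute value of the local field, transported along the embedding so that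
    it lives on a subfield of the closure.\<close>
  define u where "u y = completion_abs v (the_inv_into (carrier (local_field K v)) ?i y)" for y
  have u: "u (?i x) = completion_abs v x" if "x \<in> carrier (local_field K v)" for x
    using the_inv_into_f_f[of ?i, OF Co.indexed_const_inj_on that] by (simp add: u_def)
  have i0: "?i x = \<zero>\<^bsub>local_closure K v\<^esub> \<longleftrightarrow> x = \<zero>\<^bsub>local_field K v\<^esub>" if "x \<in> carrier (local_field K v)" for x
    using ring_hom_zero[OF hom Co.ring_axioms L.ring_axioms] inj_onD[of ?i, OF Co.indexed_const_inj_on _ that Co.zero_closed]
    by metis
  have "absolute_value (local_closure K v\<lparr>carrier := ?K'\<rparr>) u"
    unfolding absolute_value_def
  proof (intro conjI ballI)
    fix y assume "y \<in> carrier (local_closure K v\<lparr>carrier := ?K'\<rparr>)"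
    then obtain x where x: "x \<in> carrier (local_field K v)" "y = ?i x" by auto
    show "0 \<le> u y" using x u by simp
    show "(u y = 0) = (y = \<zero>\<^bsub>local_closure K v\<lparr>carrier := ?K'\<rparr>\<^esub>)" using x u i0 by simp
    fix z assume "z \<in> carrier (local_closure K v\<lparr>carrier := ?K'\<rparr>)"
    then obtain t where t: "t \<in> carrier (local_field K v)" "z = ?i t" by auto
    have "y \<otimes>\<^bsub>local_closure K v\<^esub> z = ?i (x \<otimes>\<^bsub>local_field K v\<^esub> t)"
      using ring_hom_mult[OF hom x(1) t(1)] x t by simp
    then show "u (y \<otimes>\<^bsub>local_closure K v\<lparr>carrier := ?K'\<rparr>\<^esub> z) = u y * u z" using x t u by simp
    have "y \<oplus>\<^bsub>local_closure K v\<^esub> z = ?i (x \<oplus>\<^bsub>local_field K v\<^esub> t)"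
      using ring_hom_add[OF hom x(1) t(1)] x t by simp
    then show "u (y \<oplus>\<^bsub>local_closure K v\<lparr>carrier := ?K'\<rparr>\<^esub> z) \<le> u y + u z"
      using x t u Co.v_add by simp
  qed
  from L.exists_extension_algebraic[OF L.subfield_axioms this L.algebraic_extension]
  obtain w where w: "absolute_value (local_closure K v) w" "\<And>c. c \<in> ?K' \<Longrightarrow> w c = u c" by blast
  let ?w = "local_closure_abs K v"
  have "absolute_value (local_closure K v) ?w \<and> (\<forall>x\<in>carrier (local_field K v). ?w (?i x) = completion_abs v x)"
    unfolding local_closure_abs_def by (rule someI[of _ w]) (use w u in auto)
  then have wL: "absolute_value (local_closure K v) ?w"
    and wi: "\<And>x. x \<in> carrier (local_field K v) \<Longrightarrow> ?w (?i x) = completion_abs v x" by auto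
  interpret W: valued_field "local_closure K v" ?w
    by (intro valued_field.intro valued_field_axioms.intro L.field_axioms wL)
  let ?e = "completion_embed (local_closure K v) ?w"
  interpret Om: valued_field "Omega K v" "completion_abs ?w"
    unfolding Omega_def by (rule W.valued_field_Co)
  have ehom: "?e \<in> ring_hom (local_closure K v) (Omega K v)"
    unfolding Omega_def by (rule W.completion_embed_hom)
  have khom: "completion_embed (field_ring K) v \<in> ring_hom (field_ring K) (local_field K v)"
    unfolding local_field_def by (rule V.completion_embed_hom)
  have phi: "Omega_embed K v \<in> ring_hom (field_ring K) (Omega K v)"
  proof -
    have "Omega_embed K v = ?e \<circ> (?i \<circ> completion_embed (field_ring K) v)"
      by (simp add: Omega_embed_def fun_eq_iff)
    then show ?thesis using ring_hom_trans[OF ring_hom_trans[OF khom hom] ehom] by simp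
  qed
  define S where "S = {z \<in> carrier (local_closure K v). \<exists>j. z [^]\<^bsub>local_closure K v\<^esub> ((2::nat) ^ j) = \<one>\<^bsub>local_closure K v\<^esub>}"
  show ?thesis
  proof (rule that[of "?e ` S"], intro modulus_field.intro modulus_field_axioms.intro)
    show "valued_field (Omega K v) (completion_abs ?w)" by (rule Om.valued_field_axioms)
    show "subfield_abs K v" by (rule P.subfield_abs_axioms)
    show "Omega_embed K v x \<in> carrier (Omega K v)" if "x \<in> K" for x
      using ring_hom_closed[OF phi] that by simp
    show "Omega_embed K v (x + y) = Omega_embed K v x \<oplus>\<^bsub>Omega K v\<^esub> Omega_embed K v y" if "x \<in> K" "y \<in> K" for x y
      using ring_hom_add[OF phi, of x y] that by simp
    show "Omega_embed K v (x * y) = Omega_embed K v x \<otimes>\<^bsub>Omega K v\<^esub> Omega_embed K v y" if "x \<in> K" "y \<in> K" for x y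
      using ring_hom_mult[OF phi, of x y] that by simp
    show "Omega_embed K v 1 = \<one>\<^bsub>Omega K v\<^esub>" using ring_hom_one[OF phi] by simp
    show "completion_abs ?w (Omega_embed K v x) = v x" if "x \<in> K" for x
    proof -
      have 1: "completion_embed (field_ring K) v x \<in> carrier (local_field K v)"
        using ring_hom_closed[OF khom, of x] that by simp
      show ?thesis
        unfolding Omega_embed_def
        using W.completion_abs_embed[OF ring_hom_closed[OF hom 1]] wi[OF 1] V.completion_abs_embed[of x] that by simp
    qed
    show "u \<in> carrier (Omega K v)" if "u \<in> ?e ` S" for u
      using that ring_hom_closed[OF ehom] by (auto simp: S_def)
    show "\<one>\<^bsub>Omega K v\<^esub> \<in> ?e ` S"
    proof -
      have "\<one>\<^bsub>local_closure K v\<^esub> \<in> S" by (simp add: S_def)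
      then show ?thesis using ring_hom_one[OF ehom] by (metis imageI)
    qed
    show "completion_abs ?w u = 1" if u: "u \<in> ?e ` S" for u
    proof -
      obtain z j where z: "z \<in> carrier (local_closure K v)" "u = ?e z"
        "z [^]\<^bsub>local_closure K v\<^esub> ((2::nat) ^ j) = \<one>\<^bsub>local_closure K v\<^esub>" using u by (auto simp: S_def)
      have "?w z ^ (2 ^ j) = 1" using W.v_nat_pow[OF z(1), of "2 ^ j"] z(3) by simp
      then have "?w z = 1" using power_eq_imp_eq_base[of "?w z" "2 ^ j" 1] z(1) by simp
      then show ?thesis using W.completion_abs_embed[OF z(1)] z(2) by simp
    qed
    show "\<exists>t\<in>?e ` S. t \<otimes>\<^bsub>Omega K v\<^esub> t = u" if u: "u \<in> ?e ` S" for u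
    proof -
      obtain z j where z: "z \<in> carrier (local_closure K v)" "u = ?e z"
        "z [^]\<^bsub>local_closure K v\<^esub> ((2::nat) ^ j) = \<one>\<^bsub>local_closure K v\<^esub>" using u by (auto simp: S_def)
      obtain y where y: "y \<in> carrier (local_closure K v)" "y \<otimes>\<^bsub>local_closure K v\<^esub> y = z"
        using L.exists_square_root[OF z(1)] by blast
      have "y [^]\<^bsub>local_closure K v\<^esub> ((2::nat) ^ Suc j) = (y [^]\<^bsub>local_closure K v\<^esub> (2::nat)) [^]\<^bsub>local_closure K v\<^esub> ((2::nat) ^ j)"
        using y(1) by (simp add: L.nat_pow_pow)
      also have "\<dots> = \<one>\<^bsub>local_closure K v\<^esub>" using y z(3) by (simp add: numeral_2_eq_2)
      finally have "y \<in> S" using y(1) unfolding S_def by blast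
      then show ?thesis using ring_hom_mult[OF ehom y(1) y(1)] y(2) z(2) by auto
    qed
    show "\<ominus>\<^bsub>Omega K v\<^esub> u \<in> ?e ` S" if u: "u \<in> ?e ` S" for u
    proof -
      obtain z j where z: "z \<in> carrier (local_closure K v)" "u = ?e z"
        "z [^]\<^bsub>local_closure K v\<^esub> ((2::nat) ^ j) = \<one>\<^bsub>local_closure K v\<^esub>" using u by (auto simp: S_def)
      let ?y = "\<ominus>\<^bsub>local_closure K v\<^esub> z"
      have yc: "?y \<in> carrier (local_closure K v)" using z(1) by simp
      have sq: "?y [^]\<^bsub>local_closure K v\<^esub> (2::nat) = z [^]\<^bsub>local_closure K v\<^esub> (2::nat)"
        using z(1) by (simp add: numeral_2_eq_2 L.l_minus L.r_minus)
      have "?y [^]\<^bsub>local_closure K v\<^esub> ((2::nat) ^ Suc j) = (?y [^]\<^bsub>local_closure K v\<^esub> (2::nat)) [^]\<^bsub>local_closure K v\<^esub> ((2::nat) ^ j)"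
        using yc by (simp add: L.nat_pow_pow)
      also have "\<dots> = (z [^]\<^bsub>local_closure K v\<^esub> ((2::nat) ^ j)) [^]\<^bsub>local_closure K v\<^esub> (2::nat)"
        unfolding sq using z(1) by (simp add: L.nat_pow_pow mult.commute)
      also have "\<dots> = \<one>\<^bsub>local_closure K v\<^esub>" using z(3) by simp
      finally have "?y \<in> S" using yc unfolding S_def by blast
      moreover have "\<ominus>\<^bsub>Omega K v\<^esub> u = ?e ?y"
      proof (rule Om.minus_equality)
        have "?e ?y \<oplus>\<^bsub>Omega K v\<^esub> ?e z = ?e (?y \<oplus>\<^bsub>local_closure K v\<^esub> z)"
          using ring_hom_add[OF ehom yc z(1)] by simp
        also have "\<dots> = \<zero>\<^bsub>Omega K v\<^esub>"
          using z(1) ring_hom_zero[OF ehom L.ring_axioms Om.ring_axioms] by (simp add: L.l_neg)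
        finally show "?e ?y \<oplus>\<^bsub>Omega K v\<^esub> u = \<zero>\<^bsub>Omega K v\<^esub>" using z(2) by simp
      qed (use z yc ring_hom_closed[OF ehom] in auto)
      ultimately show ?thesis by blast
    qed
    show "1 / 2 \<le> v 2" by (rule two)
  qed
qed

lemma place_exponent_pos: "number_field K \<Longrightarrow> v \<in> places K \<Longrightarrow> 0 < place_exponent K v"
  unfolding place_exponent_def using local_degree_pos nf_degree_pos by simp

text \<open>The roots of unity lie on the unit circle over which \<open>nu\<close> takes the
  supremum. \<open>S\<close> stays a real number because \<open>nu\<close> may be negative infinity;
  raising to the exponent of the place is monotone and carries the principle to normalised
  values.\<close>

lemma nu_maximum_modulus:
  assumes K: "number_field K" and v: "v \<in> places K"
    and T: "\<forall>i. Polynomial.coeff T i \<in> K" "Polynomial.degree T \<le> d"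
  obtains S where "0 \<le> S" "nu K v T = elog S"
    "\<And>x. x \<in> K \<Longrightarrow> nabs K v (poly T x) \<le> S * max 1 (nabs K v x) ^ d"
proof -
  obtain U where "modulus_field (Omega K v) (completion_abs (local_closure_abs K v)) K v (Omega_embed K v) U"
    using omega_modulus_field[OF K v] .
  then interpret modulus_field "Omega K v" "completion_abs (local_closure_abs K v)" K v "Omega_embed K v" U .
  let ?V = "completion_abs (local_closure_abs K v)"
  define e where "e = place_exponent K v"
  have e: "0 < e" unfolding e_def by (rule place_exponent_pos[OF K v])
  define C where "C = {z \<in> carrier (Omega K v). Omega_nabs K v z = 1}"
  have C: "z \<in> C \<longleftrightarrow> z \<in> carrier (Omega K v) \<and> ?V z = 1" for z
  proof -
    have "?V z powr e = 1 \<longleftrightarrow> ?V z = 1" if "z \<in> carrier (Omega K v)"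
    proof
      assume "?V z powr e = 1"
      then have "(?V z powr e) powr (1 / e) = 1" by simp
      then show "?V z = 1" using e v_nonneg[OF that] by (simp add: powr_powr)
    qed simp
    then show ?thesis by (auto simp: C_def Omega_nabs_def e_def)
  qed
  define S where "S = (SUP z\<in>C. ?V (ev T z) powr e)"
  have nu: "nu K v T = elog S"
    by (simp add: nu_def Omega_nu_def S_def C_def ev_def Omega_nabs_def e_def)
  obtain B where B: "\<And>z. z \<in> carrier (Omega K v) \<Longrightarrow> ?V z = 1 \<Longrightarrow> ?V (ev T z) \<le> B"
    using ev_bounded[OF T(1)] by blast
  have bdd: "bdd_above ((\<lambda>z. ?V (ev T z) powr e) ` C)"
    by (rule bdd_aboveI2[of _ _ "B powr e"]) (use B C T(1) e in \<open>auto intro!: powr_mono2\<close>)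
  have upper: "?V (ev T u) powr e \<le> S" if "u \<in> U" for u
    unfolding S_def using that C by (intro cSUP_upper[OF _ bdd]) auto
  have S0: "0 \<le> S" using upper[OF one_U] powr_ge_zero order_trans by blast
  \<comment> \<open>The bound before normalisation, as \<open>maximum_modulus\<close> speaks of the
    absolute value itself.\<close>
  define S' where "S' = S powr (1 / e)"
  have S': "S' powr e = S" using e S0 by (simp add: S'_def powr_powr)
  have ev_le: "?V (ev T u) \<le> S'" if u: "u \<in> U" for u
  proof -
    have nn: "0 \<le> ?V (ev T u)" using T(1) u by simp
    have "?V (ev T u) = (?V (ev T u) powr e) powr (1 / e)" using e nn by (simp add: powr_powr)
    also have "\<dots> \<le> S'" unfolding S'_def using upper[OF u] e by (intro powr_mono2) auto
    finally show ?thesis .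
  qed
  show ?thesis
  proof (rule that[OF S0 nu])
    fix x assume x: "x \<in> K"
    have "nabs K v (poly T x) = v (poly T x) powr e" by (simp add: nabs_def e_def)
    also have "\<dots> \<le> (S' * max 1 (v x) ^ d) powr e"
      using maximum_modulus[OF T ev_le x] T(1) x e by (intro powr_mono2) auto
    also have "\<dots> = S * (max 1 (v x) powr e) ^ d"
      using S' S0 by (simp add: powr_mult S'_def powr_powr powr_power mult.commute flip: powr_realpow)
    also have "max 1 (v x) powr e = max 1 (nabs K v x)"
    proof (cases "v x \<le> 1")
      case True
      then have "v x powr e \<le> 1" using e x by (simp add: powr_le1)
      then show ?thesis using True by (simp add: nabs_def e_def max_def)
    next
      case False
      then have "1 \<le> v x powr e" using e by (simp add: ge_one_powr_ge_zero)
      then show ?thesis using False by (simp add: nabs_def e_def max_def)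
    qed
    finally show "nabs K v (poly T x) \<le> S * max 1 (nabs K v x) ^ d" .
  qed
qed

section \<open>The height bound\<close>

text \<open>The Taylor coefficients at 1 are the coefficients of the polynomial after substituting X
  + 1.\<close>

lemma poly_taylor_at_1:
  fixes T :: "complex poly"
  shows "poly T (1 + z) = (\<Sum>k\<le>Polynomial.degree T. poly ((pderiv ^^ k) T) 1 / fact k * z ^ k)"
proof -
  define Q where "Q = pcompose T [:1, 1:]"
  have der: "(pderiv ^^ k) Q = pcompose ((pderiv ^^ k) T) [:1, 1:]" for k
    by (induction k) (simp_all add: Q_def pderiv_pcompose pderiv_pCons)
  have co: "Polynomial.coeff Q k = poly ((pderiv ^^ k) T) 1 / fact k" for k
  proof -
    have "poly ((pderiv ^^ k) T) 1 = Polynomial.coeff ((pderiv ^^ k) Q) 0"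
      unfolding der by (simp add: poly_pcompose flip: poly_0_coeff_0)
    also have "\<dots> = fact k * Polynomial.coeff Q k"
      by (simp add: coeff_higher_pderiv pochhammer_fact)
    finally show ?thesis by simp
  qed
  have "poly T (1 + z) = poly Q z" by (simp add: Q_def poly_pcompose)
  also have "\<dots> = (\<Sum>k\<le>Polynomial.degree Q. Polynomial.coeff Q k * z ^ k)" by (rule poly_altdef)
  also have "\<dots> = (\<Sum>k\<le>Polynomial.degree T. Polynomial.coeff Q k * z ^ k)"
    using degree_pcompose_le[of T "[:1, 1:]"] by (intro sum.mono_neutral_left) (auto simp: Q_def coeff_eq_0)
  finally show ?thesis by (simp add: co)
qed

context
  fixes K :: "complex set"
  assumes K: "number_field K"
begin

section \<open>Normalised absolute values and sums over places\<close>

lemma places_subfield_abs: assumes "v \<in> places K" shows "subfield_abs K v"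
  using place_of_places[OF K assms] place_over.axioms(1) by blast

lemma nabs_mult:
  assumes "v \<in> places K" "x \<in> K" "y \<in> K" shows "nabs K v (x * y) = nabs K v x * nabs K v y"
proof -
  interpret subfield_abs K v by (rule places_subfield_abs[OF assms(1)])
  show ?thesis using assms by (simp add: nabs_def powr_mult)
qed

lemma nabs_one: assumes "v \<in> places K" shows "nabs K v 1 = 1"
  using subfield_abs.abs_one[OF places_subfield_abs[OF assms]] by (simp add: nabs_def)

lemma nabs_power: assumes "v \<in> places K" "x \<in> K" shows "nabs K v (x ^ n) = nabs K v x ^ n"
proof -
  interpret subfield_abs K v by (rule places_subfield_abs[OF assms(1)])
  show ?thesis by (induction n) (use assms nabs_one nabs_mult in auto)
qed

lemma nabs_uminus: assumes "v \<in> places K" "x \<in> K" shows "nabs K v (- x) = nabs K v x"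
  using subfield_abs.abs_uminus[OF places_subfield_abs[OF assms(1)] assms(2)] by (simp add: nabs_def)

lemma nabs_nonneg: "0 \<le> nabs K v x"
  by (simp add: nabs_def)

lemma nabs_pos: assumes "v \<in> places K" "x \<in> K" "x \<noteq> 0" shows "0 < nabs K v x"
  using subfield_abs.abs_pos[OF places_subfield_abs[OF assms(1)] assms(2,3)] by (simp add: nabs_def)

lemma ln_nabs: assumes "v \<in> places K" "x \<in> K" "x \<noteq> 0"
  shows "ln (nabs K v x) = local_degree K v * ln (v x) / nf_degree K"
  using subfield_abs.abs_pos[OF places_subfield_abs[OF assms(1)] assms(2,3)]
  by (simp add: nabs_def place_exponent_def ln_powr)

lemma log_product_formula:
  assumes x: "x \<in> K" "x \<noteq> 0"
    and W: "finite W" "W \<subseteq> finite_places K" "\<And>v. v \<in> finite_places K \<Longrightarrow> v x \<noteq> 1 \<Longrightarrow> v \<in> W"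
  shows "(\<Sum>v\<in>W. ln (nabs K v x)) + (\<Sum>v\<in>infinite_places K. ln (nabs K v x)) = 0"
proof -
  have pos: "0 < v x" if "v \<in> places K" for v
    using subfield_abs.abs_pos[OF places_subfield_abs[OF that] x] .
  have sub: "W \<subseteq> places K" "infinite_places K \<subseteq> places K" using W by (auto simp: places_def)
  have log: "(\<Sum>v\<in>I. ln (nabs K v x)) = ln (\<Prod>v\<in>I. v x ^ local_degree K v) / nf_degree K"
    if "finite I" "I \<subseteq> places K" for I
  proof -
    have "ln (\<Prod>v\<in>I. v x ^ local_degree K v) = (\<Sum>v\<in>I. ln (v x ^ local_degree K v))"
    proof (rule ln_prod[OF that(1)])
      fix v assume "v \<in> I"
      then have "0 < v x" using that(2) pos by blast
      then show "v x ^ local_degree K v \<noteq> 0" by simp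
    qed
    also have "\<dots> = (\<Sum>v\<in>I. local_degree K v * ln (v x))"
      using that pos by (intro sum.cong) (auto simp: ln_realpow)
    finally have "ln (\<Prod>v\<in>I. v x ^ local_degree K v) / nf_degree K = (\<Sum>v\<in>I. local_degree K v * ln (v x) / nf_degree K)"
      by (simp add: sum_divide_distrib)
    also have "\<dots> = (\<Sum>v\<in>I. ln (nabs K v x))"
      using that x by (intro sum.cong) (auto simp: ln_nabs subset_iff)
    finally show ?thesis by simp
  qed
  have pp: "0 < (\<Prod>v\<in>I. v x ^ local_degree K v)" if "I \<subseteq> places K" for I
    using that pos by (intro prod_pos) auto
  have "ln (\<Prod>v\<in>W. v x ^ local_degree K v) + ln (\<Prod>v\<in>infinite_places K. v x ^ local_degree K v) = ln 1"
    using ln_mult_pos[OF pp[OF sub(1)] pp[OF sub(2)]] product_formula[OF K x W] by simp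
  then show ?thesis
    using log[OF W(1) sub(1)] log[OF finite_infinite_places[OF K] sub(2)] by (simp flip: add_divide_distrib)
qed

lemma finite_places_integers: assumes "v \<in> finite_places K" shows "v (of_nat n) \<le> 1"
proof -
  obtain p where "prime p" "v \<in> padic_places K p" using assms by (auto simp: finite_places_Union[OF K])
  then show ?thesis using padic_place_integers[of p K v] by (simp add: padic_places_def)
qed

lemma finite_infinite_disjoint: "finite_places K \<inter> infinite_places K = {}"
proof (rule ccontr)
  assume "\<not> ?thesis"
  then obtain v where v: "v \<in> finite_places K" "v \<in> infinite_places K" by blast
  then have "place_over K v (\<lambda>q. \<bar>of_rat q\<bar>)" using infinite_places_eq[OF K] by blast
  then have "v (of_rat 2) = \<bar>of_rat 2\<bar>" by (rule place_over.abs_of_rat)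
  then show False using finite_places_integers[OF v(1), of 2] by simp
qed

text \<open>A positive power of an ultrametric absolute value still satisfies the maximum
  inequality.\<close>

lemma nabs_ultrametric_sum:
  assumes v: "v \<in> finite_places K" and "0 \<le> M"
    and f: "\<And>i. i \<in> I \<Longrightarrow> f i \<in> K" "\<And>i. i \<in> I \<Longrightarrow> nabs K v (f i) \<le> M"
  shows "nabs K v (\<Sum>i\<in>I. f i) \<le> M"
proof -
  have vp: "v \<in> places K" using v by (simp add: places_def)
  interpret subfield_abs K v by (rule places_subfield_abs[OF vp])
  define e where "e = place_exponent K v"
  have e: "0 < e" unfolding e_def by (rule place_exponent_pos[OF K vp])
  have "v (\<Sum>i\<in>I. f i) \<le> M powr (1 / e)"
  proof (rule ultrametric_sum[OF finite_places_integers[OF v]])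
    fix i assume i: "i \<in> I"
    have "v (f i) = (v (f i) powr e) powr (1 / e)" using e f(1)[OF i] by (simp add: powr_powr)
    also have "\<dots> \<le> M powr (1 / e)"
      using f(2)[OF i] e by (intro powr_mono2) (auto simp: nabs_def e_def)
    finally show "v (f i) \<le> M powr (1 / e)" .
  qed (use f in auto)
  then have "v (\<Sum>i\<in>I. f i) powr e \<le> (M powr (1 / e)) powr e"
    using e f(1) by (intro powr_mono2) auto
  then show ?thesis using e assms(2) by (simp add: nabs_def e_def powr_powr)
qed

lemma infsum_ereal_finite_support:
  fixes F :: "'a \<Rightarrow> real"
  assumes "finite W" "W \<subseteq> A" "\<And>x. x \<in> A \<Longrightarrow> x \<notin> W \<Longrightarrow> F x = 0" "\<And>x. x \<in> A \<Longrightarrow> G x = ereal (F x)"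
  shows "infsum G A = ereal (\<Sum>x\<in>W. F x)"
proof -
  have "infsum G A = infsum (\<lambda>x. ereal (F x)) W"
    by (rule infsum_cong_neutral) (use assms in auto)
  then show ?thesis using assms(1) by simp
qed

lemma max_elog: "0 \<le> t \<Longrightarrow> max 0 (elog t) = ereal (ln (max 1 t))"
  by (auto simp: elog_def max_def not_le)

text \<open>All three global quantities are reduced to finite real sums over one common set of
  places; the local estimates for \<open>y\<close> are then summed against the logarithmic product
  formula.\<close>

lemma height_bound:
  assumes m: "m \<in> K" and \<alpha>: "\<alpha> \<in> K" and f: "\<forall>i. Polynomial.coeff f i \<in> K"
    and T: "\<forall>i. Polynomial.coeff T i \<in> K" and f0: "f \<noteq> 0" and n: "Polynomial.degree f = n"
    and cong: "poly_cong K f (Polynomial.monom 1 n - 1) m" and root: "poly f \<alpha> = 0"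
    and deg: "0 < Polynomial.degree T" and nz: "poly T (\<alpha> ^ n) \<noteq> 0"
  shows "(omega K m T - nu_infinity K T) / ereal (real n * real (Polynomial.degree T)) \<le> weil_height K \<alpha>"
proof -
  define D where "D = Polynomial.degree T"
  define y where "y = poly T (\<alpha> ^ n)"
  define c where "c k = m ^ k * poly ((pderiv ^^ k) T) 1 / fact k" for k
  define A where "A v = max 1 (nabs K v \<alpha>)" for v
  define M where "M v = (MAX k\<in>{0..D}. nabs K v (c k))" for v
  obtain v0 where "v0 \<in> infinite_places K"
  proof -
    have "infinite_places K \<noteq> {}"
    proof
      assume "infinite_places K = {}"
      obtain \<theta> g where tg: "minpoly \<theta> g" "K = Qadj \<theta>" using number_field_primitive[OF K] .
      interpret number_field_places K \<theta> g UNIV norm "\<lambda>q. \<bar>of_rat q\<bar>"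
        by (intro number_field_places.intro K tg place_over_UNIV) auto
      have "\<theta> \<in> Z" using tg(1) by (simp add: Z_def minpoly_def)
      then have "above \<noteq> {}" using above_eq(1) by blast
      then show False using \<open>infinite_places K = {}\<close> unfolding above_def infinite_places_eq[OF K] by blast
    qed
    then show ?thesis using that by blast
  qed
  then have v0: "v0 \<in> places K" by (simp add: places_def)
  interpret K: subfield_abs K v0 by (rule places_subfield_abs[OF v0])
  \<comment> \<open>A nonzero constant has no root, so the denominator is positive.\<close>
  have n0: "0 < n"
  proof (rule ccontr)
    assume "\<not> 0 < n"
    then obtain b where "f = [:b:]" using degree_0_id n by (metis gr0I)
    then show False using root f0 by simp
  qed
  have an: "\<alpha> ^ n \<in> K" using \<alpha> by simp
  have y: "y \<in> K" "y \<noteq> 0" unfolding y_def using T an nz K.poly_mem by auto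
  have derK: "poly ((pderiv ^^ k) T) 1 \<in> K" for k
  proof -
    have "\<forall>i. Polynomial.coeff ((pderiv ^^ k) T) i \<in> K"
    proof (induction k)
      case (Suc k)
      then show ?case using K.mult_mem[OF K.of_nat_mem] by (simp add: coeff_pderiv del: of_nat_Suc)
    qed (use T in simp)
    then show ?thesis by (intro K.poly_mem) auto
  qed
  have factK: "fact k \<in> K" for k using K.of_nat_mem[of "fact k"] by simp
  have cK: "c k \<in> K" for k unfolding c_def using m derK factK by simp
  have A1: "1 \<le> A v" for v by (simp add: A_def)
  have fin_le: "M v > 0 \<and> ln (nabs K v y) \<le> ln (M v) + real n * real D * ln (A v)" if v: "v \<in> finite_places K" for v
  proof -
    have vp: "v \<in> places K" using v by (simp add: places_def)
    define P where "P = f - (Polynomial.monom 1 n - 1)"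
    have PK: "\<forall>i. Polynomial.coeff P i \<in> K" unfolding P_def using f by (simp add: coeff_1)
    have dm: "Polynomial.degree (Polynomial.monom (1::complex) n - 1) \<le> n"
      by (intro degree_diff_le degree_monom_le) simp
    have degP: "Polynomial.degree P \<le> n"
      unfolding P_def by (rule degree_diff_le[OF _ dm]) (simp add: n)
    obtain S where S: "0 \<le> S" "nu K v P = elog S"
      "\<And>x. x \<in> K \<Longrightarrow> nabs K v (poly P x) \<le> S * max 1 (nabs K v x) ^ n"
      using nu_maximum_modulus[OF K vp PK degP] by blast
    have "nu K v P \<le> elog (nabs K v m)"
      using cong v unfolding poly_cong_def P_def by blast
    then have "elog S \<le> elog (nabs K v m)" unfolding S(2) .
    \<comment> \<open>The case distinctions in \<open>elog\<close> cover \<open>m = 0\<close> and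
      \<open>S = 0\<close>.\<close>
    then have Sm: "S \<le> nabs K v m"
      using S(1) nabs_nonneg[of v m] by (auto simp: elog_def split: if_splits)
    define z where "z = \<alpha> ^ n - 1"
    have zK: "z \<in> K" using an by (simp add: z_def)
    have "poly P \<alpha> = - z" using root by (simp add: P_def z_def poly_monom)
    then have "nabs K v z \<le> S * A v ^ n"
      using S(3)[OF \<alpha>] nabs_uminus[OF vp zK] by (simp add: A_def)
    also have "\<dots> \<le> nabs K v m * A v ^ n" using Sm A1[of v] by (intro mult_right_mono) auto
    finally have z: "nabs K v z \<le> nabs K v m * A v ^ n" .
    have Mge: "nabs K v (c k) \<le> M v" if "k \<le> D" for k
      unfolding M_def using that by (intro Max_ge) auto
    have M0: "0 \<le> M v" using Mge[of 0] nabs_nonneg[of v "c 0"] by linarith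
    have "y = (\<Sum>k\<le>D. poly ((pderiv ^^ k) T) 1 / fact k * z ^ k)"
      using poly_taylor_at_1[of T z] by (simp add: y_def z_def D_def)
    also have "nabs K v \<dots> \<le> M v * A v ^ (n * D)"
    proof (rule nabs_ultrametric_sum[OF v])
      show "0 \<le> M v * A v ^ (n * D)" using M0 A1[of v] by simp
      fix k assume k: "k \<in> {..D}"
      let ?b = "poly ((pderiv ^^ k) T) 1 / fact k"
      have bK: "?b \<in> K" using derK factK by simp
      show "?b * z ^ k \<in> K" by (rule K.mult_mem[OF bK K.power_mem[OF zK]])
      have "nabs K v (?b * z ^ k) = nabs K v ?b * nabs K v z ^ k"
        by (simp only: nabs_mult[OF vp bK K.power_mem[OF zK]] nabs_power[OF vp zK])
      also have "\<dots> \<le> nabs K v ?b * (nabs K v m * A v ^ n) ^ k"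
        using z by (intro mult_left_mono power_mono nabs_nonneg)
      also have "\<dots> = nabs K v (c k) * A v ^ (n * k)"
      proof -
        have "c k = ?b * m ^ k" by (simp add: c_def)
        then have "nabs K v (c k) = nabs K v ?b * nabs K v m ^ k"
          by (simp only: nabs_mult[OF vp bK K.power_mem[OF m]] nabs_power[OF vp m])
        then show ?thesis by (simp add: power_mult_distrib power_mult)
      qed
      also have "\<dots> \<le> M v * A v ^ (n * D)"
        using Mge[of k] k A1[of v] M0 by (intro mult_mono power_increasing) (auto simp: nabs_nonneg)
      finally show "nabs K v (?b * z ^ k) \<le> M v * A v ^ (n * D)" .
    qed
    finally have le: "nabs K v y \<le> M v * A v ^ (n * D)" .
    have ypos: "0 < nabs K v y" by (rule nabs_pos[OF vp y])
    have Apos: "0 < A v" using A1[of v] by simp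
    \<comment> \<open>Here \<open>y\<close> being nonzero is used: otherwise all Taylor terms could
      vanish and the logarithm would be negative infinity.\<close>
    have Mpos: "0 < M v"
      using le ypos M0 by (cases "M v = 0") auto
    have "ln (nabs K v y) \<le> ln (M v * A v ^ (n * D))" using le ypos by simp
    also have "\<dots> = ln (M v) + real n * real D * ln (A v)"
      using Mpos Apos by (simp add: ln_mult ln_realpow)
    finally show ?thesis using Mpos by simp
  qed
  have "\<exists>s. 0 < s \<and> nu K v T = elog s \<and> ln (nabs K v y) \<le> ln s + real n * real D * ln (A v)" if v: "v \<in> infinite_places K" for v
  proof -
    have vp: "v \<in> places K" using v by (simp add: places_def)
    obtain S where S: "0 \<le> S" "nu K v T = elog S"
      "\<And>x. x \<in> K \<Longrightarrow> nabs K v (poly T x) \<le> S * max 1 (nabs K v x) ^ D"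
      using nu_maximum_modulus[OF K vp T, of D] unfolding D_def by blast
    have "max 1 (nabs K v (\<alpha> ^ n)) = A v ^ n"
    proof (cases "nabs K v \<alpha> \<le> 1")
      case True
      then have "nabs K v \<alpha> ^ n \<le> 1" by (simp add: nabs_nonneg power_le_one)
      then show ?thesis using True by (simp add: A_def nabs_power[OF vp \<alpha>] max_def)
    next
      case False
      then have "1 \<le> nabs K v \<alpha> ^ n" by (intro one_le_power) simp
      then show ?thesis using False by (simp add: A_def nabs_power[OF vp \<alpha>] max_def)
    qed
    then have le: "nabs K v y \<le> S * A v ^ (n * D)"
      using S(3)[OF an] by (simp add: y_def power_mult)
    have ypos: "0 < nabs K v y" by (rule nabs_pos[OF vp y])
    have Apos: "0 < A v" using A1[of v] by simp
    have Spos: "0 < S" using le ypos S(1) by (cases "S = 0") auto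
    have "ln (nabs K v y) \<le> ln (S * A v ^ (n * D))" using le ypos by simp
    also have "\<dots> = ln S + real n * real D * ln (A v)"
      using Spos Apos by (simp add: ln_mult ln_realpow)
    finally show ?thesis using Spos S(2) by blast
  qed
  then obtain s where s: "\<And>v. v \<in> infinite_places K \<Longrightarrow> 0 < s v" "\<And>v. v \<in> infinite_places K \<Longrightarrow> nu K v T = elog (s v)"
    "\<And>v. v \<in> infinite_places K \<Longrightarrow> ln (nabs K v y) \<le> ln (s v) + real n * real D * ln (A v)"
    by metis
  let ?supp = "\<lambda>x. {v \<in> finite_places K. v x \<noteq> 1}"
  \<comment> \<open>Outside this finite set \<open>y\<close>, \<alpha> and all Taylor terms
    \<open>c k\<close> are zero or of absolute value 1, so every logarithm in question vanishes
    there.\<close>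
  define W where "W = ?supp y \<union> (if \<alpha> = 0 then {} else ?supp \<alpha>) \<union> (\<Union>k\<in>{k \<in> {0..D}. c k \<noteq> 0}. ?supp (c k))"
  have W: "finite W" "W \<subseteq> finite_places K"
    unfolding W_def using finite_support[OF K] y \<alpha> cK by auto
  have Wy: "v \<in> W" if "v \<in> finite_places K" "v y \<noteq> 1" for v using that by (auto simp: W_def)
  have WA: "ln (A v) = 0" if v: "v \<in> finite_places K" "v \<notin> W" for v
  proof (cases "\<alpha> = 0")
    case True
    have "v 0 = 0" using subfield_abs.abs_zero[OF places_subfield_abs] v by (simp add: places_def)
    then show ?thesis using True by (simp add: A_def nabs_def)
  next
    case False
    then have "v \<alpha> = 1" using v by (auto simp: W_def)
    then show ?thesis by (simp add: A_def nabs_def)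
  qed
  have WM: "ln (M v) = 0" if v: "v \<in> finite_places K" "v \<notin> W" for v
  proof -
    have v0: "v 0 = 0" using subfield_abs.abs_zero[OF places_subfield_abs] v by (simp add: places_def)
    have c01: "nabs K v (c k) = (if c k = 0 then 0 else 1)" if "k \<in> {0..D}" for k
      using v that v0 by (auto simp: W_def nabs_def)
    have "M v \<in> (\<lambda>k. nabs K v (c k)) ` {0..D}" unfolding M_def by (intro Max_in) auto
    then obtain k where "k \<in> {0..D}" "M v = nabs K v (c k)" by blast
    \<comment> \<open>Each candidate is 0 or 1, and positivity from \<open>fin_le\<close> excludes
      0.\<close>
    then have "M v = 1" using c01[of k] fin_le[OF v(1)] by (auto split: if_splits)
    then show ?thesis by simp
  qed
  let ?I = "infinite_places K"
  have finI: "finite ?I" by (rule finite_infinite_places[OF K])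
  have omega: "omega K m T = ereal (- (\<Sum>v\<in>W. ln (M v)))"
  proof -
    have "(\<Sum>\<^sub>\<infinity>v\<in>finite_places K. elog (MAX k\<in>{0..Polynomial.degree T}. nabs K v (m ^ k * poly ((pderiv ^^ k) T) 1 / fact k))) =
        ereal (\<Sum>v\<in>W. ln (M v))"
    proof (rule infsum_ereal_finite_support[OF W WM])
      fix v assume v: "v \<in> finite_places K"
      have "0 < M v" using fin_le[OF v] by simp
      then have "elog (M v) = ereal (ln (M v))" by (simp add: elog_def)
      then show "elog (MAX k\<in>{0..Polynomial.degree T}. nabs K v (m ^ k * poly ((pderiv ^^ k) T) 1 / fact k)) = ereal (ln (M v))"
        by (simp add: M_def c_def D_def)
    qed
    then show ?thesis by (simp add: omega_def)
  qed
  have "nu_infinity K T = (\<Sum>v\<in>?I. ereal (ln (s v)))"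
    unfolding nu_infinity_def by (rule sum.cong[OF refl]) (use s in \<open>force simp: elog_def\<close>)
  then have nu: "nu_infinity K T = ereal (\<Sum>v\<in>?I. ln (s v))" by simp
  have "weil_height K \<alpha> = ereal (\<Sum>v\<in>W \<union> ?I. ln (A v))"
    unfolding weil_height_def
  proof (rule infsum_ereal_finite_support)
    show "finite (W \<union> ?I)" using W finI by simp
    show "W \<union> ?I \<subseteq> places K" using W by (auto simp: places_def)
    show "ln (A v) = 0" if "v \<in> places K" "v \<notin> W \<union> ?I" for v using WA that by (auto simp: places_def)
    show "max 0 (elog (nabs K v \<alpha>)) = ereal (ln (A v))" for v
      unfolding A_def by (rule max_elog[OF nabs_nonneg])
  qed
  moreover have "(\<Sum>v\<in>W \<union> ?I. ln (A v)) = (\<Sum>v\<in>W. ln (A v)) + (\<Sum>v\<in>?I. ln (A v))"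
    using W finI finite_infinite_disjoint by (intro sum.union_disjoint) auto
  ultimately have height: "weil_height K \<alpha> = ereal ((\<Sum>v\<in>W. ln (A v)) + (\<Sum>v\<in>?I. ln (A v)))" by simp
  have nD: "0 < real n * real D" using n0 deg by (simp add: D_def)
  have "0 = (\<Sum>v\<in>W. ln (nabs K v y)) + (\<Sum>v\<in>?I. ln (nabs K v y))"
    using log_product_formula[OF y W Wy] by simp
  also have "\<dots> \<le> (\<Sum>v\<in>W. ln (M v) + real n * real D * ln (A v)) + (\<Sum>v\<in>?I. ln (s v) + real n * real D * ln (A v))"
    using fin_le W s(3) by (intro add_mono sum_mono) auto
  also have "\<dots> = (\<Sum>v\<in>W. ln (M v)) + (\<Sum>v\<in>?I. ln (s v)) +
      real n * real D * ((\<Sum>v\<in>W. ln (A v)) + (\<Sum>v\<in>?I. ln (A v)))"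
    by (simp add: sum.distrib sum_distrib_left[symmetric] algebra_simps)
  finally have "- (\<Sum>v\<in>W. ln (M v)) - (\<Sum>v\<in>?I. ln (s v)) \<le>
      real n * real D * ((\<Sum>v\<in>W. ln (A v)) + (\<Sum>v\<in>?I. ln (A v)))" by linarith
  then have "(- (\<Sum>v\<in>W. ln (M v)) - (\<Sum>v\<in>?I. ln (s v))) / (real n * real D) \<le>
      (\<Sum>v\<in>W. ln (A v)) + (\<Sum>v\<in>?I. ln (A v))"
    using nD by (simp add: pos_divide_le_eq mult.commute)
  moreover have "0 < D" using deg by (simp add: D_def)
  ultimately show ?thesis
    unfolding omega nu height D_def[symmetric] using n0 by simp
qed

end

theorem theorem3p1:
  fixes K :: "complex set" and m \<alpha> :: complex and f T :: "complex poly" and n :: nat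
  assumes "number_field K"
    and "m \<in> K" and "\<alpha> \<in> K"
    and "\<forall>i. Polynomial.coeff f i \<in> K" and "\<forall>i. Polynomial.coeff T i \<in> K"
    and "f \<noteq> 0" and "Polynomial.degree f = n"
    and "poly_cong K f (Polynomial.monom 1 n - 1) m"
    and "poly f \<alpha> = 0"
    and "Polynomial.degree T > 0"
    and "poly T (\<alpha> ^ n) \<noteq> 0"
  shows "weil_height K \<alpha> \<ge>
           (omega K m T - nu_infinity K T) / ereal (real n * real (Polynomial.degree T))"
  using height_bound assms by blast

end
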